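(* Let $R:\mathbb{R}^n\to\mathbb{Z}^n$ be a quantizer, let $L\in\mathbb{R}^{n\times n}$ be nonsingular, let $T=R\circ L:\mathbb{Z}^n\to\mathbb{Z}^n$, and let $\widetilde{T}=\widetilde{R}\circ L^{-1}$ be the transition operator of the compensating system. Suppose the matrix $L$ is iteratively nonresonant. Then the sequence of the set-valued maps $\Sigma_N:\mathbb{Z}^n\to\widetilde{\Pi}$, $\Sigma_N(x)=T^{-N}(x)-\widetilde{T}^N(x)$, is a homogeneous Markov chain with respect to the filtration $\{\mathcal{Q}_N^-\}_{N\ge1}$ with the transition kernel $\Delta(\cdot\mid\cdot)$. More precisely, for any $N\in\mathbb{N}$ and any finite subsets $B_1,\ldots,B_N\in\widetilde{\Pi}$ of $\mathbb{Z}^n$, $$\bigcap_{k=1}^N\Sigma_k^{-1}(B_k)=\{x\in\mathbb{Z}^n:\ \Sigma_k(x)=B_k\text{ for all }k=1,\ldots,N\}\in\mathcal{Q}_N^-$$ and $$\mathbf{F}\Big(\bigcap_{k=1}^N\Sigma_k^{-1}(B_k)\Big)=\prod_{k=1}^N\Delta(B_k\mid B_{k-1}),\qquad B_0:=\{0\}.$$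
   Context: Frequency. For $a\in\mathbb{Z}^n$ and $\ell\in\mathbb{N}^n$ let $P_{a,\ell}=\{x\in\mathbb{Z}^n:\ a_k\le x_k<a_k+\ell_k \text{ for all }1\le k\le n\}$, and for $N\in\mathbb{N}$ let $\mathcal{P}_N=\{P_{a,\ell}:\ a\in\mathbb{Z}^n,\ \ell\in\mathbb{N}^n,\ \min_k\ell_k\ge N\}$. For $A\subset\mathbb{Z}^n$ put $\mathbf{F}_*(A)=\sup_{N\ge1}\inf_{P\in\mathcal{P}_N}\frac{\#(A\cap P)}{\#P}$ and $\mathbf{F}^*(A)=\inf_{N\ge1}\sup_{P\in\mathcal{P}_N}\frac{\#(A\cap P)}{\#P}$. The set $A$ is frequency measurable if $\mathbf{F}_*(A)=\mathbf{F}^*(A)$; the common value is the frequency $\mathbf{F}(A)$. System. A quantizer is a map $R:\mathbb{R}^n\to\mathbb{Z}^n$ such that $R(u+z)=R(u)+z$ for all $u\in\mathbb{R}^n$, $z\in\mathbb{Z}^n$, and the set $R^{-1}(0)$ is Jordan measurable (bounded with boundary of zero Lebesgue measure). Let $\mu=\int_{R^{-1}(0)}u\,\mathrm{d}u$. The compensating system has the transition operator $\widetilde{T}=\widetilde{R}\circ L^{-1}:\mathbb{Z}^n\to\mathbb{Z}^n$, where $\widetilde{R}(u)=R(u+(I_n+L^{-1})\mu)$, so that $\widetilde{R}^{-1}(0)=R^{-1}(0)-(I_n+L^{-1})\mu$. $T^{-N}(x)=\{y\in\mathbb{Z}^n: T^N(y)=x\}$ is a finite (possibly empty) set, and $T^{-N}(x)-\widetilde{T}^N(x)$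 is its translate by the vector $-\widetilde{T}^N(x)$. Kernel. $\widetilde{\Pi}$ is the class of all finite subsets of $\mathbb{Z}^n$ (including $\emptyset$). For $A,B\in\widetilde{\Pi}$, $$\Delta(B\mid A)=\mathrm{mes}_n\big\{u\in\widetilde{R}^{-1}(0):\ \mathbb{Z}^n\cap\big(u+L^{-1}(A+R^{-1}(0))\big)=B\big\},$$ where $A+R^{-1}(0)$ is the Minkowski sum and $\mathrm{mes}_n$ the Lebesgue measure. Algebras. For $m\in\mathbb{N}$, $G\subset\mathbb{R}^m$ and $\Lambda\in\mathbb{R}^{m\times n}$ let $Q_m(G,\Lambda)=\{x\in\mathbb{Z}^n:\ \Lambda x\in G+\mathbb{Z}^m\}$ and $\mathcal{Q}_m(\Lambda)=\{Q_m(G,\Lambda):\ G\subset[0,1)^m\text{ Jordan measurable}\}$. For $N\in\mathbb{N}$, $\mathcal{Q}_N^-=\mathcal{Q}_{Nn}(\mathcal{L}_N^-)$, where $\mathcal{L}_N^-\in\mathbb{R}^{Nn\times n}$ is obtained by stacking $L^{-N},\ldots,L^{-1}$. Nonresonance. $\Lambda\in\mathbb{R}^{m\times n}$ is nonresonant if the rows of $\begin{bmatrix}I_n\\ \Lambda\end{bmatrix}$ are linearly independent over the rationals. A nonsingular $L$ is iteratively nonresonant if every finite submatrix (formed from finitely many rows with distinct indices) of the infinite matrix obtained by stacking all nonzero integer powers $L^k$, $k\in\mathbb{Z}\setminus\{0\}$, is nonresonant. *)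

theory Defs
  imports "HOL-Analysis.Analysis"
begin

definition real_vec :: "int ^ 'n \<Rightarrow> real ^ 'n" where
  "real_vec z = (\<chi> i. real_of_int (z $ i))"

definition lattice_box :: "int ^ 'n \<Rightarrow> nat ^ 'n \<Rightarrow> (int ^ 'n) set" where
  "lattice_box a l = {x. \<forall>k. a $ k \<le> x $ k \<and> x $ k < a $ k + int (l $ k)}"

definition lattice_boxes :: "nat \<Rightarrow> (int ^ 'n) set set" where
  "lattice_boxes N = {lattice_box a l | a l. \<forall>k. N \<le> l $ k}"

text \<open>For \<open>N \<ge> 1\<close> every box in \<open>lattice_boxes N\<close> is nonempty and finite, and all ratios below
  lie in \<open>[0, 1]\<close>, so that the real-valued suprema and infima are the genuine ones.\<close>

definition lower_freq :: "(int ^ 'n) set \<Rightarrow> real" where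
  "lower_freq A = (SUP N\<in>{1..}. INF P\<in>lattice_boxes N. real (card (A \<inter> P)) / real (card P))"

definition upper_freq :: "(int ^ 'n) set \<Rightarrow> real" where
  "upper_freq A = (INF N\<in>{1..}. SUP P\<in>lattice_boxes N. real (card (A \<inter> P)) / real (card P))"

definition freq_measurable :: "(int ^ 'n) set \<Rightarrow> bool" where
  "freq_measurable A \<longleftrightarrow> lower_freq A = upper_freq A"

text \<open>Meaningful only for frequency measurable sets.\<close>

definition freq :: "(int ^ 'n) set \<Rightarrow> real" where
  "freq A = lower_freq A"

definition jordan_measurable :: "'a::euclidean_space set \<Rightarrow> bool" where
  "jordan_measurable S \<longleftrightarrow> bounded S \<and> negligible (frontier S)"

text \<open>The same notion for subsets of the space of real vectors with coordinates indexed by a finite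
  set \<open>I\<close>. Such vectors are extensional functions, so that the dimension \<open>card I\<close> may vary.\<close>

definition jordan_measurable_on :: "'i set \<Rightarrow> ('i \<Rightarrow> real) set \<Rightarrow> bool" where
  "jordan_measurable_on I G \<longleftrightarrow>
     G \<subseteq> (\<Pi>\<^sub>E i\<in>I. UNIV) \<and>
     (\<exists>C. \<forall>g\<in>G. \<forall>i\<in>I. \<bar>g i\<bar> \<le> C) \<and>
     product_topology (\<lambda>_. euclidean) I frontier_of G \<in> null_sets (\<Pi>\<^sub>M i\<in>I. lborel)"

text \<open>The overloaded power on \<open>real ^ 'n ^ 'n\<close> is componentwise and must not be used here.\<close>

definition matrix_powi :: "real ^ 'n ^ 'n \<Rightarrow> int \<Rightarrow> real ^ 'n ^ 'n" where
  "matrix_powi L k =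
     (if 0 \<le> k then ((\<lambda>M. L ** M) ^^ nat k) (mat 1)
      else ((\<lambda>M. matrix_inv L ** M) ^^ nat (- k)) (mat 1))"

text \<open>A matrix with \<open>n\<close> columns is given by the family \<open>r\<close> of its rows, indexed by a finite set
  \<open>I\<close>. Independence is that of the family, so equal rows with distinct indices are dependent.\<close>

definition rat_independent :: "'i set \<Rightarrow> ('i \<Rightarrow> real ^ 'n) \<Rightarrow> bool" where
  "rat_independent I r \<longleftrightarrow>
     (\<forall>c :: 'i \<Rightarrow> rat. (\<Sum>i\<in>I. of_rat (c i) *\<^sub>R r i) = 0 \<longrightarrow> (\<forall>i\<in>I. c i = 0))"

definition nonresonant :: "'i set \<Rightarrow> ('i \<Rightarrow> real ^ 'n) \<Rightarrow> bool" where
  "nonresonant I r \<longleftrightarrow>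
     rat_independent ((UNIV :: 'n set) <+> I) (case_sum (\<lambda>j. row j (mat 1 :: real ^ 'n ^ 'n)) r)"

text \<open>The row with index \<open>(k, i)\<close> of the stacked powers is the \<open>i\<close>-th row of \<open>L\<^sup>k\<close>.\<close>

definition power_rows :: "real ^ 'n ^ 'n \<Rightarrow> int \<times> 'n \<Rightarrow> real ^ 'n" where
  "power_rows L = (\<lambda>(k, i). row i (matrix_powi L k))"

definition iteratively_nonresonant :: "real ^ 'n ^ 'n \<Rightarrow> bool" where
  "iteratively_nonresonant L \<longleftrightarrow>
     (\<forall>F. finite F \<and> F \<subseteq> (UNIV - {0}) \<times> UNIV \<longrightarrow> nonresonant F (power_rows L))"

definition quasiperiodic_set :: "'i set \<Rightarrow> ('i \<Rightarrow> real ^ 'n) \<Rightarrow> ('i \<Rightarrow> real) set \<Rightarrow> (int ^ 'n) set" where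
  "quasiperiodic_set I r G =
     {x. \<exists>g\<in>G. \<exists>z :: 'i \<Rightarrow> int. \<forall>i\<in>I. r i \<bullet> real_vec x = g i + real_of_int (z i)}"

definition quasiperiodic_algebra :: "'i set \<Rightarrow> ('i \<Rightarrow> real ^ 'n) \<Rightarrow> (int ^ 'n) set set" where
  "quasiperiodic_algebra I r =
     {quasiperiodic_set I r G | G. G \<subseteq> (\<Pi>\<^sub>E i\<in>I. {0..<1}) \<and> jordan_measurable_on I G}"

text \<open>The \<open>N n\<close> coordinates are indexed by the pairs \<open>(k, i)\<close> with \<open>-N \<le> k \<le> -1\<close>.\<close>

definition past_algebra :: "real ^ 'n ^ 'n \<Rightarrow> nat \<Rightarrow> (int ^ 'n) set set" where
  "past_algebra L N = quasiperiodic_algebra ({- int N..-1} \<times> UNIV) (power_rows L)"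

definition quantizer :: "(real ^ 'n \<Rightarrow> int ^ 'n) \<Rightarrow> bool" where
  "quantizer R \<longleftrightarrow> (\<forall>u z. R (u + real_vec z) = R u + z) \<and> jordan_measurable (R -` {0})"

definition cell_mean :: "(real ^ 'n \<Rightarrow> int ^ 'n) \<Rightarrow> real ^ 'n" where
  "cell_mean R = integral (R -` {0}) (\<lambda>u. u)"

definition comp_quantizer :: "(real ^ 'n \<Rightarrow> int ^ 'n) \<Rightarrow> real ^ 'n ^ 'n \<Rightarrow> real ^ 'n \<Rightarrow> int ^ 'n" where
  "comp_quantizer R L u = R (u + (mat 1 + matrix_inv L) *v cell_mean R)"

definition transition :: "(real ^ 'n \<Rightarrow> int ^ 'n) \<Rightarrow> real ^ 'n ^ 'n \<Rightarrow> int ^ 'n \<Rightarrow> int ^ 'n" where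
  "transition R L x = R (L *v real_vec x)"

definition comp_transition :: "(real ^ 'n \<Rightarrow> int ^ 'n) \<Rightarrow> real ^ 'n ^ 'n \<Rightarrow> int ^ 'n \<Rightarrow> int ^ 'n" where
  "comp_transition R L = transition (comp_quantizer R L) (matrix_inv L)"

definition preimage_shape ::
    "(real ^ 'n \<Rightarrow> int ^ 'n) \<Rightarrow> real ^ 'n ^ 'n \<Rightarrow> nat \<Rightarrow> int ^ 'n \<Rightarrow> (int ^ 'n) set" where
  "preimage_shape R L N x =
     (\<lambda>y. y - (comp_transition R L ^^ N) x) ` ((transition R L ^^ N) -` {x})"

text \<open>\<open>shape_kernel R L B A\<close> is the kernel \<open>\<Delta>(B | A)\<close>. The measure has to be the completed one,
  as \<open>R -` {0}\<close> need not be a Borel set.\<close>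

definition shape_kernel ::
    "(real ^ 'n \<Rightarrow> int ^ 'n) \<Rightarrow> real ^ 'n ^ 'n \<Rightarrow> (int ^ 'n) set \<Rightarrow> (int ^ 'n) set \<Rightarrow> real" where
  "shape_kernel R L B A =
     measure lebesgue
       {u \<in> comp_quantizer R L -` {0}.
          range real_vec \<inter>
            {u + matrix_inv L *v (real_vec a + v) | a v. a \<in> A \<and> v \<in> R -` {0}}
          = real_vec ` B}"

text \<open>Frequency plays the role of a finitely additive probability on the lattice. The state space
  \<open>S\<close> is meant to be countable, and \<open>K t s\<close> is the probability of a transition from \<open>s\<close> to \<open>t\<close>.
  The Markov property is stated in product form, so as not to divide by a zero frequency:
  given any past event \<open>A\<close> and the present state \<open>s\<close>, the next state has the law \<open>K (\<cdot>) s\<close>.\<close>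

definition homogeneous_markov_chain ::
    "(nat \<Rightarrow> (int ^ 'n) set set) \<Rightarrow> 's set \<Rightarrow> ('s \<Rightarrow> 's \<Rightarrow> real) \<Rightarrow> (nat \<Rightarrow> int ^ 'n \<Rightarrow> 's) \<Rightarrow> bool" where
  "homogeneous_markov_chain Q S K X \<longleftrightarrow>
     (\<forall>N\<ge>1. Q N \<subseteq> Q (Suc N)) \<and>
     (\<forall>N\<ge>1. \<forall>x. X N x \<in> S) \<and>
     (\<forall>N\<ge>1. \<forall>s\<in>S. X N -` {s} \<in> Q N) \<and>
     (\<forall>N\<ge>1. \<forall>A\<in>Q N. \<forall>s\<in>S. \<forall>t\<in>S.
        freq_measurable (A \<inter> X N -` {s}) \<and>
        freq_measurable (A \<inter> X N -` {s} \<inter> X (Suc N) -` {t}) \<and>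
        freq (A \<inter> X N -` {s} \<inter> X (Suc N) -` {t}) = K t s * freq (A \<inter> X N -` {s}))"

end

theory Submission
  imports Defs
begin

text \<open>Put \<open>x\<^sub>k\<close> for the \<open>k\<close>-th iterate of \<open>x\<close> under the compensating system and
  \<open>u\<^sub>k\<^sub>+\<^sub>1 = L\<^sup>-\<^sup>1 x\<^sub>k - x\<^sub>k\<^sub>+\<^sub>1\<close> for its rounding errors. The shape of the \<open>(k + 1)\<close>-st preimage is a function
  of the shape of the \<open>k\<close>-th one and of \<open>u\<^sub>k\<^sub>+\<^sub>1\<close> alone. The errors are functions, continuous off a null set, of
  the fractional parts of \<open>L\<^sup>-\<^sup>1 x, \<dots>, L\<^sup>-\<^sup>N x\<close>, which are equidistributed over the torus because \<open>L\<close> is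
  iteratively nonresonant (Weyl). Modulo the lattice, \<open>u\<^sub>N\<^sub>+\<^sub>1\<close> is \<open>L\<^sup>-\<^sup>N\<^sup>-\<^sup>1 x\<close> translated by a function of the
  earlier coordinates, so by Fubini it is uniform on the cell and independent of the past.\<close>

subsection \<open>Frequencies as limits along boxes\<close>

text \<open>The differences d_k = L^-k x - x_k start at 0 and give u_(k+1) = d_(k+1) - L^-1 d_k. An
  integer shift of the coordinate L^-k x passes through the rounding unchanged and cancels in d_k;
  hence the errors are functions on the torus although the orbit is not. The obstacle is that these
  functions jump, while membership in the algebra demands Jordan measurable sets. The jump sets are
  shown to be null by freezing the lattice value inside each rounding at its countably many possible
  values, which leaves a continuous translation of the newest block. A Jordan measurable set need
  not be Borel, so measures are computed for versions built from interiors. Uniformity over all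
  boxes comes from geometric sums, whose bound does not depend on where an interval starts or on its
  length. The law of u_(N+1) is uniform because the cell and the unit cube each represent a class
  modulo the lattice only once: cutting and translating matches their parts whatever the
  translation. The kernel is then the measure of the errors that turn the shape \<open>A\<close>
  into \<open>B\<close>.\<close>

definition box_filter :: "(int ^ 'n) set filter" where
  "box_filter = (INF N\<in>{1..}. principal (lattice_boxes N))"

lemma lattice_boxes_antimono: "M \<le> N \<Longrightarrow> lattice_boxes N \<subseteq> lattice_boxes M"
  unfolding lattice_boxes_def by (auto intro: order_trans)

lemma eventually_box_filter:
  "eventually P box_filter \<longleftrightarrow> (\<exists>N\<ge>1. \<forall>B\<in>lattice_boxes N. P B)"
proof -
  have "eventually P box_filter \<longleftrightarrow> (\<exists>N\<in>{1..}. eventually P (principal (lattice_boxes N)))"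
    unfolding box_filter_def
  proof (rule eventually_INF_base)
    fix a b :: nat assume "a \<in> {1..}" "b \<in> {1..}"
    then show "\<exists>x\<in>{1..}. principal (lattice_boxes x) \<le>
          inf (principal (lattice_boxes a :: (int ^ 'n) set set)) (principal (lattice_boxes b))"
      using lattice_boxes_antimono[of a "max a b"] lattice_boxes_antimono[of b "max a b"]
      by (intro bexI[of _ "max a b"]) auto
  qed auto
  then show ?thesis by (auto simp: eventually_principal)
qed

text \<open>Boxes become products \<open>PiE\<close>, so that cardinalities and sums of products
  factor over the coordinates.\<close>

lemma lattice_box_bij:
  "bij_betw (\<lambda>g. \<chi> j. g j) (\<Pi>\<^sub>E j\<in>UNIV. {a $ j..<a $ j + int (l $ j)}) (lattice_box a l)"
  by (rule bij_betwI[where g = "\<lambda>x j. x $ j"]) (auto simp: lattice_box_def)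

lemma finite_lattice_box [simp]: "finite (lattice_box a l)"
  using bij_betw_finite[OF lattice_box_bij[of a l]] by (auto intro!: finite_PiE)

lemma card_lattice_box: "card (lattice_box a l) = (\<Prod>j\<in>UNIV. l $ j)"
  using bij_betw_same_card[OF lattice_box_bij[of a l]] by (simp add: card_PiE)

lemma lattice_boxesD:
  assumes "P \<in> lattice_boxes N" "N \<ge> 1"
  shows "finite P" "card P > 0" "P \<noteq> {}"
proof -
  obtain a l where P: "P = lattice_box a l" "\<And>k. N \<le> l $ k"
    using assms unfolding lattice_boxes_def by auto
  show "finite P" using P by simp
  have "l $ j > 0" for j using P(2)[of j] assms by simp
  then show "card P > 0" unfolding P card_lattice_box by (auto intro: prod_pos)
  then show "P \<noteq> {}" by auto
qed

lemma lattice_boxes_nonempty: "lattice_boxes N \<noteq> {}"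
proof -
  have "lattice_box 0 (\<chi> j. N) \<in> lattice_boxes N"
    unfolding lattice_boxes_def by (auto intro!: exI[of _ 0] exI[of _ "\<chi> j. N"])
  then show ?thesis by auto
qed

lemma eventually_box_filter_ok: "eventually (\<lambda>P. finite P \<and> card P > 0) box_filter"
  unfolding eventually_box_filter using lattice_boxesD by blast

lemma box_filter_neq_bot [simp]: "box_filter \<noteq> bot"
  unfolding trivial_limit_def eventually_box_filter using lattice_boxes_nonempty by blast

text \<open>A limit along \<open>box_filter\<close> is uniform in the position and the proportions
  of the box, as its shortest side grows. Both frequencies are thereby reduced to one ordinary
  limit.\<close>

definition has_freq :: "(int ^ 'n) set \<Rightarrow> real \<Rightarrow> bool" where
  "has_freq A c \<longleftrightarrow> ((\<lambda>P. real (card (A \<inter> P)) / real (card P)) \<longlongrightarrow> c) box_filter"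

lemma has_freq_unique: "has_freq A c \<Longrightarrow> has_freq A d \<Longrightarrow> c = d"
  unfolding has_freq_def by (rule tendsto_unique[OF box_filter_neq_bot])

text \<open>For some \<open>M\<close> all ratios over \<open>lattice_boxes M\<close> lie within
  \<open>e\<close> of \<open>c\<close>, which pins the infimum and the supremum there. For arbitrary
  \<open>N\<close>, one box common to the families \<open>M\<close> and \<open>N\<close> already
  puts \<open>c\<close> between \<open>lo N\<close> and \<open>up N\<close>, up to
  \<open>e\<close>.\<close>

lemma has_freq_imp:
  assumes "has_freq A c"
  shows "lower_freq A = c" "upper_freq A = c"
proof -
  let ?r = "\<lambda>P. real (card (A \<inter> P)) / real (card P)"
  have r01: "0 \<le> ?r P" "?r P \<le> 1" if "P \<in> lattice_boxes N" "N \<ge> 1" for P N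
    using lattice_boxesD[OF that] by (auto simp: divide_le_eq intro: card_mono)
  have ne: "lattice_boxes N \<noteq> {}" for N by (rule lattice_boxes_nonempty)
  have bb: "bdd_below (?r ` lattice_boxes N)" "bdd_above (?r ` lattice_boxes N)" if "N \<ge> 1" for N
    using r01 that by (auto intro!: bdd_belowI2[where m = 0] bdd_aboveI2[where M = 1])
  have ex: "\<exists>N\<ge>1. \<forall>P\<in>lattice_boxes N. \<bar>?r P - c\<bar> < e" if "e > 0" for e
    using tendstoD[OF assms[unfolded has_freq_def] that]
    unfolding eventually_box_filter dist_real_def .
  define lo where "lo N = (INF P\<in>lattice_boxes N. ?r P)" for N
  define up where "up N = (SUP P\<in>lattice_boxes N. ?r P)" for N
  have lo_c: "lo N \<le> c" "c \<le> up N" if N: "N \<ge> 1" for N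
  proof -
    have *: "lo N \<le> c + e \<and> c - e \<le> up N" if e: "e > 0" for e
    proof -
      obtain M where M: "M \<ge> 1" "\<forall>P\<in>lattice_boxes M. \<bar>?r P - c\<bar> < e" using ex[OF e] by blast
      obtain P :: "(int ^ 'a) set" where P: "P \<in> lattice_boxes (max M N)"
        using ne[of "max M N"] by blast
      have PM: "P \<in> lattice_boxes M" and PN: "P \<in> lattice_boxes N"
        using P lattice_boxes_antimono[of M "max M N"] lattice_boxes_antimono[of N "max M N"] by auto
      have "lo N \<le> ?r P" unfolding lo_def by (rule cINF_lower[OF bb(1)[OF N] PN])
      moreover have "?r P \<le> up N" unfolding up_def by (rule cSUP_upper[OF PN bb(2)[OF N]])
      ultimately show ?thesis using M(2) PM by fastforce
    qed
    show "lo N \<le> c" by (rule field_le_epsilon) (use * in auto)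
    show "c \<le> up N" by (rule field_le_epsilon) (use * in \<open>auto simp: diff_le_eq\<close>)
  qed
  have near: "\<exists>N\<ge>1. c - e \<le> lo N \<and> up N \<le> c + e" if e: "e > 0" for e
  proof -
    obtain M where M: "M \<ge> 1" "\<forall>P\<in>lattice_boxes M. \<bar>?r P - c\<bar> < e" using ex[OF e] by blast
    have "c - e \<le> lo M" unfolding lo_def by (rule cINF_greatest[OF ne]) (use M in fastforce)
    moreover have "up M \<le> c + e" unfolding up_def by (rule cSUP_least[OF ne]) (use M in fastforce)
    ultimately show ?thesis using M by blast
  qed
  have "(SUP N\<in>{1..}. lo N) = c"
  proof (rule antisym)
    show "(SUP N\<in>{1..}. lo N) \<le> c" by (rule cSUP_least) (auto intro: lo_c)
    show "c \<le> (SUP N\<in>{1..}. lo N)"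
    proof (rule field_le_epsilon)
      fix e :: real assume "e > 0"
      then obtain N where N: "N \<ge> 1" "c - e \<le> lo N" using near by blast
      have "lo N \<le> (SUP N\<in>{1..}. lo N)"
        by (rule cSUP_upper) (use N lo_c in \<open>auto intro!: bdd_aboveI2[where M = c]\<close>)
      with N show "c \<le> (SUP N\<in>{1..}. lo N) + e" by simp
    qed
  qed
  then show "lower_freq A = c" unfolding lower_freq_def lo_def .
  have "(INF N\<in>{1..}. up N) = c"
  proof (rule antisym)
    show "c \<le> (INF N\<in>{1..}. up N)" by (rule cINF_greatest) (auto intro: lo_c)
    show "(INF N\<in>{1..}. up N) \<le> c"
    proof (rule field_le_epsilon)
      fix e :: real assume "e > 0"
      then obtain N where N: "N \<ge> 1" "up N \<le> c + e" using near by blast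
      have "(INF N\<in>{1..}. up N) \<le> up N"
        by (rule cINF_lower) (use N lo_c in \<open>auto intro!: bdd_belowI2[where m = c]\<close>)
      with N show "(INF N\<in>{1..}. up N) \<le> c + e" by simp
    qed
  qed
  then show "upper_freq A = c" unfolding upper_freq_def up_def .
qed

lemma has_freq_freq:
  assumes "has_freq A c" shows "freq_measurable A" "freq A = c"
  using has_freq_imp[OF assms] by (auto simp: freq_measurable_def freq_def)

subsection \<open>Weyl averages over boxes\<close>

lemma cis_2pi_of_int: "cis (2 * pi * of_int k) = 1"
  by (metis cis_multiple_2pi Ints_of_int mult.commute mult.left_commute)

lemma cis_sum: "finite A \<Longrightarrow> cis (sum f A) = (\<Prod>i\<in>A. cis (f i))"
  by (induction A rule: finite_induct) (auto simp flip: cis_mult)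

text \<open>A geometric series with ratio \<open>z \<noteq> 1\<close> and
  \<open>norm (z ^ l - 1) \<le> 2\<close>. The bound depends neither on \<open>a\<close> nor on
  \<open>l\<close>, which is the source of uniformity over boxes.\<close>

lemma norm_sum_cis_le:
  assumes "\<theta> \<notin> \<int>"
  shows "norm (\<Sum>t\<in>{a..<a + int l}. cis (2 * pi * \<theta> * of_int t)) \<le> 2 / norm (cis (2 * pi * \<theta>) - 1)"
proof -
  define z where "z = cis (2 * pi * \<theta>)"
  have z: "z \<noteq> 1"
  proof
    assume "z = 1"
    then have "cos (2 * pi * \<theta>) = 1" by (simp add: z_def complex_eq_iff)
    then obtain n :: int where "2 * pi * \<theta> = n * (2 * pi)" using cos_one_2pi_int by auto
    then have "\<theta> = of_int n" by simp
    then show False using assms by auto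
  qed
  have "(\<Sum>t\<in>{a..<a + int l}. cis (2 * pi * \<theta> * of_int t)) = (\<Sum>m<l. cis (2 * pi * \<theta> * of_int a) * z ^ m)"
  proof (rule sum.reindex_bij_witness[where i = "\<lambda>m. a + int m" and j = "\<lambda>t. nat (t - a)"], goal_cases)
    case (5 t)
    define m where "m = nat (t - a)"
    have t: "t = a + int m" using 5 by (auto simp: m_def)
    have "2 * pi * \<theta> * of_int t = 2 * pi * \<theta> * of_int a + real m * (2 * pi * \<theta>)"
      unfolding t by (simp add: algebra_simps)
    then have "cis (2 * pi * \<theta> * of_int t) = cis (2 * pi * \<theta> * of_int a) * z ^ m"
      unfolding z_def Complex.DeMoivre cis_mult by (rule arg_cong)
    then show ?case by (simp only: m_def)
  qed auto
  also have "\<dots> = cis (2 * pi * \<theta> * of_int a) * ((z ^ l - 1) / (z - 1))"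
    by (simp add: sum_distrib_left[symmetric] geometric_sum[OF z])
  also have "norm \<dots> = norm (z ^ l - 1) / norm (z - 1)"
    by (simp add: norm_mult norm_divide)
  also have "\<dots> \<le> 2 / norm (z - 1)"
  proof (rule divide_right_mono)
    have "norm (z ^ l - 1) \<le> norm (z ^ l) + norm (1 :: complex)" by (rule norm_triangle_ineq4)
    then show "norm (z ^ l - 1) \<le> 2" by (simp add: z_def norm_power)
  qed auto
  finally show ?thesis by (simp add: z_def)
qed

lemma sum_lattice_box_prod:
  fixes f :: "'n::finite \<Rightarrow> int \<Rightarrow> complex"
  shows "(\<Sum>x\<in>lattice_box a l. \<Prod>j\<in>UNIV. f j (x $ j)) = (\<Prod>j\<in>UNIV. \<Sum>t\<in>{a $ j..<a $ j + int (l $ j)}. f j t)"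
proof -
  have "(\<Sum>x\<in>lattice_box a l. \<Prod>j\<in>UNIV. f j (x $ j)) =
      (\<Sum>g\<in>(\<Pi>\<^sub>E j\<in>UNIV. {a $ j..<a $ j + int (l $ j)}). \<Prod>j\<in>UNIV. f j (g j))"
    by (rule sum.reindex_bij_betw[symmetric, OF lattice_box_bij, THEN trans]) simp
  then show ?thesis by (simp add: prod_sum_PiE)
qed

text \<open>The character factors over the coordinates. The factor at \<open>j\<close> stays below
  the constant \<open>C\<close>, every other one below its side length, so the average over a box is
  at most \<open>C / l $ j\<close>, whatever the position and the other sides.\<close>

lemma character_average_tendsto_0:
  fixes \<theta> :: "real ^ 'n"
  assumes "\<theta> $ j \<notin> \<int>"
  shows "((\<lambda>P. (\<Sum>x\<in>P. cis (2 * pi * (\<theta> \<bullet> real_vec x))) / of_nat (card P)) \<longlongrightarrow> 0) box_filter"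
proof (rule tendstoI)
  fix e :: real assume e: "e > 0"
  define C where "C = 2 / norm (cis (2 * pi * \<theta> $ j) - 1)"
  have C0: "C \<ge> 0" by (simp add: C_def)
  obtain N :: nat where N: "N \<ge> 1" "C / real N < e"
  proof -
    obtain M :: nat where M: "real M > C / e" using reals_Archimedean2 by blast
    have "C < e * real (Suc M)"
    proof -
      have "C < e * real M" using M e by (simp add: field_simps)
      also have "\<dots> \<le> e * real (Suc M)" using e by simp
      finally show ?thesis .
    qed
    then have "C / real (Suc M) < e" using e by (simp add: field_simps)
    then show ?thesis using that[of "Suc M"] by simp
  qed
  show "\<forall>\<^sub>F P in box_filter. dist ((\<Sum>x\<in>P. cis (2 * pi * (\<theta> \<bullet> real_vec x))) / of_nat (card P)) 0 < e"
    unfolding eventually_box_filter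
  proof (intro exI[of _ N] conjI ballI)
    show "N \<ge> 1" by fact
    fix P :: "(int ^ 'n) set" assume P: "P \<in> lattice_boxes N"
    then obtain a l where al: "P = lattice_box a l" "\<And>k. N \<le> l $ k"
      unfolding lattice_boxes_def by auto
    define D where "D = (\<Prod>i\<in>UNIV - {j}. real (l $ i))"
    have cP: "real (card P) = real (l $ j) * D"
      unfolding al card_lattice_box D_def by (subst prod.remove[of _ j]) auto
    have pos: "real (card P) > 0" using lattice_boxesD(2)[OF P N(1)] by simp
    have cis_prod: "cis (2 * pi * (\<theta> \<bullet> real_vec x)) = (\<Prod>i\<in>UNIV. cis (2 * pi * \<theta> $ i * of_int (x $ i)))" for x
      unfolding inner_vec_def by (simp add: sum_distrib_left cis_sum real_vec_def mult.assoc)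
    have "norm (\<Sum>x\<in>P. cis (2 * pi * (\<theta> \<bullet> real_vec x))) =
       (\<Prod>i\<in>UNIV. norm (\<Sum>t\<in>{a $ i..<a $ i + int (l $ i)}. cis (2 * pi * \<theta> $ i * of_int t)))"
      unfolding cis_prod al sum_lattice_box_prod[where f = "\<lambda>i t. cis (2 * pi * \<theta> $ i * of_int t)"]
      by (simp add: prod_norm)
    also have "\<dots> = norm (\<Sum>t\<in>{a $ j..<a $ j + int (l $ j)}. cis (2 * pi * \<theta> $ j * of_int t)) *
       (\<Prod>i\<in>UNIV - {j}. norm (\<Sum>t\<in>{a $ i..<a $ i + int (l $ i)}. cis (2 * pi * \<theta> $ i * of_int t)))"
      by (rule prod.remove) auto
    also have "\<dots> \<le> C * D"
      unfolding D_def
    proof (rule mult_mono)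
      show "(\<Prod>i\<in>UNIV - {j}. norm (\<Sum>t\<in>{a $ i..<a $ i + int (l $ i)}. cis (2 * pi * \<theta> $ i * of_int t)))
         \<le> (\<Prod>i\<in>UNIV - {j}. real (l $ i))"
      proof (rule prod_mono, rule conjI)
        fix i
        have "norm (\<Sum>t\<in>{a $ i..<a $ i + int (l $ i)}. cis (2 * pi * \<theta> $ i * of_int t))
            \<le> (\<Sum>t\<in>{a $ i..<a $ i + int (l $ i)}. 1)"
          by (rule sum_norm_le) auto
        then show "norm (\<Sum>t\<in>{a $ i..<a $ i + int (l $ i)}. cis (2 * pi * \<theta> $ i * of_int t)) \<le> real (l $ i)"
          by simp
      qed auto
    qed (use norm_sum_cis_le[OF assms] C0 in \<open>auto simp: C_def prod_nonneg\<close>)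
    finally have *: "norm (\<Sum>x\<in>P. cis (2 * pi * (\<theta> \<bullet> real_vec x))) \<le> C * D" .
    have "norm ((\<Sum>x\<in>P. cis (2 * pi * (\<theta> \<bullet> real_vec x))) / of_nat (card P)) \<le> C * D / real (card P)"
      unfolding norm_divide using divide_right_mono[OF *, of "real (card P)"] by simp
    also have "\<dots> = C / real (l $ j)" using pos unfolding cP by auto
    also have "\<dots> \<le> C / real N"
      using al(2)[of j] N C0 by (intro divide_left_mono) auto
    finally show "dist ((\<Sum>x\<in>P. cis (2 * pi * (\<theta> \<bullet> real_vec x))) / of_nat (card P)) 0 < e"
      using N by simp
  qed
qed

section \<open>Trigonometric polynomials of period 1\<close>

inductive trig :: "(real \<Rightarrow> complex) \<Rightarrow> bool" where
  character: "trig (\<lambda>t. c * cis (2 * pi * (of_int k * t)))"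
| add: "trig f \<Longrightarrow> trig g \<Longrightarrow> trig (\<lambda>t. f t + g t)"

lemma trig_const: "trig (\<lambda>t. c)"
  using trig.character[of c 0] by simp

lemma trig_mult: "trig f \<Longrightarrow> trig g \<Longrightarrow> trig (\<lambda>t. f t * g t)"
proof (induction f rule: trig.induct)
  case (character c k)
  from character show ?case
  proof (induction g rule: trig.induct)
    case (character d m)
    have "(\<lambda>t. c * cis (2 * pi * (of_int k * t)) * (d * cis (2 * pi * (of_int m * t)))) =
      (\<lambda>t. (c * d) * cis (2 * pi * (of_int (k + m) * t)))"
    proof
      fix t
      have "cis (2 * pi * (of_int (k + m) * t)) = cis (2 * pi * (of_int k * t)) * cis (2 * pi * (of_int m * t))"
        unfolding cis_mult by (simp add: algebra_simps)
      then show "c * cis (2 * pi * (of_int k * t)) * (d * cis (2 * pi * (of_int m * t))) =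
          (c * d) * cis (2 * pi * (of_int (k + m) * t))"
        by simp
    qed
    then show ?case using trig.character[of "c * d" "k + m"] by simp
  next
    case (add f g)
    show ?case unfolding distrib_left by (intro trig.add add.IH)
  qed
next
  case (add f g)
  show ?case unfolding distrib_right by (intro trig.add add.IH add.prems)
qed

text \<open>On the circle a linear functional is \<open>cos\<close> times \<open>f 1\<close> plus
  \<open>sin\<close> times \<open>f \<i>\<close>, and Euler's formulas turn this into the
  frequencies 1 and -1. Sums and products stay trigonometric, so the polynomials of
  Stone-Weierstrass on the circle are in the class \<open>trig\<close>.\<close>

lemma trig_real_polynomial:
  "real_polynomial_function g \<Longrightarrow> trig (\<lambda>t. of_real (g (cis (2 * pi * t))))"
proof (induction g rule: real_polynomial_function.induct)
  case (linear f)
  define a b where "a = complex_of_real (f 1)" and "b = complex_of_real (f \<i>)"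
  have eq: "(\<lambda>t. complex_of_real (f (cis (2 * pi * t)))) =
      (\<lambda>t. ((a - \<i> * b) / 2) * cis (2 * pi * (of_int 1 * t)) + ((a + \<i> * b) / 2) * cis (2 * pi * (of_int (-1) * t)))"
  proof
    fix t :: real
    have "cis (2 * pi * t) = cos (2 * pi * t) *\<^sub>R 1 + sin (2 * pi * t) *\<^sub>R \<i>"
      by (simp add: complex_eq_iff)
    then have "f (cis (2 * pi * t)) = cos (2 * pi * t) * f 1 + sin (2 * pi * t) * f \<i>"
      using linear by (simp add: linear_add bounded_linear.linear linear_scale)
    then have "complex_of_real (f (cis (2 * pi * t))) = cos (2 * pi * t) * a + sin (2 * pi * t) * b"
      by (simp add: a_def b_def)
    also have "\<dots> = ((a - \<i> * b) / 2) * cis (2 * pi * (of_int 1 * t)) + ((a + \<i> * b) / 2) * cis (2 * pi * (of_int (-1) * t))"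
      by (simp add: complex_eq_iff a_def b_def field_simps)
    finally show "complex_of_real (f (cis (2 * pi * t))) = ((a - \<i> * b) / 2) * cis (2 * pi * (of_int 1 * t)) + ((a + \<i> * b) / 2) * cis (2 * pi * (of_int (-1) * t))" .
  qed
  show ?case unfolding eq by (rule trig.add[OF trig.character trig.character])
next
  case (add f g)
  then show ?case unfolding of_real_add by (intro trig.add)
next
  case (mult f g)
  then show ?case unfolding of_real_mult by (intro trig_mult)
qed (rule trig_const)

lemma trig_expand:
  assumes "trig f"
  shows "\<exists>(J :: nat) c (k :: nat \<Rightarrow> int). f = (\<lambda>t. \<Sum>j<J. c j * cis (2 * pi * (of_int (k j) * t)))"
proof -
  \<comment> \<open>Lists of pairs of a coefficient and a frequency, since two sums are joined by
    appending; the indexed form is read off at the end.\<close>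
  have "\<exists>xs :: (complex \<times> int) list. f = (\<lambda>t. \<Sum>p\<leftarrow>xs. fst p * cis (2 * pi * (of_int (snd p) * t)))"
    using assms
  proof (induction rule: trig.induct)
    case (character c k)
    show ?case by (rule exI[of _ "[(c, k)]"]) simp
  next
    case (add f g)
    then obtain xs ys :: "(complex \<times> int) list" where
      "f = (\<lambda>t. \<Sum>p\<leftarrow>xs. fst p * cis (2 * pi * (of_int (snd p) * t)))"
      "g = (\<lambda>t. \<Sum>p\<leftarrow>ys. fst p * cis (2 * pi * (of_int (snd p) * t)))" by blast
    then show ?case by (intro exI[of _ "xs @ ys"]) simp
  qed
  then obtain xs :: "(complex \<times> int) list"
    where "f = (\<lambda>t. \<Sum>p\<leftarrow>xs. fst p * cis (2 * pi * (of_int (snd p) * t)))" by blast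
  then have "f = (\<lambda>t. \<Sum>j<length xs. fst (xs ! j) * cis (2 * pi * (of_int (snd (xs ! j)) * t)))"
    by (simp add: sum_list_sum_nth atLeast0LessThan)
  then show ?thesis by (intro exI)
qed

lemma character_has_integral:
  "((\<lambda>t. cis (2 * pi * (of_int k * t))) has_integral (if k = 0 then 1 else 0)) {0..1}"
proof (cases "k = 0")
  case True
  then show ?thesis using has_integral_const_real[of "1::complex" 0 1] by simp
next
  case False
  have "((\<lambda>t. cis (2 * pi * (of_int k * t))) has_integral
     (cis (2 * pi * (of_int k * 1)) / (\<i> * (2 * pi * k)) - cis (2 * pi * (of_int k * 0)) / (\<i> * (2 * pi * k)))) {0..1}"
  proof (rule fundamental_theorem_of_calculus)
    fix x :: real
    have "((\<lambda>x. exp (\<i> * complex_of_real (2 * pi * (of_int k * x))) / (\<i> * (2 * pi * k))) has_vector_derivative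
       exp (\<i> * complex_of_real (2 * pi * (of_int k * x)))) (at x within {0..1})"
      using False
      by (auto intro!: derivative_eq_intros has_vector_derivative_real_field simp: field_simps)
    then show "((\<lambda>x. cis (2 * pi * (of_int k * x)) / (\<i> * (2 * pi * k))) has_vector_derivative
       cis (2 * pi * (of_int k * x))) (at x within {0..1})"
      by (simp add: cis_conv_exp)
  qed simp
  then show ?thesis using False cis_2pi_of_int[of k] by simp
qed

text \<open>Weyl's condition: every nontrivial character of the torus, composed with the map from
  \<open>x\<close> to the products \<open>r i \<bullet> real_vec x\<close>, remains nontrivial on
  the integer lattice.\<close>

definition rat_free :: "'i set \<Rightarrow> ('i \<Rightarrow> real ^ 'n) \<Rightarrow> bool" where
  "rat_free I r \<longleftrightarrow> (\<forall>k :: 'i \<Rightarrow> int. (\<forall>j. (\<Sum>i\<in>I. of_int (k i) *\<^sub>R r i) $ j \<in> \<int>) \<longrightarrow> (\<forall>i\<in>I. k i = 0))"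

lemma nonresonant_imp_rat_free:
  assumes "nonresonant I r" "finite I"
  shows "rat_free I r"
  unfolding rat_free_def
proof (intro allI impI ballI)
  fix k :: "'a \<Rightarrow> int" and i
  assume k: "\<forall>j. (\<Sum>i\<in>I. of_int (k i) *\<^sub>R r i) $ j \<in> \<int>" and i: "i \<in> I"
  then obtain m :: "'b \<Rightarrow> int" where m: "\<And>j. (\<Sum>i\<in>I. of_int (k i) *\<^sub>R r i) $ j = of_int (m j)"
    unfolding Ints_def image_iff by (metis UNIV_I)
  \<comment> \<open>An integer combination of rows that equals the integer vector \<open>m\<close>
    is a rational relation with the rows of the identity, which receive the coefficients
    \<open>- m\<close>.\<close>
  define c :: "'b + 'a \<Rightarrow> rat" where "c = case_sum (\<lambda>j. - of_int (m j)) (\<lambda>i. of_int (k i))"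
  have "(\<Sum>i\<in>UNIV <+> I. of_rat (c i) *\<^sub>R case_sum (\<lambda>j. row j (mat 1 :: real ^ 'b ^ 'b)) r i) = 0"
  proof (rule vec_eq_iff[THEN iffD2], rule allI)
    fix j
    have "(\<Sum>x\<in>UNIV. real_of_int (m x) * row x (mat 1 :: real ^ 'b ^ 'b) $ j)
        = (\<Sum>x\<in>UNIV. if x = j then real_of_int (m x) else 0)"
      by (rule sum.cong) (auto simp: row_def mat_def)
    then show "(\<Sum>i\<in>UNIV <+> I. of_rat (c i) *\<^sub>R case_sum (\<lambda>j. row j (mat 1 :: real ^ 'b ^ 'b)) r i) $ j = 0 $ j"
      using m[of j] by (simp add: sum.Plus assms(2) c_def of_rat_minus sum_negf)
  qed
  then have "c (Inr i) = 0"
    using assms(1) i unfolding nonresonant_def rat_independent_def by blast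
  then show "k i = 0" by (simp add: c_def)
qed

text \<open>Multiplying out gives a sum over choices \<open>g\<close> of one term per index, and
  each product of characters is the single character with vector \<open>\<theta> g\<close>. Its
  average is 1 if all chosen frequencies vanish; otherwise \<open>rat_free\<close> supplies a
  coordinate of \<open>\<theta> g\<close> outside the integers and the average tends to 0. The
  product of the integrals expands over the same \<open>g\<close> with the same dichotomy.\<close>

lemma trig_product_average:
  fixes f :: "'i \<Rightarrow> real \<Rightarrow> complex" and r :: "'i \<Rightarrow> real ^ 'n"
  assumes "finite I" "rat_free I r" "\<And>i. i \<in> I \<Longrightarrow> trig (f i)"
  shows "((\<lambda>P. (\<Sum>x\<in>P. \<Prod>i\<in>I. f i (r i \<bullet> real_vec x)) / of_nat (card P)) \<longlongrightarrow>
     (\<Prod>i\<in>I. integral {0..1} (f i))) box_filter"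
proof -
  have "\<forall>i\<in>I. \<exists>q :: nat \<times> (nat \<Rightarrow> complex) \<times> (nat \<Rightarrow> int).
      f i = (\<lambda>t. \<Sum>j<fst q. fst (snd q) j * cis (2 * pi * (of_int (snd (snd q) j) * t)))"
  proof
    fix i assume "i \<in> I"
    then obtain J c and k :: "nat \<Rightarrow> int" where "f i = (\<lambda>t. \<Sum>j<J. c j * cis (2 * pi * (of_int (k j) * t)))"
      using trig_expand assms(3) by blast
    then show "\<exists>q :: nat \<times> (nat \<Rightarrow> complex) \<times> (nat \<Rightarrow> int).
      f i = (\<lambda>t. \<Sum>j<fst q. fst (snd q) j * cis (2 * pi * (of_int (snd (snd q) j) * t)))"
      by (intro exI[of _ "(J, c, k)"]) simp
  qed
  from bchoice[OF this] obtain q :: "'i \<Rightarrow> nat \<times> (nat \<Rightarrow> complex) \<times> (nat \<Rightarrow> int)" where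
    q: "\<forall>i\<in>I. f i = (\<lambda>t. \<Sum>j<fst (q i). fst (snd (q i)) j * cis (2 * pi * (of_int (snd (snd (q i)) j) * t)))"
    by blast
  define J where "J i = fst (q i)" for i
  define c where "c i = fst (snd (q i))" for i
  define k where "k i = snd (snd (q i))" for i
  have f: "f i = (\<lambda>t. \<Sum>j<J i. c i j * cis (2 * pi * (of_int (k i j) * t)))" if "i \<in> I" for i
    using q that by (simp add: J_def c_def k_def)
  have int: "integral {0..1} (f i) = (\<Sum>j<J i. c i j * (if k i j = 0 then 1 else 0))" if "i \<in> I" for i
    unfolding f[OF that]
    by (rule integral_unique, intro has_integral_sum has_integral_mult_right character_has_integral) auto
  define G where "G = (\<Pi>\<^sub>E i\<in>I. {..<J i})"
  have fin: "finite G" unfolding G_def using assms(1) by (intro finite_PiE) auto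
  define \<theta> where "\<theta> g = (\<Sum>i\<in>I. of_int (k i (g i)) *\<^sub>R r i)" for g
  have "((\<lambda>P. \<Sum>g\<in>G. (\<Prod>i\<in>I. c i (g i)) * ((\<Sum>x\<in>P. cis (2 * pi * (\<theta> g \<bullet> real_vec x))) / of_nat (card P)))
     \<longlongrightarrow> (\<Sum>g\<in>G. (\<Prod>i\<in>I. c i (g i)) * (\<Prod>i\<in>I. if k i (g i) = 0 then 1 else 0))) box_filter"
  proof (intro tendsto_sum tendsto_mult tendsto_const)
    fix g
    show "((\<lambda>P. (\<Sum>x\<in>P. cis (2 * pi * (\<theta> g \<bullet> real_vec x))) / of_nat (card P))
     \<longlongrightarrow> (\<Prod>i\<in>I. if k i (g i) = 0 then 1 else 0)) box_filter"
    proof (cases "\<forall>i\<in>I. k i (g i) = 0")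
      case True
      have "eventually (\<lambda>P. (\<Sum>x\<in>P. cis (2 * pi * (\<theta> g \<bullet> real_vec x))) / of_nat (card P) = 1) box_filter"
        using eventually_box_filter_ok
        by (rule eventually_mono) (use True in \<open>auto simp: \<theta>_def\<close>)
      then show ?thesis using True by (simp add: tendsto_eventually)
    next
      case False
      then obtain j where "\<theta> g $ j \<notin> \<int>"
        using assms(2)[unfolded rat_free_def, THEN spec, of "\<lambda>i. k i (g i)"] unfolding \<theta>_def by blast
      moreover have "(\<Prod>i\<in>I. if k i (g i) = 0 then 1 else 0) = (0 :: complex)"
        using False assms(1) by (auto simp: prod_zero_iff)
      ultimately show ?thesis using character_average_tendsto_0[of "\<theta> g" j] by simp
    qed
  qed
  also have "(\<Sum>g\<in>G. (\<Prod>i\<in>I. c i (g i)) * (\<Prod>i\<in>I. if k i (g i) = 0 then 1 else 0)) =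
      (\<Prod>i\<in>I. integral {0..1} (f i))"
    unfolding G_def by (simp add: int prod_sum_PiE assms(1) flip: prod.distrib)
  also have "(\<lambda>P. \<Sum>g\<in>G. (\<Prod>i\<in>I. c i (g i)) * ((\<Sum>x\<in>P. cis (2 * pi * (\<theta> g \<bullet> real_vec x))) / of_nat (card P))) =
     (\<lambda>P. (\<Sum>x\<in>P. \<Prod>i\<in>I. f i (r i \<bullet> real_vec x)) / of_nat (card P))"
  proof
    fix P :: "(int ^ 'n) set"
    have "(\<Prod>i\<in>I. f i (r i \<bullet> real_vec x)) =
       (\<Sum>g\<in>G. (\<Prod>i\<in>I. c i (g i)) * cis (2 * pi * (\<theta> g \<bullet> real_vec x)))" for x
    proof -
      have "(\<Prod>i\<in>I. f i (r i \<bullet> real_vec x)) =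
          (\<Prod>i\<in>I. \<Sum>j<J i. c i j * cis (2 * pi * (of_int (k i j) * (r i \<bullet> real_vec x))))"
        using f by (intro prod.cong) auto
      also have "\<dots> = (\<Sum>g\<in>G. \<Prod>i\<in>I. c i (g i) * cis (2 * pi * (of_int (k i (g i)) * (r i \<bullet> real_vec x))))"
        unfolding G_def using assms(1) by (simp add: prod_sum_PiE)
      also have "\<dots> = (\<Sum>g\<in>G. (\<Prod>i\<in>I. c i (g i)) * cis (2 * pi * (\<theta> g \<bullet> real_vec x)))"
        unfolding \<theta>_def inner_sum_left sum_distrib_left prod.distrib
        by (simp add: cis_sum assms(1))
      finally show ?thesis .
    qed
    then have "(\<Sum>x\<in>P. \<Prod>i\<in>I. f i (r i \<bullet> real_vec x)) =
      (\<Sum>g\<in>G. (\<Prod>i\<in>I. c i (g i)) * (\<Sum>x\<in>P. cis (2 * pi * (\<theta> g \<bullet> real_vec x))))"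
      by (simp add: sum_distrib_left sum.swap[of _ P])
    then show "(\<Sum>g\<in>G. (\<Prod>i\<in>I. c i (g i)) * ((\<Sum>x\<in>P. cis (2 * pi * (\<theta> g \<bullet> real_vec x))) / of_nat (card P))) =
      (\<Sum>x\<in>P. \<Prod>i\<in>I. f i (r i \<bullet> real_vec x)) / of_nat (card P)"
      by (simp add: sum_divide_distrib[where A = G])
  qed
  finally show ?thesis .
qed

text \<open>One-sided bounds suffice for equidistribution: lower bounds follow by passing to
  complements.\<close>

lemma trig_majorant:
  assumes "0 \<le> a" "a < b" "b \<le> 1" "e > 0"
  obtains p :: "real \<Rightarrow> real" where "trig (\<lambda>t. of_real (p t))" "\<And>t. p t \<ge> 0"
    "\<And>t. frac t \<in> {a..<b} \<Longrightarrow> p t \<ge> 1" "p integrable_on {0..1}" "integral {0..1} p \<le> b - a + e"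
proof -
  define arc where "arc = (\<lambda>t. cis (2 * pi * t)) ` {a..b}"
  \<comment> \<open>A tent over the arc: 1 on it and, for positive \<open>n\<close>, 0 from distance
    \<open>1 / n\<close> on, so it tends to the indicator of the closed arc.\<close>
  define h where "h n z = max 0 (1 - real n * infdist z arc)" for n z
  have "compact arc"
    unfolding arc_def by (intro compact_continuous_image continuous_intros) auto
  moreover have ne: "arc \<noteq> {}" using assms by (auto simp: arc_def)
  ultimately have arc: "infdist z arc = 0 \<longleftrightarrow> z \<in> arc" for z
    using in_closed_iff_infdist_zero compact_imp_closed by metis
  have cont: "continuous_on A (h n)" for A n
    unfolding h_def by (intro continuous_intros)
  have contp: "continuous_on A (\<lambda>t. h n (cis (2 * pi * t)))" for A n
    by (intro continuous_on_compose2[OF cont[of UNIV]] continuous_intros) auto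
  have h01: "0 \<le> h n z" "h n z \<le> 1" "z \<in> arc \<Longrightarrow> h n z = 1" for n z
    using arc infdist_nonneg[of z arc] by (auto simp: h_def)
  have lim: "(\<lambda>n. h n z) \<longlonglongrightarrow> indicator arc z" for z
  proof (cases "z \<in> arc")
    case True
    then show ?thesis using h01 by simp
  next
    case False
    then have pos: "infdist z arc > 0" using arc[of z] infdist_nonneg[of z arc] by linarith
    obtain N :: nat where N: "real N > 1 / infdist z arc" using reals_Archimedean2 by blast
    have "h n z = 0" if "n \<ge> N" for n
    proof -
      have "real n > 1 / infdist z arc" using N that by linarith
      then show ?thesis using pos by (simp add: h_def field_simps)
    qed
    then have "eventually (\<lambda>n. h n z = 0) sequentially" by (auto simp: eventually_sequentially)
    then show ?thesis using False by (simp add: tendsto_eventually)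
  qed
  have "((\<lambda>t. indicator {a..b} t :: real) has_integral (b - a)) {0..1}"
  proof -
    have "((\<lambda>t. if t \<in> {a..b} then 1 else 0 :: real) has_integral (b - a)) {0..1}"
      using has_integral_const_real[of "1::real" a b] assms
      by (subst has_integral_restrict) auto
    then show ?thesis by (simp add: indicator_def of_bool_def if_distrib cong: if_cong)
  qed
  \<comment> \<open>The map from \<open>{0..1}\<close> to the circle identifies only the endpoints,
    so off \<open>{0, 1}\<close> the pulled back arc is exactly \<open>{a..b}\<close>.\<close>
  then have arcint: "((\<lambda>t. indicator arc (cis (2 * pi * t)) :: real) has_integral (b - a)) {0..1}"
  proof (rule has_integral_spike_finite[rotated 2])
    fix t :: real assume t: "t \<in> {0..1} - {0, 1}"
    have "t \<in> {a..b}" if c: "cis (2 * pi * t) \<in> arc"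
    proof -
      obtain s where s: "s \<in> {a..b}" "cis (2 * pi * t) = cis (2 * pi * s)"
        using c unfolding arc_def image_iff by blast
      then have "sin (2 * pi * t) = sin (2 * pi * s) \<and> cos (2 * pi * t) = cos (2 * pi * s)"
        by (auto simp: complex_eq_iff)
      then obtain n :: int where "2 * pi * t = 2 * pi * s + 2 * pi * n"
        using sin_cos_eq_iff by metis
      then have "2 * pi * t = 2 * pi * (s + n)" by (simp add: distrib_left)
      then have ts: "t = s + n" by simp
      then have "\<bar>real_of_int n\<bar> < 1" using s t assms by auto
      then have "n = 0" by linarith
      then show ?thesis using ts s by simp
    qed
    moreover have "cis (2 * pi * t) \<in> arc" if "t \<in> {a..b}" using that by (auto simp: arc_def)
    ultimately have "cis (2 * pi * t) \<in> arc \<longleftrightarrow> t \<in> {a..b}" by blast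
    then show "indicator arc (cis (2 * pi * t)) = (indicator {a..b} t :: real)"
      unfolding indicator_def by simp
  qed auto
  have "(\<lambda>n. integral {0..1} (\<lambda>t. h n (cis (2 * pi * t)))) \<longlonglongrightarrow>
       integral {0..1} (\<lambda>t. indicator arc (cis (2 * pi * t)))"
  proof (rule dominated_convergence(2)[where h = "\<lambda>_. 1"])
    show "(\<lambda>t. h n (cis (2 * pi * t))) integrable_on {0..1}" for n
      by (intro integrable_continuous_real contp)
  qed (use h01 lim in auto)
  then have "(\<lambda>n. integral {0..1} (\<lambda>t. h n (cis (2 * pi * t)))) \<longlonglongrightarrow> b - a"
    using integral_unique[OF arcint] by simp
  from tendstoD[OF this, of "e / 2"] assms obtain n
    where "\<bar>integral {0..1} (\<lambda>t. h n (cis (2 * pi * t))) - (b - a)\<bar> < e / 2"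
    unfolding eventually_sequentially dist_real_def by auto
  then have n: "integral {0..1} (\<lambda>t. h n (cis (2 * pi * t))) \<le> b - a + e / 2" by linarith
  \<comment> \<open>The error \<open>e\<close> is spent in two halves: one for passing from the arc
    to the tent, one for the polynomial, whose uniform error \<open>e / 4\<close> is doubled when
    \<open>g\<close> is raised by \<open>e / 4\<close> to lie above the tent.\<close>
  obtain g where g: "real_polynomial_function g" "\<And>z. z \<in> sphere 0 1 \<Longrightarrow> \<bar>h n z - g z\<bar> < e / 4"
    by (rule Stone_Weierstrass_real_polynomial_function[OF compact_sphere[of 0 1] cont, of "e / 4"])
      (use assms that in auto)
  define p where "p t = g (cis (2 * pi * t)) + e / 4" for t
  have p: "h n (cis (2 * pi * t)) \<le> p t" "p t \<le> h n (cis (2 * pi * t)) + e / 2" for t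
  proof -
    have "\<bar>h n (cis (2 * pi * t)) - g (cis (2 * pi * t))\<bar> < e / 4" by (rule g(2)) simp
    then show "h n (cis (2 * pi * t)) \<le> p t" "p t \<le> h n (cis (2 * pi * t)) + e / 2"
      unfolding p_def by linarith+
  qed
  have contpp: "continuous_on {0..1} p"
    unfolding p_def
    by (intro continuous_intros continuous_on_compose2[OF continuous_on_polymonial_function[OF g(1)[unfolded real_polynomial_function_eq], of UNIV]]) auto
  show thesis
  proof
    show "trig (\<lambda>t. of_real (p t))"
      unfolding p_def of_real_add by (intro trig.add trig_real_polynomial g trig_const)
    show "p t \<ge> 0" for t using p(1)[of t] h01(1)[of n "cis (2 * pi * t)"] by linarith
    show "p integrable_on {0..1}" by (rule integrable_continuous_real) (rule contpp)
    show "p t \<ge> 1" if t: "frac t \<in> {a..<b}" for t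
    proof -
      have "cis (2 * pi * t) = cis (2 * pi * frac t) * cis (2 * pi * of_int \<lfloor>t\<rfloor>)"
        by (simp add: cis_mult frac_def algebra_simps)
      then have "cis (2 * pi * t) \<in> arc"
        using t by (auto simp: cis_2pi_of_int arc_def)
      then show ?thesis using p(1)[of t] h01(3) by simp
    qed
    have "integral {0..1} p \<le> integral {0..1} (\<lambda>t. h n (cis (2 * pi * t)) + e / 2)"
      by (intro integral_le integrable_continuous_real continuous_intros contp contpp p)
    also have "\<dots> = integral {0..1} (\<lambda>t. h n (cis (2 * pi * t))) + e / 2"
      by (subst Henstock_Kurzweil_Integration.integral_add)
        (auto intro!: integrable_continuous_real contp)
    finally show "integral {0..1} p \<le> b - a + e" using n by linarith
  qed
qed

text \<open>A grid cell is a product of intervals, so the product of one-variable majorants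
  dominates its indicator. The average of that product tends to the product of the integrals, each
  at most \<open>1 / M + d\<close>.\<close>

lemma grid_cell_upper_freq:
  fixes r :: "'i \<Rightarrow> real ^ 'n" and M :: nat
  assumes "finite I" "rat_free I r" "M > 0" "\<And>i. i \<in> I \<Longrightarrow> c i < M" "e > 0"
  shows "\<forall>\<^sub>F P in box_filter.
    real (card ({x. \<forall>i\<in>I. \<lfloor>M * frac (r i \<bullet> real_vec x)\<rfloor> = int (c i)} \<inter> P)) / real (card P)
      \<le> (1 / M) ^ card I + e"
proof -
  let ?A = "{x. \<forall>i\<in>I. \<lfloor>M * frac (r i \<bullet> real_vec x)\<rfloor> = int (c i)}"
  \<comment> \<open>\<open>d\<close> will be the excess allowed to each one-variable integral;
    continuity of the power keeps the resulting excess of the product below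
    \<open>e / 2\<close>.\<close>
  have "((\<lambda>d. (1 / M + d) ^ card I) \<longlongrightarrow> (1 / real M + 0) ^ card I) (at_right 0)"
    by (intro tendsto_intros)
  then have "\<forall>\<^sub>F d in at_right 0. (1 / M + d) ^ card I < (1 / M) ^ card I + e / 2"
    using assms(5) by (intro order_tendstoD) auto
  moreover have "\<forall>\<^sub>F d in at_right 0. (d :: real) > 0" by (simp add: eventually_at_right_less)
  ultimately have "\<forall>\<^sub>F d in at_right 0. (1 / M + d) ^ card I < (1 / M) ^ card I + e / 2 \<and> (d :: real) > 0"
    by eventually_elim auto
  then obtain d :: real where d: "d > 0" "(1 / M + d) ^ card I < (1 / M) ^ card I + e / 2"
    using eventually_happens'[OF trivial_limit_at_right_real] by blast
  define ok where "ok i p \<longleftrightarrow> trig (\<lambda>t. of_real (p t)) \<and> (\<forall>t. p t \<ge> 0) \<and>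
    (\<forall>t. frac t \<in> {c i / M..<(c i + 1) / M} \<longrightarrow> p t \<ge> 1) \<and> p integrable_on {0..1} \<and>
    integral {0..1} p \<le> 1 / M + d" for i and p :: "real \<Rightarrow> real"
  have "\<exists>p. ok i p" if i: "i \<in> I" for i
  proof -
    have "real (c i) + 1 \<le> M" using assms(4)[OF i] by linarith
    then have "0 \<le> c i / M" "c i / M < (c i + 1) / M" "(c i + 1) / M \<le> 1"
      using assms(3) by (auto simp: field_simps)
    then obtain p :: "real \<Rightarrow> real" where p: "trig (\<lambda>t. of_real (p t))" "\<And>t. p t \<ge> 0"
      "\<And>t. frac t \<in> {c i / M..<(c i + 1) / M} \<Longrightarrow> p t \<ge> 1" "p integrable_on {0..1}"
      "integral {0..1} p \<le> (c i + 1) / M - c i / M + d"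
      by (rule trig_majorant[OF _ _ _ d(1)]) (rule that)
    moreover have "(c i + 1) / M - c i / M = 1 / M" by (simp add: add_divide_distrib)
    ultimately show ?thesis unfolding ok_def by (intro exI[of _ p]) auto
  qed
  then obtain p where ok: "\<And>i. i \<in> I \<Longrightarrow> ok i (p i)" by metis
  have p: "\<And>i. i \<in> I \<Longrightarrow> trig (\<lambda>t. of_real (p i t))"
    "\<And>i t. i \<in> I \<Longrightarrow> p i t \<ge> 0"
    "\<And>i t. i \<in> I \<Longrightarrow> frac t \<in> {c i / M..<(c i + 1) / M} \<Longrightarrow> p i t \<ge> 1"
    "\<And>i. i \<in> I \<Longrightarrow> p i integrable_on {0..1}"
    "\<And>i. i \<in> I \<Longrightarrow> integral {0..1} (p i) \<le> 1 / M + d"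
    using ok unfolding ok_def by blast+
  have cint: "integral {0..1} (\<lambda>t. complex_of_real (p i t)) = of_real (integral {0..1} (p i))" if "i \<in> I" for i
    using has_integral_of_real[OF integrable_integral[OF p(4)[OF that]]] by (rule integral_unique)
  have "((\<lambda>P. (\<Sum>x\<in>P. \<Prod>i\<in>I. complex_of_real (p i (r i \<bullet> real_vec x))) / of_nat (card P)) \<longlongrightarrow>
     (\<Prod>i\<in>I. integral {0..1} (\<lambda>t. complex_of_real (p i t)))) box_filter"
    by (rule trig_product_average[OF assms(1,2) p(1)])
  from tendsto_Re[OF this]
  have "((\<lambda>P. (\<Sum>x\<in>P. \<Prod>i\<in>I. p i (r i \<bullet> real_vec x)) / real (card P)) \<longlongrightarrow>
     (\<Prod>i\<in>I. integral {0..1} (p i))) box_filter"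
    by (simp add: cint flip: of_real_prod of_real_sum)
  then have "\<forall>\<^sub>F P in box_filter. (\<Sum>x\<in>P. \<Prod>i\<in>I. p i (r i \<bullet> real_vec x)) / real (card P)
      < (\<Prod>i\<in>I. integral {0..1} (p i)) + e / 2"
    using assms(5) by (intro order_tendstoD) auto
  then show ?thesis using eventually_box_filter_ok
  proof eventually_elim
    case (elim P)
    have "real (card (?A \<inter> P)) = (\<Sum>x\<in>P. if x \<in> ?A then 1 else 0)"
      using elim by (simp add: sum.If_cases Int_commute)
    also have "\<dots> \<le> (\<Sum>x\<in>P. \<Prod>i\<in>I. p i (r i \<bullet> real_vec x))"
    proof (rule sum_mono)
      fix x
      show "(if x \<in> ?A then 1 else 0) \<le> (\<Prod>i\<in>I. p i (r i \<bullet> real_vec x))"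
      proof (cases "x \<in> ?A")
        case True
        have "p i (r i \<bullet> real_vec x) \<ge> 1" if i: "i \<in> I" for i
        proof (rule p(3)[OF i])
          have "\<lfloor>M * frac (r i \<bullet> real_vec x)\<rfloor> = int (c i)" using True i by blast
          then have "real (c i) \<le> M * frac (r i \<bullet> real_vec x)" "M * frac (r i \<bullet> real_vec x) < real (c i) + 1"
            by linarith+
          then show "frac (r i \<bullet> real_vec x) \<in> {c i / M..<(c i + 1) / M}"
            using assms(3) by (auto simp: field_simps)
        qed
        then show ?thesis using True by (auto intro: prod_ge_1)
      qed (auto intro: prod_nonneg p)
    qed
    finally have "real (card (?A \<inter> P)) / real (card P) \<le> (\<Sum>x\<in>P. \<Prod>i\<in>I. p i (r i \<bullet> real_vec x)) / real (card P)"
      by (intro divide_right_mono) auto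
    also have "\<dots> \<le> (\<Prod>i\<in>I. integral {0..1} (p i)) + e / 2" using elim by simp
    also have "(\<Prod>i\<in>I. integral {0..1} (p i)) \<le> (\<Prod>i\<in>I. 1 / M + d)"
      by (intro prod_mono conjI p Henstock_Kurzweil_Integration.integral_nonneg) auto
    also have "\<dots> \<le> (1 / M) ^ card I + e / 2" using d by simp
    finally show ?case by simp
  qed
qed

subsection \<open>Almost everywhere locally constant functions\<close>

abbreviation PL :: "'i set \<Rightarrow> ('i \<Rightarrow> real) measure" where
  "PL I \<equiv> PiM I (\<lambda>_. lborel)"

lemma product_sigma_finite_lborel: "product_sigma_finite (\<lambda>_. lborel :: real measure)"
  by (simp add: product_sigma_finite_def lborel.sigma_finite_measure_axioms)

text \<open>Jordan measurability is handled pointwise: the indicator is locally constant almost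
  everywhere. This notion is stable under composition, unlike frontiers.\<close>

definition loc_const :: "('a::topological_space \<Rightarrow> 'b) \<Rightarrow> 'a \<Rightarrow> bool" where
  "loc_const f y \<longleftrightarrow> eventually (\<lambda>y'. f y' = f y) (nhds y)"

lemma loc_const_comp2:
  assumes "loc_const f y" "loc_const g y" shows "loc_const (\<lambda>y. h (f y) (g y)) y"
  using assms unfolding loc_const_def by eventually_elim simp

lemma space_PL: "space (PL I) = (\<Pi>\<^sub>E i\<in>I. UNIV)"
  by (simp add: space_PiM)

text \<open>\<open>PL I\<close> lives on functions that are \<open>undefined\<close> off
  \<open>I\<close>, while neighbourhoods are taken in the full function type. As the index type is
  countable, the Borel sets there coincide with the product sigma-algebra, so Borel conditions
  define sets of \<open>PL I\<close>.\<close>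

lemma PL_measurable_id:
  "(\<lambda>y. y) \<in> PL (I :: 'i::countable set) \<rightarrow>\<^sub>M borel"
proof -
  have "(\<lambda>y. y) \<in> PL I \<rightarrow>\<^sub>M PiM UNIV (\<lambda>i::'i. borel :: real measure)"
  proof (rule measurable_PiM_single')
    fix i :: 'i
    show "(\<lambda>y. y i) \<in> borel_measurable (PL I)"
    proof (cases "i \<in> I")
      case True
      then show ?thesis using measurable_component_singleton[of i I "\<lambda>_. lborel :: real measure"] by simp
    next
      case False
      have "(\<lambda>y. y i) \<in> borel_measurable (PL I) \<longleftrightarrow> (\<lambda>y :: 'i \<Rightarrow> real. undefined :: real) \<in> borel_measurable (PL I)"
        using False by (intro measurable_cong) (auto simp: space_PL PiE_def extensional_def)
      then show ?thesis by simp
    qed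
  qed auto
  then show ?thesis
    using measurable_cong_sets[OF refl sets_PiM_equal_borel] by blast
qed

lemma PL_borel_in_sets:
  fixes I :: "'i::countable set"
  assumes "W \<in> sets borel"
  shows "{y \<in> space (PL I). y \<in> W} \<in> sets (PL I)"
  using measurable_sets[OF PL_measurable_id assms, of I] by (simp add: vimage_def Int_def conj_commute)

lemma continuous_coordinate: "continuous_on A (\<lambda>y :: 'i \<Rightarrow> real. y i)"
  by (rule continuous_on_product_then_coordinatewise[OF continuous_on_id])

text \<open>Together with the inclusion in \<open>continuous_map_PiE_id\<close>, this moves open
  sets between the product topology over \<open>I\<close>, in which Jordan measurability is stated,
  and the full function type, in which \<open>nhds\<close> is taken.\<close>

lemma continuous_map_restrict:
  "continuous_map euclidean (product_topology (\<lambda>_. euclidean :: real topology) I) (\<lambda>y. restrict y I)"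
  by (auto simp: continuous_map_componentwise continuous_coordinate)

lemma continuous_map_PiE_id:
  "continuous_map (product_topology (\<lambda>_. euclidean :: real topology) I) euclidean (\<lambda>y. y)"
  unfolding euclidean_product_topology[symmetric] continuous_map_componentwise_UNIV
proof
  fix i
  show "continuous_map (product_topology (\<lambda>_. euclidean :: real topology) I) euclidean (\<lambda>y. y i)"
  proof (cases "i \<in> I")
    case True
    then show ?thesis by (rule continuous_map_product_projection)
  next
    case False
    have "continuous_map (product_topology (\<lambda>_. euclidean :: real topology) I) euclidean (\<lambda>y. undefined)" by simp
    then show ?thesis
      by (rule continuous_map_eq) (use False in \<open>auto simp: PiE_def extensional_def\<close>)
  qed
qed

lemma open_vimage_restrict:
  assumes "openin (product_topology (\<lambda>_. euclidean :: real topology) I) W"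
  shows "open {y. restrict y I \<in> W}"
  using openin_continuous_map_preimage[OF continuous_map_restrict assms] by simp

lemma openin_PiE_Int:
  assumes "open W"
  shows "openin (product_topology (\<lambda>_. euclidean :: real topology) I) (W \<inter> (\<Pi>\<^sub>E i\<in>I. UNIV))"
  using openin_continuous_map_preimage[OF continuous_map_PiE_id, of W I] assms
  by (simp add: Int_def conj_commute)

lemma restrict_PL [simp]: "y \<in> space (PL I) \<Longrightarrow> restrict y I = y"
  by (simp add: space_PL)

lemma openin_sets_PL:
  fixes I :: "'i::countable set"
  assumes "openin (product_topology (\<lambda>_. euclidean) I) W"
  shows "W \<in> sets (PL I)"
proof -
  have "W = {y \<in> space (PL I). y \<in> {y. restrict y I \<in> W}}"
    using openin_subset[OF assms] by (auto simp: space_PL)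
  also have "\<dots> \<in> sets (PL I)"
    by (intro PL_borel_in_sets borel_open open_vimage_restrict assms)
  finally show ?thesis .
qed

text \<open>A point off the frontier lies in a relatively open set that is either inside
  \<open>G\<close> or disjoint from it; \<open>restrict\<close> pulls this set back to a
  neighbourhood in the full function type.\<close>

lemma jordan_measurable_onD:
  fixes I :: "'i::countable set"
  assumes "jordan_measurable_on I G"
  shows "AE y in PL I. loc_const (\<lambda>y. restrict y I \<in> G) y"
proof -
  let ?T = "product_topology (\<lambda>_. euclidean :: real topology) I"
  have null: "?T frontier_of G \<in> null_sets (PL I)"
    using assms by (simp add: jordan_measurable_on_def)
  have lc: "loc_const (\<lambda>y. restrict y I \<in> G) y"
    if W: "openin ?T W" "restrict y I \<in> W" "W \<subseteq> G \<or> W \<inter> G = {}" for W y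
  proof -
    have "eventually (\<lambda>y'. y' \<in> {y. restrict y I \<in> W}) (nhds y)"
      using W by (intro eventually_nhds_in_open open_vimage_restrict) auto
    then show ?thesis unfolding loc_const_def by eventually_elim (use W in auto)
  qed
  show ?thesis
  proof (rule AE_I'[OF null], safe)
    fix y assume y: "y \<in> space (PL I)" "\<not> loc_const (\<lambda>y. restrict y I \<in> G) y"
    then have yt: "y \<in> topspace ?T" by (simp add: space_PL)
    show "y \<in> ?T frontier_of G"
    proof (rule ccontr)
      assume "y \<notin> ?T frontier_of G"
      then consider "y \<in> ?T interior_of G" | "y \<notin> ?T closure_of G"
        by (auto simp: frontier_of_def)
      then show False
      proof cases
        case 1
        then show False
          using lc[of "?T interior_of G" y] y interior_of_subset[of ?T G] by auto
      next
        case 2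
        then obtain W where "y \<in> W" "openin ?T W" "W \<inter> G = {}"
          using yt unfolding in_closure_of by auto
        then show False using lc[of W y] y by auto
      qed
    qed
  qed
qed

lemma jordan_measurable_onI:
  fixes I :: "'i::countable set"
  assumes "G \<subseteq> (\<Pi>\<^sub>E i\<in>I. UNIV)" "\<And>g i. g \<in> G \<Longrightarrow> i \<in> I \<Longrightarrow> \<bar>g i\<bar> \<le> C"
    and "AE y in PL I. loc_const (\<lambda>y. restrict y I \<in> G) y"
  shows "jordan_measurable_on I G"
proof -
  let ?T = "product_topology (\<lambda>_. euclidean :: real topology) I"
  obtain N where N: "{y \<in> space (PL I). \<not> loc_const (\<lambda>y. restrict y I \<in> G) y} \<subseteq> N"
    "emeasure (PL I) N = 0" "N \<in> sets (PL I)"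
    using AE_E[OF assms(3)] .
  \<comment> \<open>\<open>PL I\<close> is not completed, so a subset of a null set must be shown
    measurable on its own; here it is because the frontier is closed.\<close>
  have "topspace ?T - ?T frontier_of G \<in> sets (PL I)"
    by (intro openin_sets_PL openin_diff openin_topspace closedin_frontier_of)
  then have "space (PL I) - (topspace ?T - ?T frontier_of G) \<in> sets (PL I)" by (rule sets.compl_sets)
  also have "space (PL I) - (topspace ?T - ?T frontier_of G) = ?T frontier_of G"
    using frontier_of_subset_topspace[of ?T G] by (auto simp: space_PL)
  finally have meas: "?T frontier_of G \<in> sets (PL I)" .
  have "?T frontier_of G \<subseteq> N"
  proof
    fix y assume y: "y \<in> ?T frontier_of G"
    then have yt: "y \<in> topspace ?T" using frontier_of_subset_topspace[of ?T G] by auto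
    have "\<not> loc_const (\<lambda>y. restrict y I \<in> G) y"
    proof
      assume "loc_const (\<lambda>y. restrict y I \<in> G) y"
      then obtain W where W: "open W" "y \<in> W" "\<And>y'. y' \<in> W \<Longrightarrow> restrict y' I \<in> G \<longleftrightarrow> restrict y I \<in> G"
        unfolding loc_const_def eventually_nhds by auto
      define V where "V = W \<inter> (\<Pi>\<^sub>E i\<in>I. UNIV)"
      have V: "openin ?T V" "y \<in> V" unfolding V_def using openin_PiE_Int[OF W(1)] W(2) yt by auto
      have res: "restrict y' I = y'" if "y' \<in> V" for y' using that unfolding V_def by (blast intro: PiE_restrict)
      show False
      proof (cases "y \<in> G")
        case True
        then have "V \<subseteq> G" using W(3) res V unfolding V_def by (metis IntD1 subsetI)
        then have "y \<in> ?T interior_of G" using interior_of_maximal[OF _ V(1)] V(2) by blast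
        then show False using y by (simp add: frontier_of_def)
      next
        case False
        then have "V \<inter> G = {}" using W(3) res V unfolding V_def by (metis IntD1 disjoint_iff)
        then have "y \<notin> ?T closure_of G" using V unfolding in_closure_of by blast
        then show False using y by (simp add: frontier_of_def)
      qed
    qed
    then show "y \<in> N" using N(1) yt by (auto simp: space_PL)
  qed
  moreover have "N \<in> null_sets (PL I)" using N by auto
  ultimately have "?T frontier_of G \<in> null_sets (PL I)" using meas null_sets_subset by blast
  then show ?thesis unfolding jordan_measurable_on_def using assms(1,2) by blast
qed

text \<open>The cylinder over a null set is null: after splitting \<open>J\<close> into
  \<open>I\<close> and \<open>J - I\<close>, its slice over \<open>x\<close> is empty for almost
  every \<open>x\<close>.\<close>

lemma AE_PL_restrict:
  assumes "finite J" "I \<subseteq> J" "AE y in PL I. Q y"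
  shows "AE y in PL J. Q (restrict y I)"
proof -
  interpret product_sigma_finite "\<lambda>_. lborel :: real measure" by (rule product_sigma_finite_lborel)
  obtain N where N: "{y \<in> space (PL I). \<not> Q y} \<subseteq> N" "emeasure (PL I) N = 0" "N \<in> sets (PL I)"
    using AE_E[OF assms(3)] .
  have J: "I \<union> (J - I) = J" "I \<inter> (J - I) = {}" "finite I" "finite (J - I)"
    using assms finite_subset by auto
  define A where "A = {y \<in> space (PL J). restrict y I \<in> N}"
  have A: "A \<in> sets (PL J)"
    unfolding A_def using measurable_sets[OF measurable_restrict_subset[OF assms(2), of "\<lambda>_. lborel :: real measure"] N(3)]
    by (simp add: vimage_def Int_def conj_commute)
  have "emeasure (PL (I \<union> (J - I))) A = (\<integral>\<^sup>+x. emeasure (PL (J - I)) ((\<lambda>y. merge I (J - I) (x, y)) -` A \<inter> space (PL (J - I))) \<partial>PL I)"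
    by (rule emeasure_fold_integral) (use J A in auto)
  also have "\<dots> = (\<integral>\<^sup>+x. 0 \<partial>PL I)"
  proof (rule nn_integral_cong_AE)
    have "AE x in PL I. x \<notin> N" by (rule AE_not_in) (use N in auto)
    then show "AE x in PL I. emeasure (PL (J - I)) ((\<lambda>y. merge I (J - I) (x, y)) -` A \<inter> space (PL (J - I))) = 0"
      using AE_space
    proof eventually_elim
      case (elim x)
      have "restrict (merge I (J - I) (x, y)) I = restrict x I" for y
        by (auto simp: merge_def restrict_def)
      then have "(\<lambda>y. merge I (J - I) (x, y)) -` A \<inter> space (PL (J - I)) = {}"
        using elim by (auto simp: A_def)
      then show ?case by simp
    qed
  qed
  finally have "A \<in> null_sets (PL J)" using A J by auto
  moreover have "{y \<in> space (PL J). \<not> Q (restrict y I)} \<subseteq> A"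
    unfolding A_def using N(1) by (auto simp: space_PL)
  ultimately show ?thesis by (rule AE_I')
qed

section \<open>Blocks of coordinates as vectors\<close>

definition blk :: "int \<Rightarrow> (int \<times> 'n \<Rightarrow> real) \<Rightarrow> real ^ 'n" where
  "blk k y = (\<chi> i. y (k, i))"

lemma continuous_blk: "continuous_on A (blk k :: (int \<times> 'n::finite \<Rightarrow> real) \<Rightarrow> real ^ 'n)"
  unfolding blk_def by (intro continuous_on_vec_lambda continuous_coordinate)

lemma blk_measurable: "(blk k :: _ \<Rightarrow> real ^ 'n::finite) \<in> PL I \<rightarrow>\<^sub>M borel"
  by (rule measurable_comp[OF PL_measurable_id, of "blk k" borel, unfolded comp_def])
    (intro borel_measurable_continuous_onI continuous_blk)

lemma distr_blk_lborel:
  "distr (PL ({k} \<times> (UNIV :: 'n::finite set))) borel (blk k) = (lborel :: (real ^ 'n) measure)"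
proof (rule lborel_eqI[symmetric])
  interpret product_sigma_finite "\<lambda>_. lborel :: real measure" by (rule product_sigma_finite_lborel)
  let ?J = "{k} \<times> (UNIV :: 'n set)"
  note meas = blk_measurable[of k ?J]
  fix l u :: "real ^ 'n" assume lu: "\<And>b. b \<in> Basis \<Longrightarrow> l \<bullet> b \<le> u \<bullet> b"
  have lu': "l $ i \<le> u $ i" for i
    using lu[of "axis i 1"] by (simp add: inner_axis axis_in_Basis_iff)
  have "emeasure (distr (PL ?J) borel (blk k)) (box l u) = emeasure (PL ?J) (blk k -` box l u \<inter> space (PL ?J))"
    by (rule emeasure_distr[OF meas]) simp
  also have "blk k -` box l u \<inter> space (PL ?J) = (\<Pi>\<^sub>E p\<in>?J. {l $ snd p<..<u $ snd p})"
    by (auto simp: blk_def space_PL mem_box_cart PiE_iff)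
  also have "emeasure (PL ?J) \<dots> = (\<Prod>p\<in>?J. emeasure lborel {l $ snd p<..<u $ snd p})"
    by (rule emeasure_PiM) auto
  also have "\<dots> = (\<Prod>i\<in>UNIV. ennreal (u $ i - l $ i))"
    by (rule prod.reindex_bij_witness[where i = "\<lambda>i. (k, i)" and j = snd]) (auto simp: lu')
  also have "\<dots> = ennreal (\<Prod>i\<in>UNIV. u $ i - l $ i)"
    by (rule prod_ennreal) (simp add: lu')
  also have "(\<Prod>i\<in>UNIV. u $ i - l $ i) = (\<Prod>b\<in>Basis. (u - l) \<bullet> b)"
  proof -
    have B: "(Basis :: (real ^ 'n) set) = range (\<lambda>i. axis i 1)" by (auto simp: Basis_vec_def)
    have "inj (\<lambda>i::'n. axis i (1::real))" by (auto simp: inj_def axis_eq_axis)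
    then show ?thesis unfolding B by (simp add: prod.reindex inner_axis)
  qed
  finally show "emeasure (distr (PL ?J) borel (blk k)) (box l u) = (\<Prod>b\<in>Basis. (u - l) \<bullet> b)" .
qed simp

text \<open>With all coordinates outside block \<open>k\<close> fixed, \<open>c\<close> is constant
  and the bad values of the block form a translate of the null set \<open>T\<close>. Fubini over the
  remaining coordinates gives the claim.\<close>

lemma AE_blk_notin_null:
  fixes c :: "(int \<times> 'n::finite \<Rightarrow> real) \<Rightarrow> real ^ 'n"
  assumes "finite I" "{k} \<times> UNIV \<subseteq> I" and T: "T \<in> null_sets lborel"
    and c: "continuous_on UNIV c" "\<And>y y'. (\<And>p. fst p \<noteq> k \<Longrightarrow> y p = y' p) \<Longrightarrow> c y = c y'"
  shows "AE y in PL I. blk k y + c y \<notin> T"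
proof -
  interpret product_sigma_finite "\<lambda>_. lborel :: real measure" by (rule product_sigma_finite_lborel)
  let ?J = "{k} \<times> (UNIV :: 'n set)"
  define K where "K = I - ?J"
  have J: "K \<union> ?J = I" "K \<inter> ?J = {}" "finite K" "finite ?J"
    using assms(1,2) by (auto simp: K_def)
  have Tb: "T \<in> sets borel" using T by auto
  define A where "A = {y \<in> space (PL I). y \<in> (\<lambda>y. blk k y + c y) -` T}"
  have A: "A \<in> sets (PL I)"
    unfolding A_def
  proof (rule PL_borel_in_sets)
    have "(\<lambda>y. blk k y + c y) \<in> borel_measurable borel"
      by (intro borel_measurable_continuous_onI continuous_on_add continuous_blk c)
    from measurable_sets[OF this Tb] show "(\<lambda>y. blk k y + c y) -` T \<in> sets borel" by simp
  qed
  note meas = blk_measurable[of k ?J]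
  have "emeasure (PL (K \<union> ?J)) A = (\<integral>\<^sup>+x. emeasure (PL ?J) ((\<lambda>y. merge K ?J (x, y)) -` A \<inter> space (PL ?J)) \<partial>PL K)"
    by (rule emeasure_fold_integral) (use J A in auto)
  also have "\<dots> = (\<integral>\<^sup>+x. 0 \<partial>PL K)"
  proof (rule nn_integral_cong)
    fix x assume x: "x \<in> space (PL K)"
    have b: "blk k (merge K ?J (x, y)) = blk k y" for y
      using J(2) by (auto simp: blk_def merge_def vec_eq_iff)
    \<comment> \<open>Off block \<open>k\<close> the merged point agrees with \<open>x\<close>, also
      outside \<open>I\<close>, where both are \<open>undefined\<close>.\<close>
    have cc: "c (merge K ?J (x, y)) = c x" for y
      using x by (intro c(2)) (auto simp: merge_def space_PL PiE_def extensional_def)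
    define T' where "T' = (\<lambda>v. v + c x) -` T"
    have T'b: "T' \<in> sets borel"
      unfolding T'_def using measurable_sets[OF _ Tb, of "\<lambda>v. v + c x" borel] by simp
    have "emeasure lborel T = emeasure (distr lborel borel ((+) (c x))) T" by (simp add: lborel_distr_plus)
    also have "\<dots> = emeasure lborel T'"
      using Tb by (subst emeasure_distr) (auto simp: T'_def vimage_def add.commute)
    finally have "emeasure lborel T' = 0" using T by auto
    then have "emeasure (distr (PL ?J) borel (blk k)) T' = 0" by (simp add: distr_blk_lborel)
    then have "emeasure (PL ?J) (blk k -` T' \<inter> space (PL ?J)) = 0"
      using emeasure_distr[OF meas T'b] by simp
    moreover have "(\<lambda>y. merge K ?J (x, y)) -` A \<inter> space (PL ?J) \<subseteq> blk k -` T' \<inter> space (PL ?J)"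
      unfolding A_def T'_def using b cc by auto
    moreover have "blk k -` T' \<inter> space (PL ?J) \<in> sets (PL ?J)" by (rule measurable_sets[OF meas T'b])
    ultimately show "emeasure (PL ?J) ((\<lambda>y. merge K ?J (x, y)) -` A \<inter> space (PL ?J)) = 0"
      by (metis emeasure_mono le_zero_eq)
  qed
  finally have "A \<in> null_sets (PL I)" using A J by auto
  then show ?thesis by (rule AE_I') (auto simp: A_def)
qed

subsection \<open>Equidistribution of quasiperiodic sets\<close>

definition unit_cube :: "'i set \<Rightarrow> ('i \<Rightarrow> real) set" where
  "unit_cube I = (\<Pi>\<^sub>E i\<in>I. {0..<1})"

lemma unit_cube_in_sets: "finite I \<Longrightarrow> unit_cube I \<in> sets (PL I)"
  unfolding unit_cube_def by (intro sets_PiM_I_finite) auto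

lemma emeasure_unit_cube: "finite I \<Longrightarrow> emeasure (PL I) (unit_cube I) = 1"
  using product_sigma_finite.emeasure_PiM[OF product_sigma_finite_lborel, of I "\<lambda>_. {0..<1}"]
  by (simp add: unit_cube_def)

lemma AE_coordinate_neq:
  assumes "finite I" "i \<in> I"
  shows "AE y in PL I. y i \<noteq> a"
proof -
  define B where "B j = (if j = i then {a} else UNIV)" for j
  have "emeasure (PL I) (Pi\<^sub>E I B) = (\<Prod>j\<in>I. emeasure lborel (B j))"
    using assms by (intro product_sigma_finite.emeasure_PiM[OF product_sigma_finite_lborel]) (auto simp: B_def)
  also have "\<dots> = 0" using assms by (auto simp: prod_zero_iff B_def)
  finally have "Pi\<^sub>E I B \<in> null_sets (PL I)"
    using assms by (auto intro!: sets_PiM_I_finite simp: B_def)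
  moreover have "{y \<in> space (PL I). \<not> y i \<noteq> a} \<subseteq> Pi\<^sub>E I B"
    by (simp add: B_def space_PL PiE_def subset_iff)
  ultimately show ?thesis by (rule AE_I')
qed

lemma loc_const_unit_interval:
  assumes "isCont f y" "f y \<noteq> (0::real)" "f y \<noteq> 1"
  shows "loc_const (\<lambda>y. 0 \<le> f y \<and> f y < 1) y"
proof -
  have t: "(f \<longlongrightarrow> f y) (nhds y)" using assms(1) by (simp add: continuous_within tendsto_at_iff_tendsto_nhds)
  have "\<forall>\<^sub>F y' in nhds y. (0 \<le> f y' \<longleftrightarrow> 0 \<le> f y)"
  proof (cases "f y > 0")
    case True
    show ?thesis using order_tendstoD(1)[OF t True] by eventually_elim (use True in auto)
  next
    case False
    then have "f y < 0" using assms by auto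
    show ?thesis using order_tendstoD(2)[OF t \<open>f y < 0\<close>] by eventually_elim (use \<open>f y < 0\<close> in auto)
  qed
  moreover have "\<forall>\<^sub>F y' in nhds y. (f y' < 1 \<longleftrightarrow> f y < 1)"
  proof (cases "f y > 1")
    case True
    show ?thesis using order_tendstoD(1)[OF t True] by eventually_elim (use True in auto)
  next
    case False
    then have "f y < 1" using assms by auto
    show ?thesis using order_tendstoD(2)[OF t \<open>f y < 1\<close>] by eventually_elim (use \<open>f y < 1\<close> in auto)
  qed
  ultimately show ?thesis unfolding loc_const_def by eventually_elim auto
qed

lemma AE_loc_const_unit_cube:
  fixes I :: "'i::countable set"
  assumes "finite I"
  shows "AE y in PL I. loc_const (\<lambda>y. \<forall>i\<in>I. 0 \<le> y i \<and> y i < 1) y"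
proof -
  have "AE y in PL I. \<forall>i\<in>I. y i \<noteq> 0 \<and> y i \<noteq> 1"
    using AE_coordinate_neq[OF assms] by (auto intro!: AE_finite_allI assms)
  then show ?thesis
  proof eventually_elim
    case (elim y)
    have "\<forall>i\<in>I. loc_const (\<lambda>y. 0 \<le> y i \<and> y i < 1) y"
    proof
      fix i assume i: "i \<in> I"
      have "isCont (\<lambda>y. y i) y"
        using continuous_on_interior[OF continuous_coordinate[of UNIV i]] by simp
      then show "loc_const (\<lambda>y. 0 \<le> y i \<and> y i < 1) y"
        using elim i by (intro loc_const_unit_interval) auto
    qed
    then have "\<forall>\<^sub>F y' in nhds y. \<forall>i\<in>I. (0 \<le> y' i \<and> y' i < 1) = (0 \<le> y i \<and> y i < 1)"
      unfolding loc_const_def by (intro eventually_ball_finite assms) auto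
    then show ?case unfolding loc_const_def by eventually_elim auto
  qed
qed

lemma restrict_in_unit_cube_iff: "restrict y I \<in> unit_cube I \<longleftrightarrow> (\<forall>i\<in>I. 0 \<le> y i \<and> y i < 1)"
  by (auto simp: unit_cube_def PiE_iff)

text \<open>The radii of the coordinates have a positive minimum over a finite set; coordinates off
  \<open>I\<close> are therefore required to agree exactly.\<close>

lemma eventually_nhds_fun_ball:
  fixes y :: "'i \<Rightarrow> real"
  assumes "eventually P (nhds y)" "finite I"
  obtains d where "d > 0" "\<And>y'. (\<And>i. i \<in> I \<Longrightarrow> \<bar>y' i - y i\<bar> < d) \<Longrightarrow> (\<And>i. i \<notin> I \<Longrightarrow> y' i = y i) \<Longrightarrow> P y'"
proof -
  obtain W where W: "open W" "y \<in> W" "\<And>y'. y' \<in> W \<Longrightarrow> P y'"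
    using assms(1) unfolding eventually_nhds by auto
  have "openin (product_topology (\<lambda>i. euclidean) UNIV) W"
    using W(1) by (simp add: open_fun_def)
  from product_topology_open_contains_basis[OF this W(2)]
  obtain X where X: "y \<in> (\<Pi>\<^sub>E i\<in>UNIV. X i)" "\<And>i. open (X i)" "(\<Pi>\<^sub>E i\<in>UNIV. X i) \<subseteq> W" by auto
  have "\<exists>e>0. ball (y i) e \<subseteq> X i" for i
    using X(1) X(2)[of i] unfolding open_contains_ball by auto
  then obtain e where e: "\<And>i. e i > 0" "\<And>i. ball (y i) (e i) \<subseteq> X i" by metis
  \<comment> \<open>The inserted 1 covers an empty \<open>I\<close>.\<close>
  define d where "d = Min (insert 1 (e ` I))"
  have d: "d > 0" "\<And>i. i \<in> I \<Longrightarrow> d \<le> e i"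
    using assms(2) e by (auto simp: d_def)
  show thesis
  proof
    show "d > 0" by fact
    fix y' assume y': "\<And>i. i \<in> I \<Longrightarrow> \<bar>y' i - y i\<bar> < d" "\<And>i. i \<notin> I \<Longrightarrow> y' i = y i"
    have "y' i \<in> ball (y i) (e i)" for i
    proof (cases "i \<in> I")
      case True
      then show ?thesis using y'(1)[of i] d(2)[of i] by (simp add: dist_real_def abs_minus_commute)
    next
      case False
      then show ?thesis using y'(2)[of i] e(1)[of i] by simp
    qed
    then have "y' \<in> (\<Pi>\<^sub>E i\<in>UNIV. X i)" using e(2) by blast
    then show "P y'" using X(3) W(3) by blast
  qed
qed

definition frac_point :: "'i set \<Rightarrow> ('i \<Rightarrow> real ^ 'n) \<Rightarrow> int ^ 'n \<Rightarrow> 'i \<Rightarrow> real" where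
  "frac_point I r x = restrict (\<lambda>i. frac (r i \<bullet> real_vec x)) I"

lemma frac_point_in_unit_cube: "frac_point I r x \<in> unit_cube I"
  by (auto simp: frac_point_def unit_cube_def frac_lt_1)

text \<open>The half-open cube contains one representative of each class modulo the integers, so the
  witness \<open>g\<close> can only be the point of fractional parts.\<close>

lemma quasiperiodic_set_iff:
  assumes "G \<subseteq> unit_cube I"
  shows "x \<in> quasiperiodic_set I r G \<longleftrightarrow> frac_point I r x \<in> G"
proof
  assume "x \<in> quasiperiodic_set I r G"
  then obtain g and z :: "'a \<Rightarrow> int" where g: "g \<in> G" "\<And>i. i \<in> I \<Longrightarrow> r i \<bullet> real_vec x = g i + of_int (z i)"
    unfolding quasiperiodic_set_def by blast
  have "g \<in> unit_cube I" using g(1) assms by blast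
  then have "frac_point I r x = g"
    by (auto simp: frac_point_def fun_eq_iff unit_cube_def PiE_iff extensional_def g(2) frac_unique_iff)
  then show "frac_point I r x \<in> G" using g(1) by simp
next
  assume "frac_point I r x \<in> G"
  then show "x \<in> quasiperiodic_set I r G"
    unfolding quasiperiodic_set_def
    by (intro CollectI bexI[of _ "frac_point I r x"] exI[of _ "\<lambda>i. \<lfloor>r i \<bullet> real_vec x\<rfloor>"])
      (auto simp: frac_point_def frac_def)
qed

section \<open>Outer approximation by grid cells\<close>

definition cell :: "'i set \<Rightarrow> nat \<Rightarrow> ('i \<Rightarrow> real) \<Rightarrow> 'i \<Rightarrow> nat" where
  "cell I M y = restrict (\<lambda>i. nat \<lfloor>M * y i\<rfloor>) I"

text \<open>The outer approximation of Jordan content: all grid cubes of side \<open>1 / M\<close>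
  that meet \<open>G\<close>.\<close>

definition outer_cells :: "'i set \<Rightarrow> nat \<Rightarrow> ('i \<Rightarrow> real) set \<Rightarrow> ('i \<Rightarrow> real) set" where
  "outer_cells I M G = {y \<in> unit_cube I. cell I M y \<in> cell I M ` G}"

lemma cell_image_bound:
  assumes "M > 0"
  shows "cell I M ` unit_cube I \<subseteq> (\<Pi>\<^sub>E i\<in>I. {..<M})"
proof
  fix c assume "c \<in> cell I M ` unit_cube I"
  then obtain y where y: "y \<in> unit_cube I" "c = cell I M y" by auto
  have "nat \<lfloor>M * y i\<rfloor> < M" if "i \<in> I" for i
  proof -
    have "0 \<le> y i" "y i < 1" using y(1) that by (auto simp: unit_cube_def PiE_iff)
    then have "M * y i < M" using assms by simp
    then show ?thesis using \<open>0 \<le> y i\<close> by (simp add: nat_less_iff floor_less_iff)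
  qed
  then show "c \<in> (\<Pi>\<^sub>E i\<in>I. {..<M})" by (auto simp: y(2) cell_def)
qed

lemma outer_cells_Union:
  assumes "M > 0" "G \<subseteq> unit_cube I"
  shows "outer_cells I M G = (\<Union>c\<in>cell I M ` G. \<Pi>\<^sub>E i\<in>I. {real (c i) / M..<(real (c i) + 1) / M})"
proof -
  have eq: "y \<in> unit_cube I \<and> cell I M y = c \<longleftrightarrow> y \<in> (\<Pi>\<^sub>E i\<in>I. {real (c i) / M..<(real (c i) + 1) / M})"
    if c: "c \<in> cell I M ` G" for c y
  proof -
    have cM: "c \<in> (\<Pi>\<^sub>E i\<in>I. {..<M})" using c cell_image_bound[OF assms(1)] assms(2) by blast
    have *: "0 \<le> t \<and> t < 1 \<and> nat \<lfloor>M * t\<rfloor> = k \<longleftrightarrow> t \<in> {real k / M..<(real k + 1) / M}" if "k < M" for t :: real and k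
    proof
      assume t: "0 \<le> t \<and> t < 1 \<and> nat \<lfloor>M * t\<rfloor> = k"
      then have "\<lfloor>M * t\<rfloor> = int k" using assms(1) by auto
      then have "real k \<le> M * t" "M * t < real k + 1" by linarith+
      then show "t \<in> {real k / M..<(real k + 1) / M}" using assms(1) by (auto simp: field_simps)
    next
      assume t: "t \<in> {real k / M..<(real k + 1) / M}"
      then have kt: "real k \<le> M * t" "M * t < real k + 1" using assms(1) by (auto simp: field_simps)
      then have "\<lfloor>M * t\<rfloor> = int k" by linarith
      moreover have "real k + 1 \<le> M" using that by linarith
      then have "M * t < M * 1" using kt by linarith
      then have "t < 1" using assms(1) by simp
      moreover have "0 \<le> M * t" using kt by linarith
      then have "0 \<le> t" using assms(1) by (simp add: zero_le_mult_iff)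
      ultimately show "0 \<le> t \<and> t < 1 \<and> nat \<lfloor>M * t\<rfloor> = k" by simp
    qed
    show ?thesis
    proof
      assume y: "y \<in> unit_cube I \<and> cell I M y = c"
      have "y i \<in> {real (c i) / M..<(real (c i) + 1) / M}" if i: "i \<in> I" for i
        using y i cM by (subst *[symmetric]) (auto simp: unit_cube_def PiE_iff cell_def)
      then show "y \<in> (\<Pi>\<^sub>E i\<in>I. {real (c i) / M..<(real (c i) + 1) / M})"
        using y by (auto simp: unit_cube_def PiE_iff)
    next
      assume y: "y \<in> (\<Pi>\<^sub>E i\<in>I. {real (c i) / M..<(real (c i) + 1) / M})"
      have "0 \<le> y i \<and> y i < 1 \<and> nat \<lfloor>M * y i\<rfloor> = c i" if i: "i \<in> I" for i
        using y i cM by (subst *) (auto simp: PiE_iff)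
      then show "y \<in> unit_cube I \<and> cell I M y = c"
        using y cM by (auto simp: unit_cube_def PiE_iff cell_def fun_eq_iff extensional_def)
    qed
  qed
  then show ?thesis unfolding outer_cells_def by blast
qed

lemma outer_cells_measure:
  assumes "finite I" "M > 0" "G \<subseteq> unit_cube I"
  shows "outer_cells I M G \<in> sets (PL I)" "measure (PL I) (outer_cells I M G) = card (cell I M ` G) * (1 / M) ^ card I"
proof -
  interpret product_sigma_finite "\<lambda>_. lborel :: real measure" by (rule product_sigma_finite_lborel)
  let ?B = "\<lambda>c. \<Pi>\<^sub>E i\<in>I. {real (c i) / M..<(real (c i) + 1) / M}"
  have sub: "cell I M ` G \<subseteq> (\<Pi>\<^sub>E i\<in>I. {..<M})" using cell_image_bound[OF assms(2), of I] assms(3) by blast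
  then have fin: "finite (cell I M ` G)" by (rule finite_subset) (auto intro!: finite_PiE assms(1))
  have U: "outer_cells I M G = (\<Union>c\<in>cell I M ` G. ?B c)"
    using outer_cells_Union[OF assms(2,3)] by (simp add: add.commute)
  have Bs: "?B c \<in> sets (PL I)" for c by (intro sets_PiM_I_finite assms) auto
  show "outer_cells I M G \<in> sets (PL I)"
    unfolding U by (intro sets.finite_UN fin Bs)
  have em: "emeasure (PL I) (?B c) = ennreal ((1 / M) ^ card I)" for c
  proof -
    have "emeasure (PL I) (?B c) = (\<Prod>i\<in>I. emeasure lborel {real (c i) / M..<(real (c i) + 1) / M})"
      by (rule emeasure_PiM) (use assms in auto)
    also have "\<dots> = (\<Prod>i\<in>I. ennreal (1 / M))"
      using assms(2) by (intro prod.cong refl) (simp add: divide_right_mono flip: diff_divide_distrib)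
    also have "\<dots> = ennreal ((1 / M) ^ card I)" by (simp add: ennreal_power)
    finally show ?thesis .
  qed
  have "measure (PL I) (\<Union>c\<in>cell I M ` G. ?B c) = (\<Sum>c\<in>cell I M ` G. measure (PL I) (?B c))"
  proof (rule measure_finite_Union[OF fin])
    show "disjoint_family_on ?B (cell I M ` G)"
      unfolding disjoint_family_on_def
    proof (intro ballI impI, rule ccontr)
      fix c d assume cd: "c \<in> cell I M ` G" "d \<in> cell I M ` G" "c \<noteq> d" "?B c \<inter> ?B d \<noteq> {}"
      then obtain y where y: "y \<in> ?B c" "y \<in> ?B d" by auto
      have "c i = d i" if "i \<in> I" for i
      proof -
        have "real (c i) / M \<le> y i" "y i < (real (c i) + 1) / M" "real (d i) / M \<le> y i" "y i < (real (d i) + 1) / M"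
          using y that by (auto simp: PiE_iff)
        then have "real (c i) / M < (real (d i) + 1) / M" "real (d i) / M < (real (c i) + 1) / M" by linarith+
        then have "real (c i) < real (d i) + 1" "real (d i) < real (c i) + 1"
          using assms(2) by (auto simp: divide_less_cancel)
        then show ?thesis by linarith
      qed
      then have "c = d" using sub cd(1,2) by (intro PiE_ext[of c I "\<lambda>_. {..<M}"]) auto
      then show False using cd by simp
    qed
  qed (use Bs em in auto)
  then show "measure (PL I) (outer_cells I M G) = card (cell I M ` G) * (1 / M) ^ card I"
    unfolding U by (simp add: measure_def em)
qed

text \<open>Where membership in \<open>G\<close> is locally constant, a sufficiently fine cube
  around \<open>y\<close> meets \<open>G\<close> only if \<open>y\<close> is in \<open>G\<close>; so
  the indicators converge almost everywhere, dominated by that of the unit cube. \<open>U\<close> is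
  a measurable version of \<open>G\<close>, which itself may lie outside
  \<open>sets (PL I)\<close>.\<close>

lemma outer_cells_tendsto:
  fixes I :: "'i::countable set"
  assumes "finite I" "G \<subseteq> unit_cube I" "AE y in PL I. loc_const (\<lambda>y. restrict y I \<in> G) y"
    and "U \<in> sets (PL I)" "AE y in PL I. y \<in> G \<longleftrightarrow> y \<in> U"
  shows "(\<lambda>M. measure (PL I) (outer_cells I (Suc M) G)) \<longlonglongrightarrow> measure (PL I) U"
proof -
  have "(\<lambda>M. integral\<^sup>L (PL I) (indicator (outer_cells I (Suc M) G) :: _ \<Rightarrow> real)) \<longlonglongrightarrow> integral\<^sup>L (PL I) (indicator U)"
  proof (rule integral_dominated_convergence[where w = "indicator (unit_cube I)"])
    show "integrable (PL I) (indicator (unit_cube I) :: _ \<Rightarrow> real)"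
      using unit_cube_in_sets[OF assms(1)] emeasure_unit_cube[OF assms(1)] by (simp add: integrable_indicator_iff)
    show "indicator (outer_cells I (Suc M) G) \<in> borel_measurable (PL I)" for M
      using outer_cells_measure(1)[OF assms(1) _ assms(2), of "Suc M"] by simp
    show "AE x in PL I. norm (indicator (outer_cells I (Suc M) G) x :: real) \<le> indicator (unit_cube I) x" for M
      by (auto simp: outer_cells_def indicator_def)
    show "AE y in PL I. (\<lambda>M. indicator (outer_cells I (Suc M) G) y :: real) \<longlonglongrightarrow> indicator U y"
      using assms(3,5) AE_space
    proof eventually_elim
      case (elim y)
      have r: "restrict y I = y" using elim by simp
      from elim(1) have "\<forall>\<^sub>F y' in nhds y. restrict y' I \<in> G \<longleftrightarrow> y \<in> G" unfolding loc_const_def r .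
      then obtain d where d: "d > 0" "\<And>y'. (\<And>i. i \<in> I \<Longrightarrow> \<bar>y' i - y i\<bar> < d) \<Longrightarrow>
          (\<And>i. i \<notin> I \<Longrightarrow> y' i = y i) \<Longrightarrow> restrict y' I \<in> G \<longleftrightarrow> y \<in> G"
        by (rule eventually_nhds_fun_ball[OF _ assms(1)]) (rule that, assumption, blast)
      \<comment> \<open>Beyond \<open>N\<close> the cubes have side below \<open>d\<close>, so two
        points of one cell differ by less than \<open>d\<close> in each coordinate.\<close>
      obtain N :: nat where N: "1 / d < real N" using reals_Archimedean2 by blast
      have "y \<in> outer_cells I (Suc M) G \<longleftrightarrow> y \<in> U" if "M \<ge> N" for M
      proof -
        have Md: "1 < real (Suc M) * d"
        proof -
          have "1 / d < real (Suc M)" using N that by linarith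
          then show ?thesis using d(1) by (simp add: field_simps)
        qed
        have "y \<in> G" if y: "y \<in> outer_cells I (Suc M) G"
        proof -
          obtain g where g: "g \<in> G" "cell I (Suc M) y = cell I (Suc M) g" and yc: "y \<in> unit_cube I"
            using y by (auto simp: outer_cells_def)
          have gc: "g \<in> unit_cube I" using g assms(2) by blast
          have "restrict g I \<in> G \<longleftrightarrow> y \<in> G"
          proof (rule d(2))
            fix i assume i: "i \<in> I"
            have pos: "0 \<le> real (Suc M) * y i" "0 \<le> real (Suc M) * g i" using yc gc i by (auto simp: unit_cube_def PiE_iff)
            have "nat \<lfloor>real (Suc M) * y i\<rfloor> = nat \<lfloor>real (Suc M) * g i\<rfloor>"
              using fun_cong[OF g(2), of i] i by (simp add: cell_def)
            then have "\<lfloor>real (Suc M) * y i\<rfloor> = \<lfloor>real (Suc M) * g i\<rfloor>"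
              using pos by (metis eq_nat_nat_iff zero_le_floor)
            then have "\<bar>real (Suc M) * g i - real (Suc M) * y i\<bar> < 1" by linarith
            then have "real (Suc M) * \<bar>g i - y i\<bar> < 1" by (simp add: abs_mult flip: right_diff_distrib)
            then have "real (Suc M) * \<bar>g i - y i\<bar> < real (Suc M) * d" using Md by linarith
            then show "\<bar>g i - y i\<bar> < d" by (simp add: mult_less_cancel_left)
          next
            fix i assume "i \<notin> I"
            then show "g i = y i" using yc gc by (simp add: unit_cube_def PiE_iff extensional_def)
          qed
          moreover have "restrict g I = g" using gc unfolding unit_cube_def by (rule PiE_restrict)
          ultimately show ?thesis using g(1) by simp
        qed
        moreover have "y \<in> outer_cells I (Suc M) G" if "y \<in> G"
          using that assms(2) by (auto simp: outer_cells_def)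
        ultimately show ?thesis using elim(2) by blast
      qed
      then have "eventually (\<lambda>M. indicator (outer_cells I (Suc M) G) y = (indicator U y :: real)) sequentially"
        unfolding eventually_sequentially by (intro exI[of _ N]) (auto simp: indicator_def)
      then show ?case by (rule tendsto_eventually)
    qed
  qed (use assms(4) in auto)
  moreover have "integral\<^sup>L (PL I) (indicator A :: _ \<Rightarrow> real) = measure (PL I) A" if "A \<in> sets (PL I)" for A
    using that sets.sets_into_space[OF that] by (simp add: Int_absorb2)
  ultimately show ?thesis
    using outer_cells_measure(1)[OF assms(1) _ assms(2)] assms(4) by simp
qed

text \<open>The finitely many grid cells that meet \<open>G\<close> cover it, and their frequency
  bounds add up to the measure of \<open>outer_cells\<close> plus an error shared equally among
  them.\<close>

lemma quasiperiodic_upper_freq: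
  fixes I :: "'i::countable set" and r :: "'i \<Rightarrow> real ^ 'n"
  assumes "finite I" "rat_free I r" "G \<subseteq> unit_cube I" "AE y in PL I. loc_const (\<lambda>y. restrict y I \<in> G) y"
    and "U \<in> sets (PL I)" "AE y in PL I. y \<in> G \<longleftrightarrow> y \<in> U" "e > 0"
  shows "\<forall>\<^sub>F P in box_filter. real (card (quasiperiodic_set I r G \<inter> P)) / real (card P) < measure (PL I) U + e"
proof -
  from outer_cells_tendsto[OF assms(1,3,4,5,6)]
  have "\<forall>\<^sub>F M in sequentially. measure (PL I) (outer_cells I (Suc M) G) < measure (PL I) U + e / 2"
    using assms(7) by (intro order_tendstoD) auto
  then obtain M0 where "measure (PL I) (outer_cells I (Suc M0) G) < measure (PL I) U + e / 2"
    by (auto simp: eventually_sequentially)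
  then obtain M where M: "M > 0" "measure (PL I) (outer_cells I M G) < measure (PL I) U + e / 2" by blast
  define C where "C = cell I M ` G"
  have sub: "C \<subseteq> (\<Pi>\<^sub>E i\<in>I. {..<M})" using cell_image_bound[OF M(1), of I] assms(3) by (auto simp: C_def)
  then have fin: "finite C" by (rule finite_subset) (auto intro!: finite_PiE assms(1))
  \<comment> \<open>The 1 added to \<open>card C\<close> avoids a division by zero and keeps the
    total error strictly below \<open>e / 2\<close>.\<close>
  define e' where "e' = e / 2 / (card C + 1)"
  have e': "e' > 0" "card C * e' < e / 2" using assms(7) by (auto simp: e'_def field_simps)
  let ?A = "\<lambda>c. {x. \<forall>i\<in>I. \<lfloor>M * frac (r i \<bullet> real_vec x)\<rfloor> = int (c i)}"
  have "\<forall>\<^sub>F P in box_filter. \<forall>c\<in>C. real (card (?A c \<inter> P)) / real (card P) \<le> (1 / M) ^ card I + e'"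
    using sub M(1) by (intro eventually_ball_finite fin ballI grid_cell_upper_freq assms e') auto
  then show ?thesis using eventually_box_filter_ok
  proof eventually_elim
    case (elim P)
    have "quasiperiodic_set I r G \<subseteq> (\<Union>c\<in>C. ?A c)"
    proof
      fix x assume "x \<in> quasiperiodic_set I r G"
      then have "frac_point I r x \<in> G" using quasiperiodic_set_iff[OF assms(3)] by blast
      then have "cell I M (frac_point I r x) \<in> C" by (simp add: C_def)
      moreover have "x \<in> ?A (cell I M (frac_point I r x))"
        by (auto simp: cell_def frac_point_def)
      ultimately show "x \<in> (\<Union>c\<in>C. ?A c)" by blast
    qed
    then have "quasiperiodic_set I r G \<inter> P \<subseteq> (\<Union>c\<in>C. ?A c \<inter> P)" by blast
    moreover have "finite (\<Union>c\<in>C. ?A c \<inter> P)" using fin elim by blast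
    ultimately have "card (quasiperiodic_set I r G \<inter> P) \<le> card (\<Union>c\<in>C. ?A c \<inter> P)"
      by (intro card_mono)
    also have "\<dots> \<le> (\<Sum>c\<in>C. card (?A c \<inter> P))" by (rule card_UN_le[OF fin])
    finally have "real (card (quasiperiodic_set I r G \<inter> P)) \<le> (\<Sum>c\<in>C. real (card (?A c \<inter> P)))"
      unfolding of_nat_sum[symmetric] of_nat_le_iff .
    then have "real (card (quasiperiodic_set I r G \<inter> P)) / card P \<le> (\<Sum>c\<in>C. real (card (?A c \<inter> P)) / card P)"
      unfolding sum_divide_distrib[symmetric] by (rule divide_right_mono) simp
    also have "\<dots> \<le> (\<Sum>c\<in>C. (1 / M) ^ card I + e')" using elim by (intro sum_mono) blast
    also have "\<dots> = measure (PL I) (outer_cells I M G) + card C * e'"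
      using outer_cells_measure(2)[OF assms(1) M(1) assms(3)] by (simp add: C_def distrib_left)
    finally show ?case using M(2) e'(2) by linarith
  qed
qed

text \<open>The lower bound is the upper bound for the complement in the unit cube, whose measurable
  version has measure \<open>1 - measure (PL I) U\<close>.\<close>

lemma quasiperiodic_has_freq:
  fixes I :: "'i::countable set" and r :: "'i \<Rightarrow> real ^ 'n"
  assumes "finite I" "rat_free I r" "G \<subseteq> unit_cube I" "AE y in PL I. loc_const (\<lambda>y. restrict y I \<in> G) y"
    and "U \<in> sets (PL I)" "AE y in PL I. y \<in> G \<longleftrightarrow> y \<in> U"
  shows "has_freq (quasiperiodic_set I r G) (measure (PL I) U)"
  unfolding has_freq_def
proof (rule order_tendstoI)
  fix a assume "measure (PL I) U < a"
  then show "\<forall>\<^sub>F P in box_filter. real (card (quasiperiodic_set I r G \<inter> P)) / real (card P) < a"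
    using quasiperiodic_upper_freq[OF assms, of "a - measure (PL I) U"] by simp
next
  fix a assume a: "a < measure (PL I) U"
  let ?G = "unit_cube I - G" and ?U = "unit_cube I - U"
  have cub: "unit_cube I \<in> sets (PL I)" by (rule unit_cube_in_sets[OF assms(1)])
  have "AE y in PL I. loc_const (\<lambda>y. restrict y I \<in> ?G) y"
    using AE_loc_const_unit_cube[OF assms(1)] assms(4)
    by eventually_elim (use loc_const_comp2[where h = "\<lambda>a b. a \<and> \<not> b"] in \<open>simp add: restrict_in_unit_cube_iff\<close>)
  moreover have "AE y in PL I. y \<in> ?G \<longleftrightarrow> y \<in> ?U" using assms(6) by eventually_elim auto
  ultimately have up: "\<forall>\<^sub>F P in box_filter. real (card (quasiperiodic_set I r ?G \<inter> P)) / real (card P)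
      < measure (PL I) ?U + (measure (PL I) U - a)"
    using a assms(5) cub by (intro quasiperiodic_upper_freq assms) auto
  have "measure (PL I) U = measure (PL I) (unit_cube I \<inter> U)"
    by (rule measure_eq_AE) (use assms(3,5,6) cub in \<open>auto elim!: eventually_mono\<close>)
  then have mU: "measure (PL I) ?U = 1 - measure (PL I) U"
    using measure_Diff[of "PL I" "unit_cube I" "unit_cube I \<inter> U"] cub assms(5) emeasure_unit_cube[OF assms(1)]
    by (simp add: Diff_Int measure_def)
  show "\<forall>\<^sub>F P in box_filter. a < real (card (quasiperiodic_set I r G \<inter> P)) / real (card P)"
    using up eventually_box_filter_ok
  proof eventually_elim
    case (elim P)
    have "P = (quasiperiodic_set I r G \<inter> P) \<union> (quasiperiodic_set I r ?G \<inter> P)"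
      using quasiperiodic_set_iff[OF assms(3), of _ r] quasiperiodic_set_iff[of ?G I _ r] frac_point_in_unit_cube[of I r] by auto
    moreover have "(quasiperiodic_set I r G \<inter> P) \<inter> (quasiperiodic_set I r ?G \<inter> P) = {}"
      using quasiperiodic_set_iff[OF assms(3), of _ r] quasiperiodic_set_iff[of ?G I _ r] by auto
    ultimately have "card P = card (quasiperiodic_set I r G \<inter> P) + card (quasiperiodic_set I r ?G \<inter> P)"
      using elim by (metis card_Un_disjoint finite_Int)
    then have "real (card (quasiperiodic_set I r ?G \<inter> P)) = real (card P) - real (card (quasiperiodic_set I r G \<inter> P))"
      by simp
    then have "real (card (quasiperiodic_set I r ?G \<inter> P)) / card P = 1 - real (card (quasiperiodic_set I r G \<inter> P)) / card P"
      using elim by (auto simp: diff_divide_distrib)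
    then show ?case using elim mU by linarith
  qed
qed

subsection \<open>Quantizers and preimage shapes\<close>

lemma real_vec_add: "real_vec (a + b) = real_vec a + real_vec b"
  by (simp add: real_vec_def vec_eq_iff)

lemma real_vec_diff: "real_vec (a - b) = real_vec a - real_vec b"
  by (simp add: real_vec_def vec_eq_iff)

lemma real_vec_minus: "real_vec (- a) = - real_vec a"
  by (simp add: real_vec_def vec_eq_iff)

lemma real_vec_0 [simp]: "real_vec 0 = 0"
  by (simp add: real_vec_def vec_eq_iff)

lemma real_vec_eq_iff [simp]: "real_vec a = real_vec b \<longleftrightarrow> a = b"
  by (auto simp: real_vec_def vec_eq_iff)

lemma countable_int_vec: "countable (UNIV :: (int ^ 'n::finite) set)"
proof -
  have "countable (range (vec_nth :: int ^ 'n \<Rightarrow> 'n \<Rightarrow> int))" by simp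
  moreover have "inj (vec_nth :: int ^ 'n \<Rightarrow> 'n \<Rightarrow> int)" by (auto simp: inj_def vec_eq_iff)
  ultimately show ?thesis by (rule countable_image_inj_on)
qed

lemma finite_bounded_lattice_points:
  assumes "bounded X" shows "finite {m :: int ^ 'n. real_vec m \<in> X}"
proof -
  obtain B where B: "\<And>x. x \<in> X \<Longrightarrow> norm x \<le> B" using assms unfolding bounded_iff by blast
  define K where "K = nat \<lceil>B\<rceil>"
  have "{m. real_vec m \<in> X} \<subseteq> lattice_box (\<chi> i. - int K) (\<chi> i. 2 * K + 1)"
  proof
    fix m :: "int ^ 'n" assume "m \<in> {m. real_vec m \<in> X}"
    then have *: "norm (real_vec m) \<le> B" using B by auto
    have "\<bar>m $ i\<bar> \<le> int K" for i
    proof -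
      have "\<bar>real_vec m $ i\<bar> \<le> norm (real_vec m)" by (rule component_le_norm_cart)
      then have "real_of_int \<bar>m $ i\<bar> \<le> B" using * by (simp add: real_vec_def)
      then show ?thesis unfolding K_def by linarith
    qed
    then have "- int K \<le> m $ i" "m $ i \<le> int K" for i
      using abs_le_iff[of "m $ i" "int K"] by force+
    then show "m \<in> lattice_box (\<chi> i. - int K) (\<chi> i. 2 * K + 1)" by (auto simp: lattice_box_def le_imp_less_Suc intro: order.strict_trans1)
  qed
  then show ?thesis by (rule finite_subset) simp
qed

lemma loc_const_not_frontier: "loc_const (\<lambda>u. u \<in> S) u \<Longrightarrow> u \<notin> frontier S"
proof -
  assume "loc_const (\<lambda>u. u \<in> S) u"
  then obtain W where W: "open W" "u \<in> W" "\<And>v. v \<in> W \<Longrightarrow> (v \<in> S) = (u \<in> S)"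
    unfolding loc_const_def eventually_nhds by auto
  show "u \<notin> frontier S"
  proof (cases "u \<in> S")
    case True
    then have "W \<subseteq> S" using W(3) by blast
    then have "u \<in> interior S" by (rule interiorI[OF W(1,2)])
    then show ?thesis by (simp add: frontier_def)
  next
    case False
    then have "W \<subseteq> - S" using W(3) by blast
    then have "u \<in> interior (- S)" by (rule interiorI[OF W(1,2)])
    then show ?thesis by (simp add: frontier_def interior_complement)
  qed
qed

lemma not_frontier_loc_const: "u \<notin> frontier S \<Longrightarrow> loc_const (\<lambda>u. u \<in> S) u"
proof -
  assume "u \<notin> frontier S"
  then consider "u \<in> interior S" | "u \<in> interior (- S)" by (auto simp: frontier_def interior_complement)
  then show ?thesis
  proof cases
    case 1
    then have "\<forall>\<^sub>F v in nhds u. v \<in> interior S" by (intro eventually_nhds_in_open) auto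
    then show ?thesis unfolding loc_const_def
      by eventually_elim (use 1 interior_subset[of S] in auto)
  next
    case 2
    then have "\<forall>\<^sub>F v in nhds u. v \<in> interior (- S)" by (intro eventually_nhds_in_open) auto
    then show ?thesis unfolding loc_const_def
      by eventually_elim (use 2 interior_subset[of "- S"] in auto)
  qed
qed

text \<open>Continuity of \<open>g\<close> is asked for at the single point \<open>y\<close>: inner
  maps such as \<open>pre_defect\<close> contain roundings and may jump elsewhere.\<close>

lemma loc_const_compose:
  assumes "(g \<longlongrightarrow> g y) (nhds y)" "loc_const f (g y)"
  shows "loc_const (\<lambda>y. f (g y)) y"
  using assms unfolding loc_const_def filterlim_iff by blast

lemma isCont_tendsto_nhds: "isCont g y \<Longrightarrow> (g \<longlongrightarrow> g y) (nhds y)"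
  by (simp add: continuous_within tendsto_at_iff_tendsto_nhds)

lemma loc_const_tendsto: "loc_const f y \<Longrightarrow> ((\<lambda>y. g (f y)) \<longlongrightarrow> g (f y)) (nhds y)"
  by (rule tendsto_eventually) (auto simp: loc_const_def elim: eventually_mono)

lemma negligible_borel_null:
  fixes S :: "'a::euclidean_space set"
  shows "negligible S \<Longrightarrow> S \<in> sets borel \<Longrightarrow> S \<in> null_sets lborel"
  by (simp add: negligible_iff_null_sets null_sets_completion_iff)

lemma borel_null_negligible:
  fixes S :: "'a::euclidean_space set"
  shows "S \<in> null_sets lborel \<Longrightarrow> negligible S"
  by (simp add: negligible_iff_null_sets null_sets_completionI)

lemma jordan_frontier_null:
  "jordan_measurable S \<Longrightarrow> frontier S \<in> null_sets lborel"
  unfolding jordan_measurable_def by (auto intro: negligible_borel_null frontier_closed)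

lemma quantizer_shift: "quantizer Q \<Longrightarrow> Q (u + real_vec z) = Q u + z"
  by (simp add: quantizer_def)

lemma quantizer_shift_diff: "quantizer Q \<Longrightarrow> Q (u - real_vec z) = Q u - z"
  using quantizer_shift[of Q u "- z"] by (simp add: real_vec_minus)

text \<open>By equivariance \<open>Q\<close> can jump only on the lattice translates of the frontier
  of its cell, which are countably many null sets.\<close>

lemma quantizer_loc_const:
  assumes "quantizer Q"
  obtains T where "T \<in> null_sets lborel" "\<And>u. u \<notin> T \<Longrightarrow> loc_const Q u"
proof
  let ?C = "Q -` {0}"
  let ?T = "\<Union>z\<in>UNIV. (\<lambda>v. real_vec z + v) ` frontier ?C"
  have j: "jordan_measurable ?C" using assms by (simp add: quantizer_def)
  show "?T \<in> null_sets lborel"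
  proof (rule null_sets_UN'[OF countable_int_vec])
    fix z :: "int ^ 'a"
    show "(\<lambda>v. real_vec z + v) ` frontier ?C \<in> null_sets lborel"
    proof (rule negligible_borel_null)
      show "negligible ((\<lambda>v. real_vec z + v) ` frontier ?C)"
        using j by (intro negligible_translation) (simp add: jordan_measurable_def)
      show "(\<lambda>v. real_vec z + v) ` frontier ?C \<in> sets borel"
        by (intro borel_closed closed_translation frontier_closed)
    qed
  qed
  fix u assume u: "u \<notin> ?T"
  have "u - real_vec (Q u) \<notin> frontier ?C"
  proof
    assume "u - real_vec (Q u) \<in> frontier ?C"
    then have "u \<in> (\<lambda>v. real_vec (Q u) + v) ` frontier ?C"
      by (intro image_eqI[of _ _ "u - real_vec (Q u)"]) auto
    then show False using u by blast
  qed
  then have "loc_const (\<lambda>v. v \<in> ?C) (u - real_vec (Q u))" by (rule not_frontier_loc_const)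
  then have "loc_const (\<lambda>v. v - real_vec (Q u) \<in> ?C) u"
    by (intro loc_const_compose[of "\<lambda>v. v - real_vec (Q u)"] tendsto_intros filterlim_ident)
  then show "loc_const Q u"
    unfolding loc_const_def by eventually_elim (simp add: quantizer_shift_diff[OF assms])
qed

lemma quantizer_translate:
  assumes "quantizer Q" shows "quantizer (\<lambda>u. Q (u + c))"
  unfolding quantizer_def
proof (intro conjI allI)
  show "Q (u + real_vec z + c) = Q (u + c) + z" for u z
    using quantizer_shift[OF assms, of "u + c" z] by (simp add: add_ac)
  have "(\<lambda>u. Q (u + c)) -` {0} = (\<lambda>v. - c + v) ` (Q -` {0})"
    by (auto intro!: image_eqI[of _ _ "_ + c"])
  then show "jordan_measurable ((\<lambda>u. Q (u + c)) -` {0})"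
    using assms unfolding quantizer_def jordan_measurable_def
    by (metis bounded_translation frontier_translation negligible_translation)
qed

section \<open>Preimage shapes along the compensating orbit\<close>

locale quantized_system =
  fixes R :: "real ^ 'n \<Rightarrow> int ^ 'n" and L :: "real ^ 'n ^ 'n"
  assumes quantizer_R: "quantizer R" and invertible_L: "invertible L"
begin

abbreviation Li :: "real ^ 'n ^ 'n" where "Li \<equiv> matrix_inv L"
abbreviation Rt :: "real ^ 'n \<Rightarrow> int ^ 'n" where "Rt \<equiv> comp_quantizer R L"

lemma quantizer_Rt: "quantizer Rt"
  using quantizer_translate[OF quantizer_R, of "(mat 1 + Li) *v cell_mean R"]
  by (simp add: comp_quantizer_def[abs_def])

lemma L_Li [simp]: "L *v (Li *v v) = v" "Li *v (L *v v) = v"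
proof -
  have "L ** Li = mat 1 \<and> Li ** L = mat 1"
    unfolding matrix_inv_def by (rule someI_ex) (use invertible_L in \<open>simp add: invertible_def\<close>)
  then show "L *v (Li *v v) = v" "Li *v (L *v v) = v" by (simp_all add: matrix_vector_mul_assoc)
qed

text \<open>For u = L^-1 x_k - x_(k+1) the condition says that the original system maps m + x_(k+1)
  into the translate of \<open>A\<close> by x_k.\<close>

definition next_shape :: "(int ^ 'n) set \<Rightarrow> real ^ 'n \<Rightarrow> (int ^ 'n) set" where
  "next_shape A u = {m. R (L *v (real_vec m - u)) \<in> A}"

lemma next_shape_eq_iff:
  "range real_vec \<inter> {u + Li *v (real_vec a + v) | a v. a \<in> A \<and> v \<in> R -` {0}} = real_vec ` B
    \<longleftrightarrow> next_shape A u = B"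
proof -
  have *: "real_vec m \<in> {u + Li *v (real_vec a + v) | a v. a \<in> A \<and> v \<in> R -` {0}} \<longleftrightarrow> m \<in> next_shape A u" for m
  proof
    assume "real_vec m \<in> {u + Li *v (real_vec a + v) | a v. a \<in> A \<and> v \<in> R -` {0}}"
    then obtain a v where av: "real_vec m = u + Li *v (real_vec a + v)" "a \<in> A" "R v = 0" by auto
    then have "L *v (real_vec m - u) = v + real_vec a" by (simp add: add.commute)
    then have "R (L *v (real_vec m - u)) = a" using quantizer_shift[OF quantizer_R, of v a] av(3) by simp
    then show "m \<in> next_shape A u" using av by (simp add: next_shape_def)
  next
    assume "m \<in> next_shape A u"
    then have a: "R (L *v (real_vec m - u)) \<in> A" by (simp add: next_shape_def)
    define a where "a = R (L *v (real_vec m - u))"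
    define v where "v = L *v (real_vec m - u) - real_vec a"
    have "R v = 0" by (simp add: v_def quantizer_shift_diff[OF quantizer_R] a_def)
    moreover have "real_vec m = u + Li *v (real_vec a + v)" by (simp add: v_def)
    ultimately show "real_vec m \<in> {u + Li *v (real_vec a + v) | a v. a \<in> A \<and> v \<in> R -` {0}}"
      using a by (auto simp: a_def)
  qed
  have "range real_vec \<inter> {u + Li *v (real_vec a + v) | a v. a \<in> A \<and> v \<in> R -` {0}} = real_vec ` next_shape A u"
    using * by blast
  then show ?thesis by (simp add: inj_image_eq_iff inj_def)
qed

definition shape_cell :: "(int ^ 'n) set \<Rightarrow> (int ^ 'n) set \<Rightarrow> (real ^ 'n) set" where
  "shape_cell B A = {u \<in> Rt -` {0}. next_shape A u = B}"

lemma shape_kernel_eq: "shape_kernel R L B A = measure lebesgue (shape_cell B A)"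
  unfolding shape_kernel_def shape_cell_def next_shape_eq_iff ..

text \<open>With a ball for \<open>X\<close>, this shows that only finitely many lattice points can
  enter or leave the shape near a given \<open>u\<close>.\<close>

lemma finite_near_next_shape:
  assumes "finite A" "bounded X"
  shows "finite {m. \<exists>u\<in>X. m \<in> next_shape A u}"
proof -
  have bC: "bounded (R -` {0})" using quantizer_R by (simp add: quantizer_def jordan_measurable_def)
  define Y where "Y = (\<Union>a\<in>real_vec ` A. \<Union>v\<in>R -` {0}. {a + v})"
  define Z where "Z = (\<Union>u\<in>X. \<Union>w\<in>(\<lambda>w. Li *v w) ` Y. {u + w})"
  have "bounded (real_vec ` A)" using assms(1) by (intro finite_imp_bounded) simp
  then have "bounded Y" unfolding Y_def using bC by (rule bounded_sums)
  then have "bounded ((\<lambda>w. Li *v w) ` Y)" by (rule bounded_linear_image) (rule matrix_vector_mul_bounded_linear)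
  with assms(2) have "bounded Z" unfolding Z_def by (rule bounded_sums)
  then have fin: "finite {m. real_vec m \<in> Z}" by (rule finite_bounded_lattice_points)
  show ?thesis
  proof (rule finite_subset[OF _ fin], safe)
    fix m u assume u: "u \<in> X" "m \<in> next_shape A u"
    define a where "a = R (L *v (real_vec m - u))"
    define v where "v = L *v (real_vec m - u) - real_vec a"
    have "a \<in> A" using u by (simp add: next_shape_def a_def)
    moreover have "R v = 0" by (simp add: v_def quantizer_shift_diff[OF quantizer_R] a_def)
    ultimately have "real_vec a + v \<in> Y" unfolding Y_def by blast
    moreover have "real_vec m = u + Li *v (real_vec a + v)" by (simp add: v_def)
    ultimately show "real_vec m \<in> Z" unfolding Z_def using u(1) by blast
  qed
qed

lemma finite_next_shape: "finite A \<Longrightarrow> finite (next_shape A u)"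
  using finite_near_next_shape[of A "{u}"] by simp

text \<open>Membership of a single \<open>m\<close> can change only where
  \<open>L *v (real_vec m - u)\<close> hits the jump set of \<open>R\<close>. There are countably
  many \<open>m\<close>, and near \<open>u\<close> only finitely many matter. One null set serves
  all finite \<open>A\<close>, so that \<open>A\<close> may later vary with the point.\<close>

lemma next_shape_loc_const:
  obtains T where "T \<in> null_sets lborel" "\<And>A u. finite A \<Longrightarrow> u \<notin> T \<Longrightarrow> loc_const (next_shape A) u"
proof -
  obtain T where T: "T \<in> null_sets lborel" "\<And>u. u \<notin> T \<Longrightarrow> loc_const R u"
    by (rule quantizer_loc_const[OF quantizer_R]) (rule that)
  let ?g = "\<lambda>m u. L *v (real_vec m - u)"
  have cont: "continuous_on UNIV (?g m)" for m
    by (intro continuous_intros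
        continuous_on_compose2[OF matrix_vector_mult_linear_continuous_on[of UNIV L]]) auto
  have "(\<Union>m\<in>UNIV. ?g m -` T) \<in> null_sets lborel"
  proof (rule null_sets_UN'[OF countable_int_vec])
    fix m :: "int ^ 'n"
    have Tb: "T \<in> sets borel" using T by auto
    show "?g m -` T \<in> null_sets lborel"
    proof (rule negligible_borel_null)
      show "?g m -` T \<in> sets borel"
        using measurable_sets[OF borel_measurable_continuous_onI[OF cont] Tb] by simp
      have "negligible T" by (rule borel_null_negligible[OF T(1)])
      then have "negligible ((\<lambda>v. real_vec m - Li *v v) ` T)"
        by (rule negligible_differentiable_image_negligible[OF order_refl])
          (intro differentiable_on_diff differentiable_on_const linear_imp_differentiable_on matrix_vector_mul_linear)
      moreover have "?g m -` T \<subseteq> (\<lambda>v. real_vec m - Li *v v) ` T"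
      proof
        fix u assume "u \<in> ?g m -` T"
        then have "?g m u \<in> T" by simp
        moreover have "u = real_vec m - Li *v (?g m u)" by simp
        ultimately show "u \<in> (\<lambda>v. real_vec m - Li *v v) ` T" by blast
      qed
      ultimately show "negligible (?g m -` T)" by (rule negligible_subset)
    qed
  qed
  moreover have "loc_const (next_shape A) u" if A: "finite A" and u: "u \<notin> (\<Union>m\<in>UNIV. ?g m -` T)" for A u
  proof -
    have lc: "loc_const (\<lambda>u. R (?g m u)) u" for m
    proof (rule loc_const_compose[where g = "?g m" and f = R])
      have "isCont (?g m) u" using cont[of m] by (simp add: continuous_on_eq_continuous_at)
      then show "(?g m \<longlongrightarrow> ?g m u) (nhds u)" by (rule isCont_tendsto_nhds)
      show "loc_const R (?g m u)" using u by (intro T) auto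
    qed
    define S where "S = {m. \<exists>v\<in>ball u 1. m \<in> next_shape A v}"
    have "finite S" unfolding S_def by (rule finite_near_next_shape[OF A]) simp
    then have "\<forall>\<^sub>F v in nhds u. \<forall>m\<in>S. R (?g m v) = R (?g m u)"
      using lc unfolding loc_const_def by (intro eventually_ball_finite) auto
    moreover have "\<forall>\<^sub>F v in nhds u. v \<in> ball u 1" by (intro eventually_nhds_in_open) auto
    ultimately show ?thesis unfolding loc_const_def
    proof eventually_elim
      case (elim v)
      have "m \<in> next_shape A v \<longleftrightarrow> m \<in> next_shape A u" for m
      proof (cases "m \<in> S")
        case True
        then show ?thesis using elim by (simp add: next_shape_def)
      next
        case False
        then show ?thesis using elim(2) by (auto simp: S_def)
      qed
      then show ?case by blast
    qed
  qed
  ultimately show thesis by (rule that)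
qed

lemma jordan_shape_cell:
  assumes "finite A" shows "jordan_measurable (shape_cell B A)"
proof -
  obtain T where T: "T \<in> null_sets lborel" "\<And>A u. finite A \<Longrightarrow> u \<notin> T \<Longrightarrow> loc_const (next_shape A) u"
    by (rule next_shape_loc_const) (rule that)
  obtain T' where T': "T' \<in> null_sets lborel" "\<And>u. u \<notin> T' \<Longrightarrow> loc_const Rt u"
    by (rule quantizer_loc_const[OF quantizer_Rt]) (rule that)
  have "frontier (shape_cell B A) \<subseteq> T \<union> T'"
  proof (rule ccontr)
    assume "\<not> frontier (shape_cell B A) \<subseteq> T \<union> T'"
    then obtain u where u: "u \<in> frontier (shape_cell B A)" "u \<notin> T" "u \<notin> T'" by blast
    have "loc_const (\<lambda>u. Rt u = 0 \<and> next_shape A u = B) u"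
      using T(2)[OF assms u(2)] T'(2)[OF u(3)]
      by (rule loc_const_comp2[where h = "\<lambda>a b. b = 0 \<and> a = B"])
    then have "loc_const (\<lambda>u. u \<in> shape_cell B A) u" by (simp add: shape_cell_def)
    then show False using loc_const_not_frontier u(1) by blast
  qed
  moreover have "negligible (T \<union> T')"
    using T(1) T'(1) by (intro negligible_Un borel_null_negligible)
  ultimately have "negligible (frontier (shape_cell B A))" using negligible_subset by blast
  moreover have "bounded (shape_cell B A)"
    by (rule bounded_subset[of "Rt -` {0}"])
      (use quantizer_Rt in \<open>auto simp: quantizer_def jordan_measurable_def shape_cell_def\<close>)
  ultimately show ?thesis by (simp add: jordan_measurable_def)
qed

abbreviation orbit :: "nat \<Rightarrow> int ^ 'n \<Rightarrow> int ^ 'n" where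
  "orbit k x \<equiv> (comp_transition R L ^^ k) x"

text \<open>The error u_(k+1) of the overview; the index here is lower by one.\<close>

definition defect :: "nat \<Rightarrow> int ^ 'n \<Rightarrow> real ^ 'n" where
  "defect k x = Li *v real_vec (orbit k x) - real_vec (orbit (Suc k) x)"

lemma defect_in_cell: "Rt (defect k x) = 0"
  unfolding defect_def quantizer_shift_diff[OF quantizer_Rt]
  by (simp add: comp_transition_def transition_def)

lemma preimage_shape_0: "preimage_shape R L 0 x = {0}"
  by (simp add: preimage_shape_def)

text \<open>A point belongs to the (k+1)-st preimage iff the original system maps it into the k-th
  one. Recentring the former by x_(k+1) and the latter by x_k is absorbed by the equivariance of
  \<open>R\<close>.\<close>

lemma preimage_shape_Suc:
  "preimage_shape R L (Suc k) x = next_shape (preimage_shape R L k x) (defect k x)"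
proof -
  let ?T = "transition R L"
  have iff: "m \<in> preimage_shape R L j x \<longleftrightarrow> (?T ^^ j) (m + orbit j x) = x" for m j
  proof
    assume "(?T ^^ j) (m + orbit j x) = x"
    then show "m \<in> preimage_shape R L j x"
      unfolding preimage_shape_def by (intro image_eqI[of _ _ "m + orbit j x"]) auto
  qed (auto simp: preimage_shape_def)
  have "m \<in> preimage_shape R L (Suc k) x \<longleftrightarrow> m \<in> next_shape (preimage_shape R L k x) (defect k x)" for m
  proof -
    have "L *v (real_vec m - defect k x) = L *v real_vec (m + orbit (Suc k) x) - real_vec (orbit k x)"
      unfolding defect_def real_vec_add
      by (simp add: matrix_vector_mult_diff_distrib matrix_vector_right_distrib algebra_simps)
    then have "R (L *v (real_vec m - defect k x)) = ?T (m + orbit (Suc k) x) - orbit k x"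
      by (simp only: quantizer_shift_diff[OF quantizer_R] transition_def)
    then show ?thesis
      unfolding next_shape_def mem_Collect_eq iff by (simp add: funpow_Suc_right del: funpow.simps(2))
  qed
  then show ?thesis by blast
qed

lemma finite_preimage_shape: "finite (preimage_shape R L k x)"
  by (induction k) (simp_all add: preimage_shape_0 preimage_shape_Suc finite_next_shape)

end

subsection \<open>Rounding errors as functions of torus coordinates\<close>

text \<open>\<open>F\<close> meets each lattice coset at most once and the unit cube meets it
  exactly once. Cutting along the shifts \<open>c + real_vec m\<close> and translating back
  rearranges the set in the cube into \<open>F\<close> without overlap, so its measure does not
  depend on \<open>c\<close>.\<close>

lemma emeasure_torus_slice:
  fixes F :: "(real ^ 'n) set"
  assumes F: "F \<in> sets borel" and inj: "\<And>u m. u \<in> F \<Longrightarrow> u + real_vec m \<in> F \<Longrightarrow> m = 0"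
  shows "emeasure lborel {w. (\<forall>i. 0 \<le> w $ i \<and> w $ i < 1) \<and> (\<exists>m. w - c - real_vec m \<in> F)} = emeasure lborel F"
proof -
  define Q :: "(real ^ 'n) set" where "Q = {w. \<forall>i. 0 \<le> w $ i \<and> w $ i < 1}"
  have "Q = (\<Inter>i. {w. 0 \<le> w $ i} \<inter> {w. w $ i < 1})" by (auto simp: Q_def)
  also have "\<dots> \<in> sets borel"
    by (intro sets.countable_INT'' sets.Int borel_closed borel_open closed_halfspace_component_ge_cart
        open_halfspace_component_lt_cart) auto
  finally have Q: "Q \<in> sets borel" .
  have shift: "(\<lambda>w. w + v) \<in> borel_measurable borel" "(\<lambda>w. w - v) \<in> borel_measurable borel"
    for v :: "real ^ 'n" by simp_all
  \<comment> \<open>\<open>X m\<close> is \<open>Y m\<close> translated by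
    \<open>c + real_vec m\<close>. The pieces \<open>X m\<close> are disjoint by \<open>inj\<close>,
    the pieces \<open>Y m\<close> because the cube is half-open with side 1.\<close>
  define X where "X m = {w. w \<in> Q \<and> w - (c + real_vec m) \<in> F}" for m
  define Y where "Y m = {u. u \<in> F \<and> u + (c + real_vec m) \<in> Q}" for m
  have Xs: "X m \<in> sets lborel" and Ys: "Y m \<in> sets lborel" for m
  proof -
    have "X m = Q \<inter> ((\<lambda>w. w - (c + real_vec m)) -` F \<inter> space borel)" by (auto simp: X_def)
    then show "X m \<in> sets lborel" using Q F measurable_sets[OF shift(2) F] by (metis sets.Int sets_lborel)
    have "Y m = F \<inter> ((\<lambda>w. w + (c + real_vec m)) -` Q \<inter> space borel)" by (auto simp: Y_def)
    then show "Y m \<in> sets lborel" using Q F measurable_sets[OF shift(1) Q] by (metis sets.Int sets_lborel)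
  qed
  have eq: "emeasure lborel (X m) = emeasure lborel (Y m)" for m
  proof -
    have "emeasure lborel (X m) = emeasure (distr lborel borel ((+) (c + real_vec m))) (X m)"
      by (simp add: lborel_distr_plus)
    also have "\<dots> = emeasure lborel ((+) (c + real_vec m) -` X m \<inter> space lborel)"
      using Xs by (intro emeasure_distr) auto
    also have "(+) (c + real_vec m) -` X m \<inter> space lborel = Y m"
      by (auto simp: X_def Y_def add_ac)
    finally show ?thesis .
  qed
  have "{w. (\<forall>i. 0 \<le> w $ i \<and> w $ i < 1) \<and> (\<exists>m. w - c - real_vec m \<in> F)} = (\<Union>m. X m)"
    by (auto simp: X_def Q_def diff_diff_eq)
  also have "emeasure lborel \<dots> = (\<integral>\<^sup>+m. emeasure lborel (X m) \<partial>count_space UNIV)"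
  proof (rule emeasure_UN_countable[OF Xs countable_int_vec])
    show "disjoint_family_on X UNIV"
      unfolding disjoint_family_on_def
    proof (intro ballI impI, rule ccontr)
      fix m m' :: "int ^ 'n" assume "m \<noteq> m'" "X m \<inter> X m' \<noteq> {}"
      then obtain w where "w - (c + real_vec m) \<in> F" "w - (c + real_vec m') \<in> F" by (auto simp: X_def)
      moreover have "w - (c + real_vec m') = w - (c + real_vec m) + real_vec (m - m')"
        by (simp add: real_vec_diff)
      ultimately have "m - m' = 0" using inj by metis
      then show False using \<open>m \<noteq> m'\<close> by simp
    qed
  qed
  also have "\<dots> = (\<integral>\<^sup>+m. emeasure lborel (Y m) \<partial>count_space UNIV)" by (simp add: eq)
  also have "\<dots> = emeasure lborel (\<Union>m. Y m)"
  proof (rule emeasure_UN_countable[OF Ys countable_int_vec, symmetric])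
    show "disjoint_family_on Y UNIV"
      unfolding disjoint_family_on_def
    proof (intro ballI impI, rule ccontr)
      fix m m' :: "int ^ 'n" assume "m \<noteq> m'" "Y m \<inter> Y m' \<noteq> {}"
      then obtain u where u: "u + (c + real_vec m) \<in> Q" "u + (c + real_vec m') \<in> Q" by (auto simp: Y_def)
      have "m $ i = m' $ i" for i
      proof -
        have "0 \<le> u $ i + (c $ i + m $ i)" "u $ i + (c $ i + m $ i) < 1"
          "0 \<le> u $ i + (c $ i + m' $ i)" "u $ i + (c $ i + m' $ i) < 1"
          using u by (auto simp: Q_def real_vec_def)
        then show ?thesis by linarith
      qed
      then show False using \<open>m \<noteq> m'\<close> by (simp add: vec_eq_iff)
    qed
  qed
  also have "(\<Union>m. Y m) = F"
  proof -
    \<comment> \<open>The floors give the integer vector that brings \<open>u + c\<close> into the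
      cube, so the pieces \<open>Y m\<close> exhaust \<open>F\<close>.\<close>
    have "u + (c + real_vec (\<chi> i. - \<lfloor>u $ i + c $ i\<rfloor>)) \<in> Q" for u
    proof -
      have "0 \<le> u $ i + (c $ i + - real_of_int \<lfloor>u $ i + c $ i\<rfloor>)" "u $ i + (c $ i + - real_of_int \<lfloor>u $ i + c $ i\<rfloor>) < 1" for i
        by linarith+
      then show ?thesis by (simp add: Q_def real_vec_def)
    qed
    then show ?thesis by (auto simp: Y_def)
  qed
  finally show ?thesis .
qed

lemma continuous_restrict: "continuous_on A (\<lambda>y :: 'i \<Rightarrow> real. restrict y I)"
proof (rule continuous_on_coordinatewise_then_product)
  fix i show "continuous_on A (\<lambda>y :: 'i \<Rightarrow> real. restrict y I i)"
    by (cases "i \<in> I") (simp_all add: continuous_coordinate)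
qed

lemma restrict_tendsto:
  fixes y :: "'i::countable \<Rightarrow> real"
  shows "((\<lambda>y. restrict y I) \<longlongrightarrow> restrict y I) (nhds y)"
  using continuous_on_interior[OF continuous_restrict[of UNIV I], of y] by (intro isCont_tendsto_nhds) simp

definition past_index :: "nat \<Rightarrow> (int \<times> 'n) set" where
  "past_index N = {- int N..-1} \<times> UNIV"

lemma finite_past_index [simp]: "finite (past_index N :: (int \<times> 'n::finite) set)"
  by (simp add: past_index_def)

lemma past_index_Suc:
  "past_index (Suc N) = past_index N \<union> {- int (Suc N)} \<times> UNIV"
  "past_index N \<inter> {- int (Suc N)} \<times> UNIV = {}"
  by (auto simp: past_index_def)

context quantized_system
begin

definition past_block :: "nat \<Rightarrow> (int \<times> 'n \<Rightarrow> real) \<Rightarrow> real ^ 'n" where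
  "past_block k y = (if k = 0 then 0 else blk (- int k) y)"

text \<open>At the coordinates of a lattice point \<open>x\<close>, \<open>lattice_part k\<close> is \<open>x\<^sub>k\<close> for \<open>k \<ge> 1\<close>. At \<open>k = 0\<close>
  both it and \<open>past_block 0\<close> are \<open>0\<close> instead of \<open>x\<close>; only their difference matters.\<close>

primrec lattice_part :: "nat \<Rightarrow> (int \<times> 'n \<Rightarrow> real) \<Rightarrow> int ^ 'n" where
  "lattice_part 0 y = 0"
| "lattice_part (Suc k) y = Rt (past_block (Suc k) y - Li *v (past_block k y - real_vec (lattice_part k y)))"

text \<open>At the coordinates of \<open>x\<close> this is L^-1 x_k, also for k = 0. It is written
  as the newest block translated by a function of the earlier ones.\<close>

definition pre_defect :: "nat \<Rightarrow> (int \<times> 'n \<Rightarrow> real) \<Rightarrow> real ^ 'n" where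
  "pre_defect k y = past_block (Suc k) y - Li *v (past_block k y - real_vec (lattice_part k y))"

definition defect_of :: "nat \<Rightarrow> (int \<times> 'n \<Rightarrow> real) \<Rightarrow> real ^ 'n" where
  "defect_of k y = pre_defect k y - real_vec (lattice_part (Suc k) y)"

primrec shape_of :: "nat \<Rightarrow> (int \<times> 'n \<Rightarrow> real) \<Rightarrow> (int ^ 'n) set" where
  "shape_of 0 y = {0}"
| "shape_of (Suc k) y = next_shape (shape_of k y) (defect_of k y)"

text \<open>These values are not reduced modulo 1; \<open>frac_point\<close> reduces them on a
  finite index set.\<close>

definition coordinates :: "int ^ 'n \<Rightarrow> int \<times> 'n \<Rightarrow> real" where
  "coordinates x p = power_rows L p \<bullet> real_vec x"

lemma lattice_part_Suc: "lattice_part (Suc k) y = Rt (pre_defect k y)"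
  by (simp add: pre_defect_def)

lemma matrix_powi_neg: "matrix_powi L (- int k) *v v = ((*v) Li ^^ k) v"
proof -
  have "((\<lambda>M. Li ** M) ^^ k) (mat 1) *v v = ((*v) Li ^^ k) v"
    by (induction k) (simp_all flip: matrix_vector_mul_assoc)
  then show ?thesis by (cases "k = 0") (simp_all add: matrix_powi_def)
qed

lemma past_block_coordinates:
  "k > 0 \<Longrightarrow> past_block k (coordinates x) = ((*v) Li ^^ k) (real_vec x)"
  by (simp add: past_block_def blk_def coordinates_def power_rows_def vec_eq_iff matrix_vector_mul_component
      flip: matrix_powi_neg) (simp add: row_def vec_nth_inverse)

lemma comp_transition_eq: "comp_transition R L z = Rt (Li *v real_vec z)"
  by (simp add: comp_transition_def transition_def)

text \<open>Both sides are 0 at \<open>k = 0\<close>; afterwards the vector to be rounded is L^-1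
  x_k, whose rounding is x_(k+1).\<close>

lemma lattice_part_coordinates:
  "past_block k (coordinates x) - real_vec (lattice_part k (coordinates x)) =
    ((*v) Li ^^ k) (real_vec x) - real_vec (orbit k x)"
proof (induction k)
  case (Suc k)
  have *: "past_block (Suc k) (coordinates x) = Li *v ((*v) Li ^^ k) (real_vec x)"
    by (simp add: past_block_coordinates)
  have "lattice_part (Suc k) (coordinates x) = orbit (Suc k) x"
    by (simp add: Suc * matrix_vector_mult_diff_distrib comp_transition_eq[of "orbit k x"])
  with * show ?case by (simp del: lattice_part.simps)
qed (simp add: past_block_def)

text \<open>The form d_(k+1) - L^-1 d_k of the error: only differences of a block and its lattice
  part enter, and these are invariant modulo 1.\<close>

lemma defect_of_eq:
  "defect_of k y = (past_block (Suc k) y - real_vec (lattice_part (Suc k) y))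
    - Li *v (past_block k y - real_vec (lattice_part k y))"
  by (simp add: defect_of_def pre_defect_def del: lattice_part.simps)

lemma defect_of_coordinates: "defect_of k (coordinates x) = defect k x"
  unfolding defect_of_eq lattice_part_coordinates defect_def
  by (simp add: matrix_vector_mult_diff_distrib)

lemma shape_of_coordinates: "shape_of k (coordinates x) = preimage_shape R L k x"
  by (induction k) (simp_all add: preimage_shape_0 preimage_shape_Suc defect_of_coordinates)

lemma finite_shape_of: "finite (shape_of k y)"
  by (induction k) (simp_all add: finite_next_shape)

text \<open>Nothing is compared off \<open>past_index N\<close>, so the relation covers both
  reduction modulo 1 and restriction to the index set.\<close>

definition equiv_mod1 :: "nat \<Rightarrow> (int \<times> 'n \<Rightarrow> real) \<Rightarrow> (int \<times> 'n \<Rightarrow> real) \<Rightarrow> bool" where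
  "equiv_mod1 N y y' \<longleftrightarrow> (\<forall>p\<in>past_index N. y p - y' p \<in> \<int>)"

lemma past_block_mod1:
  assumes "equiv_mod1 N y y'" "k \<le> N"
  shows "\<exists>m. past_block k y = past_block k y' + real_vec m"
proof (cases "k = 0")
  case True
  then show ?thesis by (intro exI[of _ 0]) (simp add: past_block_def)
next
  case False
  then have "y (- int k, i) - y' (- int k, i) \<in> \<int>" for i
    using assms unfolding equiv_mod1_def past_index_def by auto
  then have "\<forall>i. \<exists>m. y (- int k, i) - y' (- int k, i) = of_int m"
    by (meson Ints_cases)
  then obtain m where m: "\<And>i. y (- int k, i) - y' (- int k, i) = of_int (m i)" by metis
  have "y (- int k, i) = y' (- int k, i) + of_int (m i)" for i using m[of i] by simp
  then have "past_block k y = past_block k y' + real_vec (\<chi> i. m i)"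
    using False by (simp add: past_block_def blk_def real_vec_def vec_eq_iff)
  then show ?thesis ..
qed

text \<open>Given the claim for \<open>k\<close>, an integer shift of block \<open>Suc k\<close>
  shifts the vector to be rounded, hence the rounding, by the same amount and cancels in the
  difference.\<close>

lemma lattice_part_mod1:
  assumes "equiv_mod1 N y y'"
  shows "k \<le> N \<Longrightarrow> past_block k y - real_vec (lattice_part k y) = past_block k y' - real_vec (lattice_part k y')"
proof (induction k)
  case (Suc k)
  then obtain m where m: "past_block (Suc k) y = past_block (Suc k) y' + real_vec m"
    using past_block_mod1[OF assms] by blast
  have "pre_defect k y = pre_defect k y' + real_vec m"
    using Suc by (simp add: pre_defect_def m)
  then have "lattice_part (Suc k) y = lattice_part (Suc k) y' + m"
    unfolding lattice_part_Suc by (simp add: quantizer_shift[OF quantizer_Rt])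
  then show ?case by (simp add: m real_vec_add del: lattice_part.simps)
qed (simp add: past_block_def)

lemma defect_of_mod1:
  assumes "equiv_mod1 N y y'" "Suc k \<le> N"
  shows "defect_of k y = defect_of k y'"
  unfolding defect_of_eq lattice_part_mod1[OF assms] lattice_part_mod1[OF assms(1) Suc_leD[OF assms(2)]] ..

lemma shape_of_mod1:
  assumes "equiv_mod1 N y y'"
  shows "k \<le> N \<Longrightarrow> shape_of k y = shape_of k y'"
  by (induction k) (simp_all add: defect_of_mod1[OF assms])

lemma equiv_mod1_frac_point: "equiv_mod1 N (frac_point (past_index N) (power_rows L) x) (coordinates x)"
  by (auto simp: equiv_mod1_def frac_point_def coordinates_def frac_def)

lemma equiv_mod1_restrict: "equiv_mod1 N (restrict y (past_index N)) y"
  by (auto simp: equiv_mod1_def)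

section \<open>Local constancy almost everywhere on the torus\<close>

lemma continuous_past_block: "continuous_on A (past_block k)"
  by (cases "k = 0") (simp_all add: past_block_def[abs_def] continuous_blk)

lemma past_block_tendsto: "(past_block k \<longlongrightarrow> past_block k y) (nhds y)"
  using continuous_on_interior[OF continuous_past_block[of UNIV k], of y] by (intro isCont_tendsto_nhds) simp

lemma continuous_pre_defect_summand:
  "continuous_on A (\<lambda>y. - (Li *v (past_block k y - v)))"
  by (intro continuous_intros continuous_on_compose2[OF matrix_vector_mult_linear_continuous_on[of UNIV Li]]
      continuous_past_block) auto

text \<open>\<open>lattice_part k\<close> is not continuous, so it is replaced by each fixed
  \<open>z\<close> in turn. For fixed \<open>z\<close> the summand besides the newest block is
  continuous and depends on another block only, and countably many null sets are joined.\<close>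

lemma AE_pre_defect_notin:
  assumes "T \<in> null_sets lborel" "Suc k \<le> N"
  shows "AE y in PL (past_index N). pre_defect k y \<notin> T"
proof -
  have "AE y in PL (past_index N). \<forall>z\<in>UNIV. blk (- int (Suc k)) y + - (Li *v (past_block k y - real_vec z)) \<notin> T"
  proof (rule AE_ball_countable'[OF _ countable_int_vec])
    fix z :: "int ^ 'n"
    show "AE y in PL (past_index N). blk (- int (Suc k)) y + - (Li *v (past_block k y - real_vec z)) \<notin> T"
    proof (rule AE_blk_notin_null)
      show "{- int (Suc k)} \<times> UNIV \<subseteq> past_index N" using assms(2) by (auto simp: past_index_def)
      show "continuous_on UNIV (\<lambda>y. - (Li *v (past_block k y - real_vec z)))"
        by (rule continuous_pre_defect_summand)
      fix y y' :: "int \<times> 'n \<Rightarrow> real" assume "\<And>p. fst p \<noteq> - int (Suc k) \<Longrightarrow> y p = y' p"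
      then have "past_block k y = past_block k y'" by (simp add: past_block_def blk_def)
      then show "- (Li *v (past_block k y - real_vec z)) = - (Li *v (past_block k y' - real_vec z))" by simp
    qed (use assms in auto)
  qed
  then show ?thesis
  proof eventually_elim
    case (elim y)
    then show ?case by (simp add: pre_defect_def past_block_def)
  qed
qed

text \<open>The subtracted lattice part is unknown, so \<open>pre_defect\<close> has to avoid all
  lattice translates of \<open>T\<close>.\<close>

lemma AE_defect_of_notin:
  assumes "T \<in> null_sets lborel" "Suc k \<le> N"
  shows "AE y in PL (past_index N). defect_of k y \<notin> T"
proof -
  have "(\<Union>z\<in>UNIV. (\<lambda>u. u - real_vec z) -` T) \<in> null_sets lborel"
  proof (rule null_sets_UN'[OF countable_int_vec])
    fix z :: "int ^ 'n"
    have T: "T \<in> sets borel" using assms by auto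
    have "emeasure lborel T = emeasure (distr lborel borel ((+) (- real_vec z))) T"
      by (simp only: lborel_distr_plus)
    also have "\<dots> = emeasure lborel ((\<lambda>u. u - real_vec z) -` T)"
      using T by (subst emeasure_distr) (auto simp: vimage_def)
    finally have "emeasure lborel ((\<lambda>u. u - real_vec z) -` T) = 0" using assms by auto
    moreover have "(\<lambda>u. u - real_vec z) -` T \<in> sets borel"
      using measurable_sets[of "\<lambda>u. u - real_vec z" borel borel T] T by simp
    ultimately show "(\<lambda>u. u - real_vec z) -` T \<in> null_sets lborel" by auto
  qed
  from AE_pre_defect_notin[OF this assms(2)] show ?thesis
    by eventually_elim (auto simp: defect_of_def simp del: lattice_part.simps)
qed

lemma pre_defect_tendsto:
  assumes "loc_const (lattice_part k) y"
  shows "(pre_defect k \<longlongrightarrow> pre_defect k y) (nhds y)"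
proof -
  have "((\<lambda>y. Li *v (past_block k y - real_vec (lattice_part k y))) \<longlongrightarrow> Li *v (past_block k y - real_vec (lattice_part k y))) (nhds y)"
    by (intro bounded_linear.tendsto[OF matrix_vector_mul_bounded_linear] tendsto_diff past_block_tendsto
        loc_const_tendsto[OF assms, of real_vec])
  then show ?thesis unfolding pre_defect_def[abs_def] by (intro tendsto_diff past_block_tendsto)
qed

lemma defect_of_tendsto:
  assumes "loc_const (lattice_part k) y" "loc_const (lattice_part (Suc k)) y"
  shows "(defect_of k \<longlongrightarrow> defect_of k y) (nhds y)"
  unfolding defect_of_def[abs_def]
  by (intro tendsto_diff pre_defect_tendsto assms loc_const_tendsto[OF assms(2), of real_vec])

text \<open>Where \<open>lattice_part k\<close> is locally constant, \<open>pre_defect k\<close> is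
  continuous at that point, and almost everywhere it avoids the null set on which \<open>Rt\<close>
  jumps.\<close>

lemma AE_loc_const_lattice_part:
  "k \<le> N \<Longrightarrow> AE y in PL (past_index N). loc_const (lattice_part k) y"
proof (induction k)
  case 0
  then show ?case by (simp add: loc_const_def)
next
  case (Suc k)
  obtain T where T: "T \<in> null_sets lborel" "\<And>u. u \<notin> T \<Longrightarrow> loc_const Rt u"
    by (rule quantizer_loc_const[OF quantizer_Rt]) (rule that)
  have "AE y in PL (past_index N). loc_const (lattice_part k) y" using Suc by simp
  with AE_pre_defect_notin[OF T(1) Suc.prems] show ?case
  proof eventually_elim
    case (elim y)
    have "loc_const (\<lambda>y. Rt (pre_defect k y)) y"
      by (rule loc_const_compose[where g = "pre_defect k" and f = Rt]) (intro pre_defect_tendsto T elim)+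
    then show ?case by (simp add: lattice_part_Suc[abs_def] del: lattice_part.simps)
  qed
qed

lemma AE_loc_const_defect_of:
  assumes "Suc k \<le> N" "jordan_measurable E"
  shows "AE y in PL (past_index N). loc_const (\<lambda>y. defect_of k y \<in> E) y"
proof -
  have "AE y in PL (past_index N). loc_const (lattice_part k) y"
    using assms(1) by (intro AE_loc_const_lattice_part) simp
  with AE_loc_const_lattice_part[OF assms(1)] AE_defect_of_notin[OF jordan_frontier_null[OF assms(2)] assms(1)]
  show ?thesis
  proof eventually_elim
    case (elim y)
    show ?case
      by (rule loc_const_compose[where g = "defect_of k" and f = "\<lambda>u. u \<in> E"])
        (intro defect_of_tendsto not_frontier_loc_const elim)+
  qed
qed

lemma AE_loc_const_shape_of:
  "k \<le> N \<Longrightarrow> AE y in PL (past_index N). loc_const (shape_of k) y"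
proof (induction k)
  case 0
  then show ?case by (simp add: loc_const_def)
next
  case (Suc k)
  obtain T where T: "T \<in> null_sets lborel" "\<And>A u. finite A \<Longrightarrow> u \<notin> T \<Longrightarrow> loc_const (next_shape A) u"
    by (rule next_shape_loc_const) (rule that)
  have "AE y in PL (past_index N). loc_const (shape_of k) y"
    "AE y in PL (past_index N). loc_const (lattice_part k) y"
    using Suc AE_loc_const_lattice_part[of k N] by simp_all
  with AE_loc_const_lattice_part[OF Suc.prems] AE_defect_of_notin[OF T(1) Suc.prems]
  show ?case
  proof eventually_elim
    case (elim y)
    \<comment> \<open>The earlier shape is frozen at its value in \<open>y\<close>, which it keeps
      nearby; the null set \<open>T\<close> was chosen for all finite shapes at once.\<close>
    have "loc_const (\<lambda>y'. next_shape (shape_of k y) (defect_of k y')) y"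
      by (rule loc_const_compose[where g = "defect_of k" and f = "next_shape (shape_of k y)"])
        (intro defect_of_tendsto T finite_shape_of elim)+
    with elim(3) show ?case unfolding loc_const_def by eventually_elim simp
  qed
qed

end

context quantized_system
begin

subsection \<open>The Markov property\<close>

abbreviation past_set :: "nat \<Rightarrow> (int \<times> 'n \<Rightarrow> real) set \<Rightarrow> (int ^ 'n) set" where
  "past_set N G \<equiv> quasiperiodic_set (past_index N) (power_rows L) G"

abbreviation past_frac :: "nat \<Rightarrow> int ^ 'n \<Rightarrow> int \<times> 'n \<Rightarrow> real" where
  "past_frac N x \<equiv> frac_point (past_index N) (power_rows L) x"

lemma past_algebra_iff:
  "A \<in> past_algebra L N \<longleftrightarrow>
    (\<exists>G. A = past_set N G \<and> G \<subseteq> unit_cube (past_index N) \<and> jordan_measurable_on (past_index N) G)"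
  unfolding past_algebra_def quasiperiodic_algebra_def past_index_def unit_cube_def by blast

lemma unit_cube_jordan_measurable_onI:
  fixes I :: "'i::countable set"
  assumes "G \<subseteq> unit_cube I" "AE y in PL I. loc_const (\<lambda>y. restrict y I \<in> G) y"
  shows "jordan_measurable_on I G"
proof (rule jordan_measurable_onI[OF _ _ assms(2), where C = 1])
  show "G \<subseteq> (\<Pi>\<^sub>E i\<in>I. UNIV)" using assms(1) by (auto simp: unit_cube_def PiE_iff)
  fix g i assume "g \<in> G" "i \<in> I"
  then have "0 \<le> g i \<and> g i < 1" using assms(1) by (force simp: unit_cube_def PiE_iff)
  then show "\<bar>g i\<bar> \<le> 1" by simp
qed

text \<open>Invariance modulo 1 lets \<open>P\<close> be evaluated at the fractional parts, so the
  event is cut out by a subset of the cube; local constancy makes that subset Jordan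
  measurable.\<close>

lemma past_algebra_event:
  assumes "A \<in> past_algebra L N"
    and P: "\<And>y y'. equiv_mod1 N y y' \<Longrightarrow> P y = P y'" "AE y in PL (past_index N). loc_const P y"
  shows "A \<inter> {x. P (coordinates x)} \<in> past_algebra L N"
proof -
  obtain G where G: "A = past_set N G" "G \<subseteq> unit_cube (past_index N)" "jordan_measurable_on (past_index N) G"
    using assms(1) unfolding past_algebra_iff by blast
  define G' where "G' = {y \<in> G. P y}"
  have sub: "G' \<subseteq> unit_cube (past_index N)" using G by (auto simp: G'_def)
  have "A \<inter> {x. P (coordinates x)} = past_set N G'"
  proof (rule set_eqI)
    fix x
    have "P (past_frac N x) = P (coordinates x)" by (rule P(1)[OF equiv_mod1_frac_point])
    then show "x \<in> A \<inter> {x. P (coordinates x)} \<longleftrightarrow> x \<in> past_set N G'"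
      unfolding Int_iff mem_Collect_eq G(1) quasiperiodic_set_iff[OF sub] quasiperiodic_set_iff[OF G(2)]
      by (simp add: G'_def)
  qed
  moreover have "jordan_measurable_on (past_index N) G'"
  proof (rule unit_cube_jordan_measurable_onI[OF sub])
    show "AE y in PL (past_index N). loc_const (\<lambda>y. restrict y (past_index N) \<in> G') y"
      using jordan_measurable_onD[OF G(3)] P(2)
    proof eventually_elim
      case (elim y)
      from loc_const_comp2[OF this, of "(\<and>)"] show ?case
        by (simp add: G'_def P(1)[OF equiv_mod1_restrict])
    qed
  qed
  ultimately show ?thesis using sub unfolding past_algebra_iff by blast
qed

lemma UNIV_in_past_algebra: "UNIV \<in> past_algebra L N"
proof -
  have "past_set N (unit_cube (past_index N)) = UNIV"
    by (simp add: set_eq_iff quasiperiodic_set_iff frac_point_in_unit_cube)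
  moreover have "jordan_measurable_on (past_index N :: (int \<times> 'n) set) (unit_cube (past_index N))"
    using AE_loc_const_unit_cube[of "past_index N :: (int \<times> 'n) set"]
    by (intro unit_cube_jordan_measurable_onI) (simp_all add: restrict_in_unit_cube_iff)
  ultimately show ?thesis unfolding past_algebra_iff by blast
qed

lemma preimage_shape_event_in_past_algebra:
  assumes "A \<in> past_algebra L N"
  shows "A \<inter> preimage_shape R L N -` {s} \<in> past_algebra L N"
proof -
  have "A \<inter> {x. shape_of N (coordinates x) = s} \<in> past_algebra L N"
  proof (rule past_algebra_event[OF assms])
    show "(shape_of N y = s) = (shape_of N y' = s)" if "equiv_mod1 N y y'" for y y'
      using shape_of_mod1[OF that order_refl] by simp
    show "AE y in PL (past_index N). loc_const (\<lambda>y. shape_of N y = s) y"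
      using AE_loc_const_shape_of[OF order_refl]
      by eventually_elim (auto simp: loc_const_def elim: eventually_mono)
  qed
  then show ?thesis by (simp add: shape_of_coordinates vimage_def)
qed

lemma lattice_part_restrict: "lattice_part N (restrict y (past_index N)) = lattice_part N y"
proof -
  have b: "past_block N (restrict y (past_index N)) = past_block N y"
    by (simp add: past_block_def blk_def past_index_def vec_eq_iff)
  have "real_vec (lattice_part N (restrict y (past_index N))) = real_vec (lattice_part N y)"
    using lattice_part_mod1[OF equiv_mod1_restrict order_refl, of N y] unfolding b by simp
  then show ?thesis by simp
qed

text \<open>Supplies the measurable version of \<open>G\<close>: the interior is open, and it
  differs from \<open>G\<close> only on the frontier.\<close>

lemma AE_eq_interior:
  fixes I :: "'i::countable set"
  assumes "jordan_measurable_on I G"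
  shows "AE y in PL I. y \<in> G \<longleftrightarrow> y \<in> product_topology (\<lambda>_. euclidean) I interior_of G"
proof -
  let ?T = "product_topology (\<lambda>_. euclidean :: real topology) I"
  have null: "?T frontier_of G \<in> null_sets (PL I)" and sub: "G \<subseteq> topspace ?T"
    using assms by (auto simp: jordan_measurable_on_def)
  have "y \<in> ?T frontier_of G" if "\<not> (y \<in> G \<longleftrightarrow> y \<in> ?T interior_of G)" for y
    using that closure_of_subset[OF sub] interior_of_subset[of ?T G] by (auto simp: frontier_of_def)
  then show ?thesis by (intro AE_I'[OF null]) auto
qed

text \<open>The error \<open>defect N\<close> is uniform on the cell and independent of every event
  of level \<open>N\<close>. On the torus of level \<open>Suc N\<close>, the fibre of the joint
  event over a past point is a translate of \<open>E\<close> folded into the unit cube. Since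
  \<open>E\<close> lies in the cell, nothing overlaps and the fibre has the measure of
  \<open>E\<close>.\<close>

lemma one_step:
  assumes free: "\<And>N. rat_free (past_index N) (power_rows L)"
    and A: "A \<in> past_algebra L N" and E: "jordan_measurable E" "E \<subseteq> Rt -` {0}"
  obtains c where "has_freq A c" "A \<inter> {x. defect N x \<in> E} \<in> past_algebra L (Suc N)"
    "has_freq (A \<inter> {x. defect N x \<in> E}) (measure lebesgue E * c)"
proof -
  interpret product_sigma_finite "\<lambda>_. lborel :: real measure" by (rule product_sigma_finite_lborel)
  let ?I = "past_index N :: (int \<times> 'n) set" and ?I' = "past_index (Suc N) :: (int \<times> 'n) set"
  let ?J = "{- int (Suc N)} \<times> (UNIV :: 'n set)"
  have I': "?I' = ?I \<union> ?J" "?I \<inter> ?J = {}" by (rule past_index_Suc)+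
  obtain G where G: "A = past_set N G" "G \<subseteq> unit_cube ?I" "jordan_measurable_on ?I G"
    using A unfolding past_algebra_iff by blast
  define U where "U = product_topology (\<lambda>_. euclidean) ?I interior_of G"
  have Uop: "openin (product_topology (\<lambda>_. euclidean) ?I) U" unfolding U_def by (rule openin_interior_of)
  have UG: "U \<subseteq> G" unfolding U_def by (rule interior_of_subset)
  have Us: "U \<in> sets (PL ?I)" by (rule openin_sets_PL[OF Uop])
  have AEU: "AE y in PL ?I. y \<in> G \<longleftrightarrow> y \<in> U" unfolding U_def by (rule AE_eq_interior[OF G(3)])
  have freqA: "has_freq A (measure (PL ?I) U)"
    unfolding G(1) by (rule quasiperiodic_has_freq[OF _ free G(2) jordan_measurable_onD[OF G(3)] Us AEU]) simp
  define G' where "G' = {y \<in> unit_cube ?I'. restrict y ?I \<in> G \<and> defect_of N y \<in> E}"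
  have sub: "G' \<subseteq> unit_cube ?I'" by (auto simp: G'_def)
  have "restrict (past_frac (Suc N) x) ?I = past_frac N x" for x
    unfolding frac_point_def restrict_restrict using I' by (simp add: Int_absorb1 Un_upper1)
  moreover have "defect_of N (past_frac (Suc N) x) = defect N x" for x
    using defect_of_mod1[OF equiv_mod1_frac_point order_refl] by (simp add: defect_of_coordinates)
  ultimately have set_eq: "A \<inter> {x. defect N x \<in> E} = past_set (Suc N) G'"
    unfolding set_eq_iff Int_iff mem_Collect_eq G(1) quasiperiodic_set_iff[OF sub] quasiperiodic_set_iff[OF G(2)]
    by (simp add: G'_def frac_point_in_unit_cube)
  have res2: "restrict (restrict y ?I') ?I = restrict y ?I" for y :: "int \<times> 'n \<Rightarrow> real"
    using I' by (simp add: Int_absorb1 Un_upper1)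
  have AE_I': "AE y in PL ?I'. Q (restrict y ?I)" if "AE y in PL ?I. Q y" for Q
    using that I' by (intro AE_PL_restrict) auto
  have lcG': "AE y in PL ?I'. loc_const (\<lambda>y. restrict y ?I' \<in> G') y"
    using AE_loc_const_unit_cube[of ?I', OF finite_past_index] AE_I'[OF jordan_measurable_onD[OF G(3)]]
      AE_loc_const_defect_of[OF order_refl E(1)]
  proof eventually_elim
    case (elim y)
    have "loc_const (\<lambda>y. restrict y ?I' \<in> unit_cube ?I') y"
      using elim(1) by (simp add: restrict_in_unit_cube_iff)
    moreover have "loc_const (\<lambda>y. restrict y ?I \<in> G) y"
      using loc_const_compose[where g = "\<lambda>y. restrict y ?I", OF restrict_tendsto elim(2)] by simp
    moreover have "loc_const (\<lambda>y. defect_of N (restrict y ?I') \<in> E) y"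
      using elim(3) defect_of_mod1[OF equiv_mod1_restrict order_refl] by simp
    ultimately have "loc_const (\<lambda>y. restrict y ?I' \<in> unit_cube ?I' \<and> restrict y ?I \<in> G \<and> defect_of N (restrict y ?I') \<in> E) y"
      unfolding loc_const_def by eventually_elim auto
    then show ?case by (simp only: G'_def mem_Collect_eq res2)
  qed
  have mem: "A \<inter> {x. defect N x \<in> E} \<in> past_algebra L (Suc N)"
    using set_eq sub unit_cube_jordan_measurable_onI[OF sub lcG'] unfolding past_algebra_iff by blast
  \<comment> \<open>\<open>S\<close> is to be a measurable version of \<open>G'\<close>: the sets
    \<open>E\<close>, \<open>G\<close> and the level sets of \<open>lattice_part N\<close> are
    replaced by their interiors, and the two roundings are resolved into unions over their possible
    values \<open>z\<close> and \<open>m\<close>.\<close>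
  define F where "F = interior E"
  define Z where "Z z = interior {y. lattice_part N y = z}" for z
  define h where "h z m y = past_block (Suc N) y - Li *v (past_block N y - real_vec z) - real_vec m" for z m y
  define S where "S = {y \<in> space (PL ?I'). y \<in> {y. \<forall>p\<in>?I'. 0 \<le> y p \<and> y p < 1} \<inter>
     ({y. restrict y ?I \<in> U} \<inter> (\<Union>z. Z z \<inter> (\<Union>m. h z m -` F)))}"
  have conth: "continuous_on UNIV (h z m)" for z m
    unfolding h_def
    by (intro continuous_intros continuous_on_compose2[OF matrix_vector_mult_linear_continuous_on[of UNIV Li]]
      continuous_past_block) auto
  have "S \<in> sets (PL ?I')"
    unfolding S_def
  proof (rule PL_borel_in_sets, rule sets.Int)
    have "{y :: int \<times> 'n \<Rightarrow> real. \<forall>p\<in>?I'. 0 \<le> y p \<and> y p < 1} = (\<Inter>p\<in>?I'. (\<lambda>y. y p) -` {0..<1}) \<inter> UNIV"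
      by auto
    also have "\<dots> \<in> sets borel"
    proof -
      have "(\<lambda>y :: int \<times> 'n \<Rightarrow> real. y p) -` {0..<1} \<in> sets borel" for p :: "int \<times> 'n"
        using measurable_sets[OF borel_measurable_continuous_onI[OF continuous_coordinate[of UNIV p]], of "{0..<1}"] by simp
      then show ?thesis by (simp add: sets.countable_INT'' countable_finite)
    qed
    finally show "{y :: int \<times> 'n \<Rightarrow> real. \<forall>p\<in>?I'. 0 \<le> y p \<and> y p < 1} \<in> sets borel" .
    show "{y. restrict y ?I \<in> U} \<inter> (\<Union>z. Z z \<inter> (\<Union>m. h z m -` F)) \<in> sets borel"
      by (intro borel_open open_Int open_UN ballI open_vimage_restrict Uop open_vimage conth)
        (simp_all add: Z_def F_def)
  qed
  then have Ss: "S \<in> sets (PL ?I')" .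
  have loc_Z: "y \<in> Z z \<longleftrightarrow> z = lattice_part N y" if "loc_const (lattice_part N) y" for y z
  proof
    assume "y \<in> Z z"
    then show "z = lattice_part N y" using interior_subset unfolding Z_def by blast
  next
    assume z: "z = lattice_part N y"
    from that have "\<exists>W. open W \<and> y \<in> W \<and> (\<forall>v\<in>W. lattice_part N v = lattice_part N y)"
      unfolding loc_const_def eventually_nhds .
    then obtain W where W: "open W" "y \<in> W" "\<forall>v\<in>W. lattice_part N v = lattice_part N y"
      by (elim exE conjE)
    then have "W \<subseteq> {v. lattice_part N v = lattice_part N y}" by blast
    then show "y \<in> Z z" unfolding Z_def z by (rule interiorI[OF W(1,2)])
  qed
  have AES: "AE y in PL ?I'. y \<in> G' \<longleftrightarrow> y \<in> S"
    using AE_I'[OF AEU] AE_loc_const_lattice_part[OF le_SucI[OF order_refl]]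
      AE_defect_of_notin[OF jordan_frontier_null[OF E(1)] order_refl] AE_space
  proof eventually_elim
    case (elim y)
    have hd: "h (lattice_part N y) m y = pre_defect N y - real_vec m" for m
      by (simp add: h_def pre_defect_def)
    have "defect_of N y \<in> E \<longleftrightarrow> (\<exists>m. h (lattice_part N y) m y \<in> F)"
    proof
      assume "defect_of N y \<in> E"
      then have "defect_of N y \<in> F"
        using elim(3) closure_subset[of E] by (auto simp: frontier_def F_def)
      then show "\<exists>m. h (lattice_part N y) m y \<in> F" unfolding hd defect_of_def by blast
    next
      assume "\<exists>m. h (lattice_part N y) m y \<in> F"
      then obtain m where m: "pre_defect N y - real_vec m \<in> F" unfolding hd by blast
      then have mE: "pre_defect N y - real_vec m \<in> E" using interior_subset unfolding F_def by blast
      \<comment> \<open>\<open>Rt\<close> vanishes on \<open>E\<close>, so an \<open>m\<close> that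
        brings \<open>pre_defect N y\<close> into \<open>E\<close> can only be its rounding.\<close>
      then have "Rt (pre_defect N y - real_vec m) = 0" using E(2) by auto
      then have "lattice_part (Suc N) y = m"
        by (simp add: quantizer_shift_diff[OF quantizer_Rt] lattice_part_Suc del: lattice_part.simps)
      then show "defect_of N y \<in> E" using mE by (simp add: defect_of_def del: lattice_part.simps)
    qed
    moreover have "y \<in> unit_cube ?I' \<longleftrightarrow> (\<forall>p\<in>?I'. 0 \<le> y p \<and> y p < 1)"
      using restrict_in_unit_cube_iff[of y ?I'] elim(4) by simp
    ultimately show ?case
      using elim(1,4) loc_Z[OF elim(2)] unfolding S_def G'_def by auto
  qed
  \<comment> \<open>Independence is the constancy of this fibre measure on \<open>U\<close>.\<close>
  have slice: "AE x in PL ?I. emeasure (PL ?J) ((\<lambda>b. merge ?I ?J (x, b)) -` S \<inter> space (PL ?J)) =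
      emeasure lborel F * indicator U x"
    using AE_loc_const_lattice_part[OF order_refl] AE_space
  proof eventually_elim
    case (elim x)
    have res: "restrict (merge ?I ?J (x, b)) ?I = x" for b
      using elim(2) by (auto simp: space_PL restrict_def merge_def fun_eq_iff PiE_def extensional_def)
    show ?case
    proof (cases "x \<in> U")
      case False
      then have "merge ?I ?J (x, b) \<notin> S" for b
        unfolding S_def Int_iff mem_Collect_eq res by blast
      then have "(\<lambda>b. merge ?I ?J (x, b)) -` S \<inter> space (PL ?J) = {}" by blast
      then show ?thesis using False by simp
    next
      case True
      then have xc: "x \<in> unit_cube ?I" using UG G(2) by blast
      \<comment> \<open>The past acts on the newest block only through this translation.\<close>
      define c where "c = Li *v (past_block N x - real_vec (lattice_part N x))"
      let ?D = "{w. (\<forall>i. 0 \<le> w $ i \<and> w $ i < 1) \<and> (\<exists>m. w - c - real_vec m \<in> F)}"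
      have "(\<lambda>b. merge ?I ?J (x, b)) -` S \<inter> space (PL ?J) = blk (- int (Suc N)) -` ?D \<inter> space (PL ?J)"
      proof -
        have "merge ?I ?J (x, b) \<in> S \<longleftrightarrow> blk (- int (Suc N)) b \<in> ?D" if b: "b \<in> space (PL ?J)" for b
        proof -
          let ?y = "merge ?I ?J (x, b)"
          \<comment> \<open>\<open>lattice_part N\<close> ignores the coordinates outside
            \<open>?I\<close>, so its local constancy passes from \<open>x\<close> to the merged
            point.\<close>
          have "loc_const (\<lambda>y. lattice_part N (restrict y ?I)) ?y"
            by (rule loc_const_compose[where g = "\<lambda>y. restrict y ?I", OF restrict_tendsto]) (unfold res, rule elim(1))
          then have lc: "loc_const (lattice_part N) ?y" by (simp add: lattice_part_restrict)
          have lp: "lattice_part N ?y = lattice_part N x"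
            using lattice_part_restrict[of N ?y] unfolding res by simp
          have "past_block N ?y = past_block N (restrict ?y ?I)"
            by (simp add: past_block_def blk_def past_index_def vec_eq_iff)
          then have pb: "past_block N ?y = past_block N x" by (simp only: res)
          have pb': "past_block (Suc N) ?y = blk (- int (Suc N)) b"
            using I'(2) by (auto simp: past_block_def blk_def merge_def vec_eq_iff)
          have "?y \<in> space (PL ?I')" using elim(2) b by (auto simp: space_PL I'(1) merge_def PiE_iff extensional_def)
          moreover have "(\<forall>p\<in>?I'. 0 \<le> ?y p \<and> ?y p < 1) \<longleftrightarrow> (\<forall>i. 0 \<le> blk (- int (Suc N)) b $ i \<and> blk (- int (Suc N)) b $ i < 1)"
          proof -
            have "(\<forall>p\<in>?I'. 0 \<le> ?y p \<and> ?y p < 1) \<longleftrightarrow> (\<forall>p\<in>?I. 0 \<le> ?y p \<and> ?y p < 1) \<and> (\<forall>p\<in>?J. 0 \<le> ?y p \<and> ?y p < 1)"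
              unfolding I'(1) by blast
            also have "(\<forall>p\<in>?I. 0 \<le> ?y p \<and> ?y p < 1) \<longleftrightarrow> True"
              using xc by (auto simp: merge_def unit_cube_def PiE_iff)
            also have "(\<forall>p\<in>?J. 0 \<le> ?y p \<and> ?y p < 1) \<longleftrightarrow> (\<forall>p\<in>?J. 0 \<le> b p \<and> b p < 1)"
              using I'(2) by (intro ball_cong refl) (auto simp: merge_def)
            finally show ?thesis by (simp add: blk_def)
          qed
          moreover have "?y \<in> (\<Union>z. Z z \<inter> (\<Union>m. h z m -` F)) \<longleftrightarrow> (\<exists>m. blk (- int (Suc N)) b - c - real_vec m \<in> F)"
          proof -
            have hy: "h (lattice_part N x) m ?y = blk (- int (Suc N)) b - c - real_vec m" for m
              unfolding h_def pb pb' c_def ..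
            have "?y \<in> (\<Union>z. Z z \<inter> (\<Union>m. h z m -` F)) \<longleftrightarrow> (\<exists>m. h (lattice_part N x) m ?y \<in> F)"
              using loc_Z[OF lc, unfolded lp] by simp
            then show ?thesis unfolding hy .
          qed
          ultimately show ?thesis using True unfolding S_def Int_iff mem_Collect_eq res by blast
        qed
        then show ?thesis by blast
      qed
      also have "emeasure (PL ?J) \<dots> = emeasure lborel ?D"
      proof -
        note meas = blk_measurable[of "- int (Suc N)" ?J]
        have "?D = (\<Inter>i. {w. 0 \<le> w $ i} \<inter> {w. w $ i < 1}) \<inter> (\<Union>m. (\<lambda>w. w - c - real_vec m) -` F)" by auto
        also have "\<dots> \<in> sets borel"
          by (intro sets.Int sets.countable_INT'' borel_closed borel_open closed_halfspace_component_ge_cart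
              open_halfspace_component_lt_cart open_UN ballI open_vimage continuous_intros) (auto simp: F_def)
        finally have "?D \<in> sets borel" .
        from emeasure_distr[OF meas this] show ?thesis by (simp only: distr_blk_lborel)
      qed
      also have "\<dots> = emeasure lborel F"
      proof (rule emeasure_torus_slice)
        show "F \<in> sets borel" by (simp add: F_def)
        fix u m assume "u \<in> F" "u + real_vec m \<in> F"
        then have "Rt u = 0" "Rt (u + real_vec m) = 0" using E(2) interior_subset[of E] unfolding F_def by blast+
        then show "m = 0" by (simp add: quantizer_shift[OF quantizer_Rt])
      qed
      finally show ?thesis using True by simp
    qed
  qed
  have "emeasure (PL ?I') S = (\<integral>\<^sup>+x. emeasure (PL ?J) ((\<lambda>b. merge ?I ?J (x, b)) -` S \<inter> space (PL ?J)) \<partial>PL ?I)"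
    unfolding I'(1) by (rule emeasure_fold_integral[OF I'(2)]) (use Ss I'(1) in auto)
  also have "\<dots> = (\<integral>\<^sup>+x. emeasure lborel F * indicator U x \<partial>PL ?I)"
    by (rule nn_integral_cong_AE[OF slice])
  also have "\<dots> = emeasure lborel F * emeasure (PL ?I) U"
    using Us by (simp add: nn_integral_cmult_indicator)
  finally have "measure (PL ?I') S = measure lborel F * measure (PL ?I) U"
    by (simp add: measure_def enn2real_mult)
  \<comment> \<open>The frontier of \<open>E\<close> is null. The completed measure is needed on the
    right, as \<open>E\<close> may fail to be Borel.\<close>
  also have "measure lborel F = measure lebesgue E"
  proof -
    have "measure lebesgue E = measure lebesgue F"
      unfolding F_def using E(1) by (intro measure_interior[symmetric]) (auto simp: jordan_measurable_def)
    then show ?thesis by (simp add: F_def)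
  qed
  finally have "measure (PL ?I') S = measure lebesgue E * measure (PL ?I) U" .
  moreover have "has_freq (past_set (Suc N) G') (measure (PL ?I') S)"
    by (rule quasiperiodic_has_freq[OF _ free sub lcG' Ss AES]) simp
  ultimately show thesis using that[OF freqA mem] set_eq by simp
qed

end

theorem theorem13:
  fixes R :: "real ^ 'n \<Rightarrow> int ^ 'n" and L :: "real ^ 'n ^ 'n"
  assumes "quantizer R"
    and "invertible L"
    and "iteratively_nonresonant L"
  shows "homogeneous_markov_chain (past_algebra L) {B. finite B} (shape_kernel R L) (preimage_shape R L)
    \<and> (\<forall>N\<ge>1. \<forall>B :: nat \<Rightarrow> (int ^ 'n) set.
         B 0 = {0} \<and> (\<forall>k\<in>{1..N}. finite (B k)) \<longrightarrow>
           (\<Inter>k\<in>{1..N}. preimage_shape R L k -` {B k})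
              = {x. \<forall>k\<in>{1..N}. preimage_shape R L k x = B k} \<and>
           (\<Inter>k\<in>{1..N}. preimage_shape R L k -` {B k}) \<in> past_algebra L N \<and>
           freq_measurable (\<Inter>k\<in>{1..N}. preimage_shape R L k -` {B k}) \<and>
           freq (\<Inter>k\<in>{1..N}. preimage_shape R L k -` {B k})
              = (\<Prod>k=1..N. shape_kernel R L (B k) (B (k - 1))))"
proof -
  interpret quantized_system R L using assms(1,2) by unfold_locales
  have free: "rat_free (past_index N) (power_rows L)" for N
  proof (rule nonresonant_imp_rat_free[OF _ finite_past_index])
    have "past_index N \<subseteq> (UNIV - {0}) \<times> (UNIV :: 'n set)" by (auto simp: past_index_def)
    then show "nonresonant (past_index N) (power_rows L)"
      using assms(3) unfolding iteratively_nonresonant_def by simp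
  qed
  \<comment> \<open>Given the present shape \<open>s\<close>, the next one is \<open>t\<close> iff
    the error, which always lies in the cell, falls into \<open>shape_cell t s\<close>.\<close>
  have next_eq: "A \<inter> preimage_shape R L N -` {s} \<inter> preimage_shape R L (Suc N) -` {t} =
      (A \<inter> preimage_shape R L N -` {s}) \<inter> {x. defect N x \<in> shape_cell t s}" for A N s t
  proof (rule set_eqI)
    fix x
    show "x \<in> A \<inter> preimage_shape R L N -` {s} \<inter> preimage_shape R L (Suc N) -` {t} \<longleftrightarrow>
        x \<in> (A \<inter> preimage_shape R L N -` {s}) \<inter> {x. defect N x \<in> shape_cell t s}"
      by (cases "preimage_shape R L N x = s") (simp_all add: preimage_shape_Suc shape_cell_def defect_in_cell)
  qed
  have step: "\<exists>c. has_freq A c \<and> A \<inter> {x. defect N x \<in> shape_cell t s} \<in> past_algebra L (Suc N) \<and>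
      has_freq (A \<inter> {x. defect N x \<in> shape_cell t s}) (shape_kernel R L t s * c)"
    if A: "A \<in> past_algebra L N" and s: "finite s" for A N s t
  proof -
    have "shape_cell t s \<subseteq> Rt -` {0}" by (auto simp: shape_cell_def)
    then obtain c where "has_freq A c" "A \<inter> {x. defect N x \<in> shape_cell t s} \<in> past_algebra L (Suc N)"
      "has_freq (A \<inter> {x. defect N x \<in> shape_cell t s}) (measure lebesgue (shape_cell t s) * c)"
      by (rule one_step[OF free A jordan_shape_cell[OF s]]) (rule that)
    then show ?thesis unfolding shape_kernel_eq by blast
  qed
  have markov: "homogeneous_markov_chain (past_algebra L) {B. finite B} (shape_kernel R L) (preimage_shape R L)"
    unfolding homogeneous_markov_chain_def
  proof (intro conjI allI impI ballI)
    fix N :: nat assume N: "1 \<le> N"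
    show "past_algebra L N \<subseteq> past_algebra L (Suc N)"
    proof
      fix A assume "A \<in> past_algebra L N"
      \<comment> \<open>With the whole cell for \<open>E\<close> the condition on the error always
        holds, which embeds level \<open>N\<close> into level \<open>Suc N\<close>.\<close>
      moreover have "jordan_measurable (Rt -` {0})" using quantizer_Rt by (simp add: quantizer_def)
      ultimately have "A \<inter> {x. defect N x \<in> Rt -` {0}} \<in> past_algebra L (Suc N)"
        by (rule one_step[OF free]) auto
      then show "A \<in> past_algebra L (Suc N)" by (simp add: defect_in_cell)
    qed
    show "preimage_shape R L N x \<in> {B. finite B}" for x by (simp add: finite_preimage_shape)
    show "preimage_shape R L N -` {s} \<in> past_algebra L N" for s
      using preimage_shape_event_in_past_algebra[OF UNIV_in_past_algebra] by simp
    fix A and s t :: "(int ^ 'n) set" assume A: "A \<in> past_algebra L N" and s: "s \<in> {B. finite B}"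
    let ?A = "A \<inter> preimage_shape R L N -` {s}"
    obtain c where c: "has_freq ?A c" "has_freq (?A \<inter> {x. defect N x \<in> shape_cell t s}) (shape_kernel R L t s * c)"
      using step[OF preimage_shape_event_in_past_algebra[OF A], of s] s by blast
    show "freq_measurable ?A" by (rule has_freq_freq[OF c(1)])
    show "freq_measurable (?A \<inter> preimage_shape R L (Suc N) -` {t})"
      unfolding next_eq by (rule has_freq_freq[OF c(2)])
    show "freq (?A \<inter> preimage_shape R L (Suc N) -` {t}) = shape_kernel R L t s * freq ?A"
      unfolding next_eq has_freq_freq(2)[OF c(1)] by (rule has_freq_freq[OF c(2)])
  qed
  \<comment> \<open>Membership in the algebra is carried through the induction because
    \<open>step\<close> applies to events of level \<open>N\<close>.\<close>
  have product: "{x. \<forall>k\<in>{1..N}. preimage_shape R L k x = B k} \<in> past_algebra L N \<and>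
      has_freq {x. \<forall>k\<in>{1..N}. preimage_shape R L k x = B k} (\<Prod>k=1..N. shape_kernel R L (B k) (B (k - 1)))"
    if B0: "B 0 = {0}" and B: "\<forall>k\<in>{1..N}. finite (B k)" for N and B :: "nat \<Rightarrow> (int ^ 'n) set"
    using B
  proof (induction N)
    case 0
    \<comment> \<open>Level 0 has no coordinates: the empty intersection is everything, and its
      frequency 1 is the empty product.\<close>
    have "eventually (\<lambda>P. real (card (UNIV \<inter> P)) / real (card P) = 1) box_filter"
      using eventually_box_filter_ok by (rule eventually_mono) auto
    then have "has_freq (UNIV :: (int ^ 'n) set) 1" unfolding has_freq_def by (rule tendsto_eventually)
    then show ?case by (simp add: UNIV_in_past_algebra)
  next
    case (Suc N)
    let ?A = "{x. \<forall>k\<in>{1..N}. preimage_shape R L k x = B k}"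
    have IH: "?A \<in> past_algebra L N" "has_freq ?A (\<Prod>k=1..N. shape_kernel R L (B k) (B (k - 1)))"
      using Suc by auto
    have fin: "finite (B N)" using Suc.prems B0 by (cases "N = 0") auto
    \<comment> \<open>For \<open>N = 0\<close> no condition is imposed on \<open>x\<close>; there
      the initial value \<open>B 0 = {0}\<close> is the shape at time 0.\<close>
    have BN: "preimage_shape R L N x = B N" if "x \<in> ?A" for x
      using that B0 by (cases "N = 0") (auto simp: preimage_shape_0)
    have eq: "{x. \<forall>k\<in>{1..Suc N}. preimage_shape R L k x = B k} = ?A \<inter> {x. defect N x \<in> shape_cell (B (Suc N)) (B N)}"
    proof -
      have "(\<forall>k\<in>{1..Suc N}. preimage_shape R L k x = B k) \<longleftrightarrow> x \<in> ?A \<and> preimage_shape R L (Suc N) x = B (Suc N)" for x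
        by (auto simp: atLeastAtMostSuc_conv)
      then show ?thesis using BN by (auto simp: preimage_shape_Suc shape_cell_def defect_in_cell)
    qed
    obtain c where c: "has_freq ?A c" "?A \<inter> {x. defect N x \<in> shape_cell (B (Suc N)) (B N)} \<in> past_algebra L (Suc N)"
      "has_freq (?A \<inter> {x. defect N x \<in> shape_cell (B (Suc N)) (B N)}) (shape_kernel R L (B (Suc N)) (B N) * c)"
      using step[OF IH(1) fin] by blast
    have "c = (\<Prod>k=1..N. shape_kernel R L (B k) (B (k - 1)))" by (rule has_freq_unique[OF c(1) IH(2)])
    then show ?case using c(2,3) unfolding eq by (simp add: mult.commute)
  qed
  have eq: "(\<Inter>k\<in>{1..N}. preimage_shape R L k -` {B k}) = {x. \<forall>k\<in>{1..N}. preimage_shape R L k x = B k}"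
    for N and B :: "nat \<Rightarrow> (int ^ 'n) set" by auto
  show ?thesis
    unfolding eq
  proof (intro conjI allI impI)
    fix N :: nat and B :: "nat \<Rightarrow> (int ^ 'n) set"
    assume B: "B 0 = {0} \<and> (\<forall>k\<in>{1..N}. finite (B k))"
    note p = product[OF conjunct1[OF B] conjunct2[OF B]]
    show "{x. \<forall>k\<in>{1..N}. preimage_shape R L k x = B k} \<in> past_algebra L N"
      "freq_measurable {x. \<forall>k\<in>{1..N}. preimage_shape R L k x = B k}"
      "freq {x. \<forall>k\<in>{1..N}. preimage_shape R L k x = B k} = (\<Prod>k=1..N. shape_kernel R L (B k) (B (k - 1)))"
      using p has_freq_freq by blast+
  qed (fact markov | rule refl)+
qed

end
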